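(* Fix an integer $\Delta\ge 0$ and let $\mathcal{G}_U^\Delta$ be the class of unit disk graphs of maximum degree at most $\Delta$. Then $\mathcal{G}_U^\Delta$ has truly sublinear treewidth with parameter $\lambda=\frac12$; that is, for every $\eta>0$ there exists $\beta>0$ such that for every $G\in\mathcal{G}_U^\Delta$ and every $X\subseteq V(G)$ with $\mathbf{tw}(G\setminus X)\le\eta$ we have $\mathbf{tw}(G)\le \eta+\beta|X|^{1/2}$.
   Context: A unit disk graph is the intersection graph of a finite family of closed unit disks in $\mathbb{R}^2$: one vertex per disk, two vertices adjacent iff their disks intersect. $\mathbf{tw}(G)$ denotes the treewidth of $G$, and $G\setminus X$ denotes the subgraph of $G$ induced by $V(G)\setminus X$. A graph class $\mathcal{G}$ has truly sublinear treewidth with parameter $\lambda$, $0<\lambda<1$, if for every $\eta>0$ there is $\beta>0$ such that for every $G\in\mathcal{G}$ and $X\subseteq V(G)$, $\mathbf{tw}(G\setminus X)\le\eta$ implies $\mathbf{tw}(G)\le\eta+\beta|X|^\lambda$. *)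

theory Defs
  imports "HOL-Analysis.Analysis" "Graph_Theory.Graph_Theory"
begin

text \<open>
  Finite simple graphs are the symmetric digraphs of the locale \<^locale>\<open>graph\<close>.
  The constant \<open>tree\<close> of the library is unsuitable for them: it counts
  \<open>u, v, u\<close> as a cycle. A cycle of the underlying undirected graph is a directed
  cycle with at least three arcs.
\<close>

definition undirected_tree :: "('a, 'b) pre_digraph \<Rightarrow> bool" where
  "undirected_tree T \<longleftrightarrow>
     graph T \<and> Digraph_Component.connected T \<and>
     \<not> (\<exists>p. pre_digraph.cycle T p \<and> 3 \<le> length p)"

text \<open>
  Decomposition trees are finite, so taking their nodes in \<^typ>\<open>nat\<close> is no restriction.
\<close>

definition tree_decomposition ::
    "('a, 'b) pre_digraph \<Rightarrow> (nat, nat \<times> nat) pre_digraph \<Rightarrow> (nat \<Rightarrow> 'a set) \<Rightarrow> bool" where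
  "tree_decomposition G T B \<longleftrightarrow>
     undirected_tree T \<and>
     (\<Union>t\<in>verts T. B t) = verts G \<and>
     (\<forall>u v. u \<rightarrow>\<^bsub>G\<^esub> v \<longrightarrow> (\<exists>t\<in>verts T. u \<in> B t \<and> v \<in> B t)) \<and>
     (\<forall>v\<in>verts G. Digraph_Component.connected (T \<restriction> {t \<in> verts T. v \<in> B t}))"

definition decomposition_width :: "(nat, nat \<times> nat) pre_digraph \<Rightarrow> (nat \<Rightarrow> 'a set) \<Rightarrow> int" where
  "decomposition_width T B = int (MAX t\<in>verts T. card (B t)) - 1"

text \<open>The empty graph has treewidth \<open>-1\<close>.\<close>

definition treewidth :: "('a, 'b) pre_digraph \<Rightarrow> int" where
  "treewidth G = (LEAST w. \<exists>T B. tree_decomposition G T B \<and> w = decomposition_width T B)"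

definition delete_verts :: "('a, 'b) pre_digraph \<Rightarrow> 'a set \<Rightarrow> ('a, 'b) pre_digraph" where
  "delete_verts G X = G \<restriction> (verts G - X)"

text \<open>
  A family of disks may contain the same disk several times, so the map \<open>c\<close> from
  vertices to disk centres need not be injective.
\<close>

definition unit_disk_graph :: "('a, 'b) pre_digraph \<Rightarrow> bool" where
  "unit_disk_graph G \<longleftrightarrow>
     graph G \<and>
     (\<exists>c :: 'a \<Rightarrow> real ^ 2. \<forall>u\<in>verts G. \<forall>v\<in>verts G.
        u \<rightarrow>\<^bsub>G\<^esub> v \<longleftrightarrow> u \<noteq> v \<and> cball (c u) 1 \<inter> cball (c v) 1 \<noteq> {})"

text \<open>In a symmetric digraph without parallel arcs the degree of a vertex is its out-degree.\<close>

definition unit_disk_graphs_max_degree :: "nat \<Rightarrow> ('a, 'b) pre_digraph set" where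
  "unit_disk_graphs_max_degree \<Delta> =
     {G. unit_disk_graph G \<and> (\<forall>v\<in>verts G. out_degree G v \<le> \<Delta>)}"

definition truly_sublinear_treewidth :: "('a, 'b) pre_digraph set \<Rightarrow> real \<Rightarrow> bool" where
  "truly_sublinear_treewidth \<G> lam \<longleftrightarrow>
     0 < lam \<and> lam < 1 \<and>
     (\<forall>\<eta>::real. \<eta> > 0 \<longrightarrow>
       (\<exists>\<beta>::real. \<beta> > 0 \<and>
         (\<forall>G\<in>\<G>. \<forall>X. X \<subseteq> verts G \<longrightarrow>
            real_of_int (treewidth (delete_verts G X)) \<le> \<eta> \<longrightarrow>
            real_of_int (treewidth G) \<le> \<eta> + \<beta> * real (card X) powr lam)))"

text \<open>
  For finite graphs the minimum in the definition of treewidth is attained.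
\<close>

lemma undirected_tree_singleton:
  "undirected_tree \<lparr>verts = {a}, arcs = {}, tail = fst, head = snd\<rparr>"
proof -
  let ?T = "\<lparr>verts = {a}, arcs = {}, tail = fst, head = snd\<rparr> :: ('a, 'a \<times> 'a) pre_digraph"
  have g: "graph ?T"
    by unfold_locales (auto simp: symmetric_def arcs_ends_def sym_def)
  then interpret T: graph ?T .
  have "Digraph_Component.connected ?T"
    unfolding connected_conv by (auto intro: rtrancl_on_refl)
  moreover have "\<not> T.cycle p" for p
    by (cases p) (auto simp: T.cycle_def T.awalk_def)
  ultimately show ?thesis using g by (simp add: undirected_tree_def)
qed

lemma tree_decomposition_exists:
  fixes G :: "('a, 'b) pre_digraph"
  assumes "graph G"
  shows "\<exists>T B. tree_decomposition G T B"
proof -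
  interpret G: graph G by fact
  let ?T = "\<lparr>verts = {0}, arcs = {}, tail = fst, head = snd\<rparr> :: (nat, nat \<times> nat) pre_digraph"
  have t: "undirected_tree ?T" by (rule undirected_tree_singleton)
  have e: "?T \<restriction> {0} = ?T" by (simp add: induce_subgraph_def)
  have "tree_decomposition G ?T (\<lambda>_. verts G)"
    using t by (auto simp: e tree_decomposition_def undirected_tree_def dest: G.adj_in_verts)
  then show ?thesis by blast
qed

lemma decomposition_width_ge: "decomposition_width T B \<ge> -1"
  by (simp add: decomposition_width_def)

lemma
  assumes "graph G"
  shows treewidth_attained: "\<exists>T B. tree_decomposition G T B \<and> treewidth G = decomposition_width T B"
    and treewidth_le: "tree_decomposition G T B \<Longrightarrow> treewidth G \<le> decomposition_width T B"
proof -
  define P where "P w \<longleftrightarrow> (\<exists>T B. tree_decomposition G T B \<and> w = decomposition_width T B)" for w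
  obtain w0 where w0: "P w0" using tree_decomposition_exists[OF assms] by (auto simp: P_def)
  have lb: "w \<ge> -1" if "P w" for w using that decomposition_width_ge by (auto simp: P_def)
  define n where "n = (LEAST n. P (int n - 1))"
  have "P (int (nat (w0 + 1)) - 1)" using w0 lb[OF w0] by simp
  then have Pn: "P (int n - 1)" unfolding n_def by (rule LeastI)
  have least: "int n - 1 \<le> w" if "P w" for w
  proof -
    have "P (int (nat (w + 1)) - 1)" using that lb[OF that] by simp
    then have "n \<le> nat (w + 1)" unfolding n_def by (rule Least_le)
    then show ?thesis using lb[OF that] by simp
  qed
  have tw: "treewidth G = int n - 1"
    unfolding treewidth_def P_def[symmetric] by (rule Least_equality) (use Pn least in auto)
  show "\<exists>T B. tree_decomposition G T B \<and> treewidth G = decomposition_width T B"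
    using Pn unfolding tw P_def .
  show "tree_decomposition G T B \<Longrightarrow> treewidth G \<le> decomposition_width T B"
    unfolding tw by (rule least) (auto simp: P_def)
qed

end

theory Submission
  imports Defs
begin

text \<open>
  Two edges of a unit disk graph whose segments come close have adjacent end points, by Stewart's
  identity. Rasterising the segments on the grid \<open>\<int>\<^sup>2\<close> at a fixed scale therefore gives a finite
  subgraph \<open>Q\<close> of the planar grid such that \<open>G\<close> and \<open>Q\<close> control each other's treewidth up to
  factors depending on \<open>\<Delta>\<close>, and \<open>X\<close> becomes a set of \<open>O(|X|)\<close> grid points.

  In the grid, a tree decomposition of \<open>Q - X\<close> of width \<open>O(\<eta>)\<close> yields a core of \<open>O(|X|)\<close> vertices
  containing \<open>X\<close> such that every component of the rest has \<open>O(\<eta>)\<close> neighbours, all in the core.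
  Contracting these components leaves a minor of the grid with \<open>O(|X|)\<close> vertices. The grid has no \<open>K\<^sub>5\<close>
  minor: for vertex-disjoint walks, the parity of the crossings of one with vertical rays from
  the ends of the other depends on the four ends only, and summing over the disjoint edge pairs of
  \<open>K\<^sub>5\<close> gives a contradiction. Hence the separator theorem of Alon, Seymour and Thomas applies and
  \<open>O(\<surd>|X|)\<close> vertices of \<open>Q\<close> split \<open>X\<close> in halves. Recursion gives a geometric series.
\<close>

text \<open>A separator theorem is of no use on the disk graph itself: it may contain cliques of
  order \<open>\<Delta> + 1\<close>, and its number of vertices is not bounded in terms of
  \<open>X\<close>. The first obstacle is the reason for the grid, where the exclusion of one minor
  suffices and no plane embedding is handled. The second is the reason for the core: a separator of
  order sqrt |Q| is too large, since \<open>Q\<close> may be much bigger than \<open>X\<close>.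

  Constant factors can be lost freely. For nonempty \<open>X\<close> the term |X|^(1/2) is at least
  1, so everything that depends on \<open>\<eta>\<close> and \<open>\<Delta>\<close> only goes into
  \<open>\<beta>\<close>; for empty \<open>X\<close> the exact bound \<open>\<eta>\<close> is
  required, but then nothing has been deleted. What must not pile up is the width along the
  recursion. It does not: a component \<open>C\<close> of \<open>Q - S\<close> inherits a
  decomposition of \<open>C - X\<close> with the same bag size from that of \<open>Q - X\<close>,
  and only the separators add up.

  The degree bound enters on the way back from the grid to the disk graph, where it limits the
  number of disks that use one grid point.\<close>

section \<open>Connected sets and rooted tree decompositions\<close>

text \<open>Connectedness by cuts instead of paths, so that closure arguments need no walks. The
  empty set counts as connected; nonemptiness is demanded separately where it matters.\<close>

definition conn :: "('a \<Rightarrow> 'a \<Rightarrow> bool) \<Rightarrow> 'a set \<Rightarrow> bool" where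
  "conn E C \<longleftrightarrow>
     (\<forall>S\<subseteq>C. S \<noteq> {} \<longrightarrow> (\<forall>a\<in>S. \<forall>b\<in>C. E a b \<longrightarrow> b \<in> S) \<longrightarrow> S = C)"

text \<open>Overlap counts as contact, because the connected sets that stand for vertices in
  \<open>td_transfer\<close> may intersect.\<close>

definition touch :: "('a \<Rightarrow> 'a \<Rightarrow> bool) \<Rightarrow> 'a set \<Rightarrow> 'a set \<Rightarrow> bool" where
  "touch E C D \<longleftrightarrow> (\<exists>x\<in>C. \<exists>y\<in>D. x = y \<or> E x y)"

lemma touch_commute: "symp E \<Longrightarrow> touch E C D \<longleftrightarrow> touch E D C"
  unfolding touch_def by (metis sympD)

lemma conn_empty [simp]: "conn E {}"
  by (auto simp: conn_def)

lemma conn_singleton [simp]: "conn E {x}"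
  unfolding conn_def by blast

text \<open>Induction along edges: \<open>A \<inter> D\<close> is a nonempty part of
  \<open>D\<close> that no edge inside \<open>D\<close> leaves.\<close>

lemma conn_closed_subset:
  assumes "conn E D" "x \<in> D" "x \<in> A"
    and "\<And>a b. a \<in> A \<Longrightarrow> a \<in> D \<Longrightarrow> b \<in> D \<Longrightarrow> E a b \<Longrightarrow> b \<in> A"
  shows "D \<subseteq> A"
proof -
  have "A \<inter> D = D"
    using assms(1)[unfolded conn_def, rule_format, of "A \<inter> D"] assms(2-4) by blast
  then show ?thesis by blast
qed

text \<open>A closed part that meets some \<open>C i\<close> gets into \<open>C0\<close> through the
  contact of the two, which uses symmetry; from \<open>C0\<close> it spreads to every other
  member.\<close>

lemma conn_UN:
  assumes sym: "symp E" and C0: "conn E C0"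
    and C: "\<And>i. i \<in> I \<Longrightarrow> conn E (C i)" "\<And>i. i \<in> I \<Longrightarrow> touch E C0 (C i)"
  shows "conn E (C0 \<union> (\<Union>i\<in>I. C i))"
  unfolding conn_def
proof (intro allI impI)
  let ?U = "C0 \<union> (\<Union>i\<in>I. C i)"
  fix S assume S: "S \<subseteq> ?U" "S \<noteq> {}" "\<forall>a\<in>S. \<forall>b\<in>?U. E a b \<longrightarrow> b \<in> S"
  have C0S: "C0 \<subseteq> S" if "x \<in> S" "x \<in> C0" for x
    by (rule conn_closed_subset[OF C0 that(2,1)]) (use S(3) in blast)
  have CiS: "C i \<subseteq> S" if "i \<in> I" "x \<in> S" "x \<in> C i" for i x
    by (rule conn_closed_subset[OF C(1)[OF that(1)] that(3,2)]) (use S(3) that(1) in blast)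
  have "\<exists>x. x \<in> S \<and> x \<in> C0"
  proof -
    obtain x where x: "x \<in> S" using S(2) by blast
    show ?thesis
    proof (cases "x \<in> C0")
      case False
      then obtain i where i: "i \<in> I" "x \<in> C i" using x S(1) by blast
      obtain a b where ab: "a \<in> C0" "b \<in> C i" "a = b \<or> E a b"
        using C(2)[OF i(1)] by (auto simp: touch_def)
      have "b \<in> S" using CiS[OF i(1) x i(2)] ab(2) by blast
      moreover have "E b a" if "a \<noteq> b" using ab(3) that sym by (auto dest: sympD)
      ultimately have "a \<in> S" using ab(1) S(3) by (cases "a = b") auto
      then show ?thesis using ab(1) by blast
    qed (use x in blast)
  qed
  then have "C0 \<subseteq> S" using C0S by blast
  moreover have "C i \<subseteq> S" if i: "i \<in> I" for i
  proof -
    obtain a b where ab: "a \<in> C0" "b \<in> C i" "a = b \<or> E a b"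
      using C(2)[OF i] by (auto simp: touch_def)
    have "b \<in> S" using \<open>C0 \<subseteq> S\<close> ab S(3) i by blast
    then show ?thesis using CiS i ab(2) by blast
  qed
  ultimately show "S = ?U" using S(1) by blast
qed

lemma conn_Un:
  assumes "symp E" "conn E C" "conn E D" "touch E C D"
  shows "conn E (C \<union> D)"
  using conn_UN[of E C "{()}" "\<lambda>_. D"] assms by simp

lemma conn_Un_Int:
  assumes "symp E" "conn E C" "conn E D" "x \<in> C" "x \<in> D"
  shows "conn E (C \<union> D)"
  by (rule conn_Un[OF assms(1-3)]) (use assms(4,5) in \<open>auto simp: touch_def\<close>)

section \<open>Connected components\<close>

definition component :: "('a \<Rightarrow> 'a \<Rightarrow> bool) \<Rightarrow> 'a set \<Rightarrow> 'a \<Rightarrow> 'a set" where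
  "component E C x = \<Union>{D. D \<subseteq> C \<and> conn E D \<and> x \<in> D}"

lemma component_subset: "component E C x \<subseteq> C"
  by (auto simp: component_def)

lemma component_self: "x \<in> C \<Longrightarrow> x \<in> component E C x"
  unfolding component_def by (rule UnionI[of "{x}"]) auto

lemma component_maximal: "D \<subseteq> C \<Longrightarrow> conn E D \<Longrightarrow> x \<in> D \<Longrightarrow> D \<subseteq> component E C x"
  by (auto simp: component_def)

lemma conn_component:
  assumes "symp E"
  shows "conn E (component E C x)"
proof (cases "x \<in> C")
  case True
  have "component E C x = {x} \<union> (\<Union>D\<in>{D. D \<subseteq> C \<and> conn E D \<and> x \<in> D}. D)"
    using component_self[OF True, of E] by (auto simp: component_def)
  moreover have "conn E \<dots>"
    by (rule conn_UN[OF assms]) (auto simp: touch_def)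
  ultimately show ?thesis by simp
next
  case False
  then have "component E C x = {}" by (auto simp: component_def)
  then show ?thesis by simp
qed

lemma component_closed:
  assumes "symp E" "a \<in> component E C x" "b \<in> C" "E a b"
  shows "b \<in> component E C x"
proof -
  have x: "x \<in> component E C x"
    using assms(2) component_self[of x C E] by (auto simp: component_def)
  have "conn E (component E C x \<union> {b})"
    using assms by (intro conn_Un conn_component) (auto simp: touch_def)
  then have "component E C x \<union> {b} \<subseteq> component E C x"
    by (rule component_maximal[rotated]) (use x component_subset[of E C x] assms(3) in auto)
  then show ?thesis by blast
qed

lemma component_eq:
  assumes "symp E" "y \<in> component E C x"
  shows "component E C y = component E C x"
proof
  have x: "x \<in> component E C x"
    using assms(2) component_self[of x C E] by (auto simp: component_def)
  show sub: "component E C x \<subseteq> component E C y"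
    by (rule component_maximal) (use assms conn_component component_subset[of E C x] in auto)
  show "component E C y \<subseteq> component E C x"
    by (rule component_maximal) (use x sub assms conn_component component_subset[of E C y] in auto)
qed

text \<open>\<open>td E k V R\<close>: the graph \<open>E\<close> on \<open>V\<close> has a rooted tree decomposition with root bag \<open>R\<close> and
  all bags of size at most \<open>k\<close>.\<close>

inductive td :: "('a \<Rightarrow> 'a \<Rightarrow> bool) \<Rightarrow> nat \<Rightarrow> 'a set \<Rightarrow> 'a set \<Rightarrow> bool" for E k where
  leaf: "finite R \<Longrightarrow> card R \<le> k \<Longrightarrow> td E k R R"
| step: "td E k V R \<Longrightarrow> finite R' \<Longrightarrow> card R' \<le> k \<Longrightarrow> R' \<inter> V \<subseteq> R \<Longrightarrow>
    (\<And>u v. u \<in> R' - V \<Longrightarrow> v \<in> V - R' \<Longrightarrow> \<not> E u v) \<Longrightarrow> td E k (V \<union> R') R'"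
| join: "td E k V1 R \<Longrightarrow> td E k V2 R \<Longrightarrow> V1 \<inter> V2 \<subseteq> R \<Longrightarrow>
    (\<And>u v. u \<in> V1 - R \<Longrightarrow> v \<in> V2 - R \<Longrightarrow> \<not> E u v) \<Longrightarrow> td E k (V1 \<union> V2) R"

lemma td_finite: "td E k V R \<Longrightarrow> finite V \<and> R \<subseteq> V \<and> finite R \<and> card R \<le> k"
  by (induction rule: td.induct) auto

lemma td_mono: "td E k V R \<Longrightarrow> k \<le> k' \<Longrightarrow> td E k' V R"
  by (induction rule: td.induct) (auto intro: td.intros)

text \<open>This is how a separator is put back after its removal: \<open>S\<close> joins every bag,
  so edges at \<open>S\<close> cause no conflict.\<close>

lemma td_Un_bags:
  assumes "td E k V R" "finite S"
  shows "td E (k + card S) (V \<union> S) (R \<union> S)"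
  using assms(1)
proof (induction rule: td.induct)
  case (leaf R)
  then show ?case
    using assms(2) card_Un_le[of R S] by (intro td.leaf) auto
next
  case (step V R R')
  have "td E (k + card S) ((V \<union> S) \<union> (R' \<union> S)) (R' \<union> S)"
    using step assms(2) card_Un_le[of R' S] by (intro td.step[OF step.IH]) auto
  then show ?case by (simp add: Un_ac)
next
  case (join V1 R V2)
  have "td E (k + card S) ((V1 \<union> S) \<union> (V2 \<union> S)) (R \<union> S)"
    using join by (intro td.join[OF join.IH]) auto
  then show ?case by (simp add: Un_ac)
qed

text \<open>The hypothesis \<open>closed\<close> says that the part of the decomposition built so far is attached to
  the rest of the ground set \<open>U\<close> through its root bag only.\<close>

lemma td_transfer_aux:
  assumes "td E k V R" and sym: "symp E"
    and closed: "\<And>u v. u \<in> V - R \<Longrightarrow> v \<in> U \<Longrightarrow> E u v \<Longrightarrow> v \<in> V"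
    and rel: "\<And>b. b \<in> A \<Longrightarrow> conn E (rel b) \<and> rel b \<subseteq> U"
    and adj: "\<And>b b'. b \<in> A \<Longrightarrow> b' \<in> A \<Longrightarrow> F b b' \<Longrightarrow> touch E (rel b) (rel b')"
    and cong: "\<And>v. v \<in> U \<Longrightarrow> finite {b\<in>A. v \<in> rel b} \<and> card {b\<in>A. v \<in> rel b} \<le> c"
    and VU: "V \<subseteq> U"
  shows "td F (c * k) {b\<in>A. rel b \<inter> V \<noteq> {}} {b\<in>A. rel b \<inter> R \<noteq> {}}"
  using assms(1) closed VU
proof (induction rule: td.induct)
  have bag: "finite {b\<in>A. rel b \<inter> R \<noteq> {}} \<and> card {b\<in>A. rel b \<inter> R \<noteq> {}} \<le> c * k"
    if R: "finite R" "card R \<le> k" "R \<subseteq> U" for R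
  proof -
    have eq: "{b\<in>A. rel b \<inter> R \<noteq> {}} = (\<Union>v\<in>R. {b\<in>A. v \<in> rel b})" by auto
    have "card (\<Union>v\<in>R. {b\<in>A. v \<in> rel b}) \<le> (\<Sum>v\<in>R. card {b\<in>A. v \<in> rel b})"
      by (rule card_UN_le) (use R in auto)
    also have "\<dots> \<le> (\<Sum>v\<in>R. c)" by (rule sum_mono) (use cong R in auto)
    also have "\<dots> \<le> c * k" using R(2) by simp
    finally have "card (\<Union>v\<in>R. {b\<in>A. v \<in> rel b}) \<le> c * k" .
    then show ?thesis unfolding eq using cong R by blast
  qed
  {
    case (leaf R)
    then show ?case using bag by (intro td.leaf) auto
  next
    case (step V R R')
    have cl: "v \<in> V" if "u \<in> V - R" "v \<in> U" "E u v" for u v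
    proof -
      have "u \<in> V \<union> R' - R'" using that(1) step.hyps(4) by blast
      then have "v \<in> V \<union> R'" using step.prems(1) that by blast
      moreover have "v \<notin> R' - V" using step.hyps(5)[of v u] that sym \<open>u \<in> V \<union> R' - R'\<close>
        by (auto dest: sympD)
      ultimately show ?thesis by blast
    qed
    \<comment> \<open>A connected set that meets \<open>V\<close> and avoids the new bag cannot
      leave \<open>V\<close>, since every way out leads through the bag.\<close>
    have inner: "rel b \<subseteq> V - R'" if b: "b \<in> A" "rel b \<inter> V \<noteq> {}" "rel b \<inter> R' = {}" for b
    proof -
      obtain x where x: "x \<in> rel b" "x \<in> V" using b by blast
      show ?thesis
        by (rule conn_closed_subset[of E _ x]) (use rel b x step.prems(1) in blast)+
    qed
    have inner': "rel b \<subseteq> V - R" if b: "b \<in> A" "rel b \<inter> V \<noteq> {}" "rel b \<inter> R = {}" for b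
    proof -
      obtain x where x: "x \<in> rel b" "x \<in> V" using b by blast
      show ?thesis
        by (rule conn_closed_subset[of E _ x]) (use rel b x cl in blast)+
    qed
    have "td F (c * k) ({b\<in>A. rel b \<inter> V \<noteq> {}} \<union> {b\<in>A. rel b \<inter> R' \<noteq> {}}) {b\<in>A. rel b \<inter> R' \<noteq> {}}"
    proof (rule td.step[OF step.IH])
      show "{b \<in> A. rel b \<inter> R' \<noteq> {}} \<inter> {b \<in> A. rel b \<inter> V \<noteq> {}} \<subseteq> {b \<in> A. rel b \<inter> R \<noteq> {}}"
        using inner' step.hyps(4) by blast
      fix b b'
      assume b: "b \<in> {b \<in> A. rel b \<inter> R' \<noteq> {}} - {b \<in> A. rel b \<inter> V \<noteq> {}}"
        and b': "b' \<in> {b \<in> A. rel b \<inter> V \<noteq> {}} - {b \<in> A. rel b \<inter> R' \<noteq> {}}"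
      show "\<not> F b b'"
      proof
        assume "F b b'"
        then obtain x y where xy: "x \<in> rel b" "y \<in> rel b'" "x = y \<or> E x y"
          using adj[of b b'] b b' unfolding touch_def by blast
        have y: "y \<in> V - R'" using inner b' xy(2) by blast
        then have "x \<noteq> y" using b xy(1) by blast
        then have "E x y" "E y x" using xy sym by (auto dest: sympD)
        moreover have "x \<in> U" using rel b xy(1) by blast
        ultimately have "x \<in> R'" using step.prems(1)[of y x] y b xy(1) by blast
        then show False using step.hyps(5)[of x y] \<open>E x y\<close> y b xy(1) by blast
      qed
    qed (use bag[of R'] step cl in auto)
    moreover have "{b\<in>A. rel b \<inter> (V \<union> R') \<noteq> {}} = {b\<in>A. rel b \<inter> V \<noteq> {}} \<union> {b\<in>A. rel b \<inter> R' \<noteq> {}}"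
      by blast
    ultimately show ?case by simp
  next
    case (join V1 R V2)
    have cl1: "v \<in> V1" if "u \<in> V1 - R" "v \<in> U" "E u v" for u v
      using join.prems(1)[of u v] join.hyps(4)[of u v] that td_finite[OF join.hyps(1)] by blast
    have cl2: "v \<in> V2" if "u \<in> V2 - R" "v \<in> U" "E u v" for u v
      using join.prems(1)[of u v] join.hyps(4)[of v u] that td_finite[OF join.hyps(2)] sympD[OF sym]
      by blast
    have inner1: "rel b \<subseteq> V1 - R" if b: "b \<in> A" "rel b \<inter> V1 \<noteq> {}" "rel b \<inter> R = {}" for b
    proof -
      obtain x where x: "x \<in> rel b" "x \<in> V1" using b by blast
      show ?thesis
        by (rule conn_closed_subset[of E _ x]) (use rel b x cl1 in blast)+
    qed
    have inner2: "rel b \<subseteq> V2 - R" if b: "b \<in> A" "rel b \<inter> V2 \<noteq> {}" "rel b \<inter> R = {}" for b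
    proof -
      obtain x where x: "x \<in> rel b" "x \<in> V2" using b by blast
      show ?thesis
        by (rule conn_closed_subset[of E _ x]) (use rel b x cl2 in blast)+
    qed
    have "td F (c * k) ({b\<in>A. rel b \<inter> V1 \<noteq> {}} \<union> {b\<in>A. rel b \<inter> V2 \<noteq> {}}) {b\<in>A. rel b \<inter> R \<noteq> {}}"
    proof (rule td.join)
      show "{b \<in> A. rel b \<inter> V1 \<noteq> {}} \<inter> {b \<in> A. rel b \<inter> V2 \<noteq> {}} \<subseteq> {b \<in> A. rel b \<inter> R \<noteq> {}}"
        using inner1 join.hyps(3) by blast
      fix b b'
      assume b: "b \<in> {b \<in> A. rel b \<inter> V1 \<noteq> {}} - {b \<in> A. rel b \<inter> R \<noteq> {}}"
        and b': "b' \<in> {b \<in> A. rel b \<inter> V2 \<noteq> {}} - {b \<in> A. rel b \<inter> R \<noteq> {}}"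
      show "\<not> F b b'"
      proof
        assume "F b b'"
        then obtain x y where xy: "x \<in> rel b" "y \<in> rel b'" "x = y \<or> E x y"
          using adj[of b b'] b b' unfolding touch_def by blast
        have "x \<in> V1 - R" "y \<in> V2 - R" using inner1 inner2 b b' xy by blast+
        then show False using join.hyps(3,4) xy(3) by blast
      qed
    qed (use join cl1 cl2 in auto)
    moreover have "{b\<in>A. rel b \<inter> (V1 \<union> V2) \<noteq> {}} = {b\<in>A. rel b \<inter> V1 \<noteq> {}} \<union> {b\<in>A. rel b \<inter> V2 \<noteq> {}}"
      by blast
    ultimately show ?case by simp
  }
qed

text \<open>Serves both directions between the disk graph and the grid. A new vertex enters each bag
  that its connected set meets, so the congestion \<open>c\<close> multiplies the bag size.\<close>

lemma td_transfer:
  assumes "td E k V R" and "symp E"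
    and "\<And>b. b \<in> A \<Longrightarrow> conn E (rel b) \<and> rel b \<subseteq> V \<and> rel b \<noteq> {}"
    and "\<And>b b'. b \<in> A \<Longrightarrow> b' \<in> A \<Longrightarrow> F b b' \<Longrightarrow> touch E (rel b) (rel b')"
    and "\<And>v. v \<in> V \<Longrightarrow> finite {b\<in>A. v \<in> rel b} \<and> card {b\<in>A. v \<in> rel b} \<le> c"
  shows "\<exists>R'. td F (c * k) A R'"
proof -
  have "td F (c * k) {b\<in>A. rel b \<inter> V \<noteq> {}} {b\<in>A. rel b \<inter> R \<noteq> {}}"
    by (rule td_transfer_aux[where U = V]) (use assms in auto)
  moreover have "{b\<in>A. rel b \<inter> V \<noteq> {}} = A" using assms(3) by blast
  ultimately show ?thesis by auto
qed

lemma td_subgraph: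
  assumes "td E k V R" "symp E" "A \<subseteq> V"
    and F: "\<And>u v. u \<in> A \<Longrightarrow> v \<in> A \<Longrightarrow> F u v \<Longrightarrow> E u v"
  shows "\<exists>R'. td F k A R'"
proof -
  have "{b \<in> A. v \<in> {b}} \<subseteq> {v}" for v by auto
  then have "finite {b \<in> A. v \<in> {b}} \<and> card {b \<in> A. v \<in> {b}} \<le> 1" for v
    using card_mono[of "{v}" "{b \<in> A. v \<in> {b}}"] finite_subset by fastforce
  then have "\<exists>R'. td F (1 * k) A R'"
    by (intro td_transfer[OF assms(1,2), where rel = "\<lambda>b. {b}"]) (use assms in \<open>auto simp: touch_def\<close>)
  then show ?thesis by simp
qed

text \<open>With an empty root bag, decompositions of different components can be joined.\<close>

lemma td_root_empty: "td E k V R \<Longrightarrow> td E k V {}"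
  using td.step[of E k V R "{}"] by simp

lemma td_UN_disjoint:
  assumes "finite I" "\<And>i. i \<in> I \<Longrightarrow> \<exists>R. td E k (C i) R"
    and "\<And>i j. i \<in> I \<Longrightarrow> j \<in> I \<Longrightarrow> i \<noteq> j \<Longrightarrow> C i \<inter> C j = {} \<and> (\<forall>u\<in>C i. \<forall>v\<in>C j. \<not> E u v)"
  shows "td E k (\<Union>i\<in>I. C i) {}"
  using assms
proof (induction I)
  case empty
  then show ?case using td.leaf[of "{}" k E] by simp
next
  case (insert i I)
  obtain R where "td E k (C i) R" using insert.prems(1)[of i] by auto
  then have 1: "td E k (C i) {}" by (rule td_root_empty)
  have "td E k (C i \<union> (\<Union>j\<in>I. C j)) {}"
  proof (rule td.join[OF 1])
    show "td E k (\<Union> (C ` I)) {}"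
      by (rule insert.IH) (use insert.prems in blast)+
    have *: "C i \<inter> C j = {} \<and> (\<forall>u\<in>C i. \<forall>v\<in>C j. \<not> E u v)" if "j \<in> I" for j
      using insert.prems(2)[of i j] insert.hyps that by auto
    then show "C i \<inter> \<Union> (C ` I) \<subseteq> {}" by blast
    fix u v assume "u \<in> C i - {}" "v \<in> \<Union> (C ` I) - {}"
    then show "\<not> E u v" using * by blast
  qed
  then show ?case by simp
qed

section \<open>The core of a marked set\<close>

text \<open>Cuts a connected set down to \<open>V\<close>: the component of \<open>c\<close> in
  \<open>C \<inter> V\<close> is all of \<open>C\<close> unless some edge of \<open>C\<close> leaves
  \<open>V\<close> from it.\<close>

lemma conn_exit:
  assumes "symp E" "conn E C" "c \<in> C" "c \<in> V"
  obtains C1 where "C1 \<subseteq> C \<inter> V" "conn E C1" "c \<in> C1"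
    "C1 = C \<or> (\<exists>a\<in>C1. \<exists>b\<in>C - V. E a b)"
proof
  let ?C1 = "component E (C \<inter> V) c"
  show "?C1 \<subseteq> C \<inter> V" by (rule component_subset)
  show "conn E ?C1" by (rule conn_component) fact
  show c: "c \<in> ?C1" using assms by (intro component_self) auto
  show "?C1 = C \<or> (\<exists>a\<in>?C1. \<exists>b\<in>C - V. E a b)"
  proof (rule disjCI)
    assume no: "\<not> (\<exists>a\<in>?C1. \<exists>b\<in>C - V. E a b)"
    have "C \<subseteq> ?C1"
    proof (rule conn_closed_subset[OF assms(2,3) c])
      fix a b assume ab: "a \<in> ?C1" "a \<in> C" "b \<in> C" "E a b"
      then have "b \<in> C \<inter> V" using no by blast
      then show "b \<in> ?C1" using component_closed[OF assms(1)] ab by blast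
    qed
    then show "?C1 = C" using component_subset[of E "C \<inter> V" c] by blast
  qed
qed

text \<open>The origin of \<open>2 * k\<close>. If \<open>C\<close> has a neighbour \<open>z\<close>
  in the new part of the bag, then \<open>C \<union> {z}\<close> meets the old root \<open>R\<close>
  and sees only \<open>D\<close> in \<open>Z\<close>, so all neighbours of \<open>C\<close> lie in
  \<open>D \<union> R'\<close>. If not, the old bound applies.\<close>

lemma core_add_bag:
  assumes sym: "symp E" and D: "D \<subseteq> Z" "finite Z" "card D \<le> k"
    and R': "finite R'" "card R' \<le> k"
    and pc: "\<And>C. conn E C \<Longrightarrow> C \<subseteq> V - Z \<Longrightarrow> card {z\<in>Z. \<exists>c\<in>C. E c z} \<le> 2 * k"
    and pd: "\<And>C. conn E C \<Longrightarrow> C \<subseteq> V - Z \<Longrightarrow> C \<inter> R \<noteq> {} \<Longrightarrow> {z\<in>Z. \<exists>c\<in>C. E c z} \<subseteq> D"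
    and C: "conn E C" "C \<subseteq> V - Z"
    and new: "\<And>z c. z \<in> R' - Z \<Longrightarrow> c \<in> C \<Longrightarrow> E c z \<Longrightarrow> z \<in> R \<inter> V"
  shows "card {z \<in> Z \<union> R'. \<exists>c\<in>C. E c z} \<le> 2 * k"
proof (cases "{z\<in>R' - Z. \<exists>c\<in>C. E c z} = {}")
  case True
  then have "{z \<in> Z \<union> R'. \<exists>c\<in>C. E c z} = {z \<in> Z. \<exists>c\<in>C. E c z}" by blast
  then show ?thesis using pc[OF C] by simp
next
  case False
  then obtain z c where z: "z \<in> R'" "z \<notin> Z" "c \<in> C" "E c z" by blast
  have zR: "z \<in> R \<inter> V" using new z by blast
  have "conn E (C \<union> {z})"
    using C(1) z by (intro conn_Un[OF sym]) (auto simp: touch_def)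
  then have "{y\<in>Z. \<exists>c\<in>C\<union>{z}. E c y} \<subseteq> D"
    using pd[of "C \<union> {z}"] zR z C by blast
  then have "{z \<in> Z \<union> R'. \<exists>c\<in>C. E c z} \<subseteq> D \<union> R'" by blast
  then have "card {z \<in> Z \<union> R'. \<exists>c\<in>C. E c z} \<le> card (D \<union> R')"
    using finite_subset[OF D(1,2)] R'(1) by (intro card_mono) auto
  also have "\<dots> \<le> card D + card R'" by (rule card_Un_le)
  finally show ?thesis using D(3) R'(2) by simp
qed

text \<open>The branch \<open>W\<close> contributes nothing to the core. If \<open>C\<close> meets
  \<open>R\<close> or leaves \<open>V\<close>, then the piece of \<open>C \<inter> V\<close> next to
  a given core vertex has to meet \<open>R\<close>, and such a piece sees only
  \<open>D\<close>.\<close>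

lemma core_join_unmarked:
  assumes sym: "symp E" and D: "D \<subseteq> Z" "finite Z" "card D \<le> k" "Z \<subseteq> V" "R \<inter> Z \<subseteq> D"
    and pc: "\<And>C. conn E C \<Longrightarrow> C \<subseteq> V - Z \<Longrightarrow> card {z\<in>Z. \<exists>c\<in>C. E c z} \<le> 2 * k"
    and pd: "\<And>C. conn E C \<Longrightarrow> C \<subseteq> V - Z \<Longrightarrow> C \<inter> R \<noteq> {} \<Longrightarrow> {z\<in>Z. \<exists>c\<in>C. E c z} \<subseteq> D"
    and R: "R \<subseteq> V"
    and cross: "\<And>u v. u \<in> V - R \<Longrightarrow> v \<in> W - R \<Longrightarrow> \<not> E u v \<and> \<not> E v u"
    and C: "conn E C" "C \<subseteq> V \<union> W - Z"
  shows "card {z\<in>Z. \<exists>c\<in>C. E c z} \<le> 2 * k \<and>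
    (C \<inter> R \<noteq> {} \<longrightarrow> {z\<in>Z. \<exists>c\<in>C. E c z} \<subseteq> D)"
proof -
  have sub: "{z\<in>Z. \<exists>c\<in>C. E c z} \<subseteq> D" if CR: "C \<inter> R \<noteq> {} \<or> \<not> C \<subseteq> V"
  proof
    fix z assume "z \<in> {z\<in>Z. \<exists>c\<in>C. E c z}"
    then obtain c where c: "c \<in> C" "E c z" "z \<in> Z" by blast
    show "z \<in> D"
    proof (cases "c \<in> V")
      case True
      obtain C1 where C1: "C1 \<subseteq> C \<inter> V" "conn E C1" "c \<in> C1"
          "C1 = C \<or> (\<exists>a\<in>C1. \<exists>b\<in>C - V. E a b)"
        by (rule conn_exit[OF sym C(1) c(1) True])
      have "C1 \<inter> R \<noteq> {}" using C1(4)
      proof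
        assume "C1 = C"
        then show ?thesis using CR C1(1) by blast
      next
        assume "\<exists>a\<in>C1. \<exists>b\<in>C - V. E a b"
        then obtain a b where ab: "a \<in> C1" "b \<in> C - V" "E a b" by blast
        then have "a \<in> R" using cross[of a b] C(2) C1(1) R by blast
        then show ?thesis using ab(1) by blast
      qed
      then show ?thesis using pd[OF C1(2)] C1 C(2) c by blast
    next
      case False
      then have "z \<in> R" using cross[of z c] c C(2) D(4) R by blast
      then show ?thesis using c(3) D(5) by blast
    qed
  qed
  have "card {z\<in>Z. \<exists>c\<in>C. E c z} \<le> 2 * k"
  proof (cases "C \<subseteq> V")
    case True
    then show ?thesis using pc[OF C(1)] C(2) by blast
  next
    case False
    then have "card {z \<in> Z. \<exists>c\<in>C. E c z} \<le> card D"
      using sub finite_subset[OF D(1,2)] by (intro card_mono) auto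
    then show ?thesis using D(3) by simp
  qed
  then show ?thesis using sub by blast
qed

text \<open>\<open>D\<close> is the topmost bag of the core below the root: a piece of the complement of the core
  that still meets the root bag sees only \<open>D\<close>. The core grows by a whole bag only where a new
  marked vertex appears or two marked branches meet, as in a least-common-ancestor closure.\<close>

lemma td_core_aux:
  assumes "td E k V R" and sym: "symp E" and "M \<subseteq> V"
  shows "\<exists>Z D. M \<subseteq> Z \<and> Z \<subseteq> V \<and> D \<subseteq> Z \<and> card D \<le> k \<and> R \<inter> Z \<subseteq> D \<and>
     (if M = {} then Z = {} else card Z + k \<le> 2 * k * card M) \<and>
     (\<forall>C. conn E C \<longrightarrow> C \<subseteq> V - Z \<longrightarrow>
        card {z\<in>Z. \<exists>c\<in>C. E c z} \<le> 2 * k \<and>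
        (C \<inter> R \<noteq> {} \<longrightarrow> {z\<in>Z. \<exists>c\<in>C. E c z} \<subseteq> D))"
  using assms(1,3)
proof (induction arbitrary: M rule: td.induct)
  case (leaf R)
  show ?case
  proof (cases "M = {}")
    case True
    then show ?thesis by (intro exI[of _ "{}"]) auto
  next
    case False
    have "card M \<ge> 1" using False leaf finite_subset[of M R] by (simp add: Suc_le_eq card_gt_0_iff)
    then have "k + k \<le> 2 * k * card M" using mult_le_mono2[of 1 "card M" "2 * k"] by linarith
    then show ?thesis using False leaf
      by (intro exI[of _ R]) (auto intro: order_trans[OF card_mono])
  qed
next
  case (step V R R')
  note fin = td_finite[OF step.hyps(1)]
  obtain Z D where ZD: "M \<inter> V \<subseteq> Z" "Z \<subseteq> V" "D \<subseteq> Z" "card D \<le> k" "R \<inter> Z \<subseteq> D"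
      "if M \<inter> V = {} then Z = {} else card Z + k \<le> 2 * k * card (M \<inter> V)"
    and pc: "\<And>C. conn E C \<Longrightarrow> C \<subseteq> V - Z \<Longrightarrow> card {z\<in>Z. \<exists>c\<in>C. E c z} \<le> 2 * k"
    and pd: "\<And>C. conn E C \<Longrightarrow> C \<subseteq> V - Z \<Longrightarrow> C \<inter> R \<noteq> {} \<Longrightarrow> {z\<in>Z. \<exists>c\<in>C. E c z} \<subseteq> D"
    using step.IH[of "M \<inter> V"] by auto
  have finZ: "finite Z" using ZD(2) fin finite_subset by blast
  have finM: "finite M" using step.prems step.hyps fin finite_subset by blast
  have new: "v \<in> R'" if "u \<in> R' - V" "E u v \<or> E v u" "v \<in> V \<union> R'" for u v
    using step.hyps(5)[of u v] that sympD[OF sym] by blast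
  \<comment> \<open>To reach \<open>R'\<close>, the piece of \<open>C\<close> next to
    \<open>z\<close> passes through the old root, because
    \<open>R' \<inter> V \<subseteq> R\<close>.\<close>
  have sub: "{z\<in>Z. \<exists>c\<in>C. E c z} \<subseteq> D" if C: "conn E C" "C \<subseteq> V \<union> R' - Z" "C \<inter> R' \<noteq> {}" for C
  proof
    fix z assume "z \<in> {z\<in>Z. \<exists>c\<in>C. E c z}"
    then obtain c where c: "c \<in> C" "E c z" "z \<in> Z" by blast
    show "z \<in> D"
    proof (cases "c \<in> V")
      case True
      obtain C1 where C1: "C1 \<subseteq> C \<inter> V" "conn E C1" "c \<in> C1"
          "C1 = C \<or> (\<exists>a\<in>C1. \<exists>b\<in>C - V. E a b)"
        by (rule conn_exit[OF sym C(1) c(1) True])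
      have "C1 \<inter> R \<noteq> {}" using C1(4)
      proof
        assume "C1 = C"
        then show ?thesis using C(3) C1(1) step.hyps(4) by blast
      next
        assume "\<exists>a\<in>C1. \<exists>b\<in>C - V. E a b"
        then obtain a b where ab: "a \<in> C1" "b \<in> C - V" "E a b" by blast
        then have "a \<in> R'" using new[of b a] C(2) C1(1) by blast
        then show ?thesis using ab(1) C1(1) step.hyps(4) by blast
      qed
      then show ?thesis using pd[OF C1(2)] C1 C(2) c by blast
    next
      case False
      then have "z \<in> R'" using new[of c z] c C(2) ZD(2) by blast
      then show ?thesis using c(3) ZD(2,5) step.hyps(4) by blast
    qed
  qed
  show ?case
  proof (cases "M \<subseteq> V")
    case True
    then have MV: "M \<inter> V = M" by blast
    show ?thesis
    proof (rule exI[of _ Z], rule exI[of _ D], intro conjI allI impI)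
      show "R' \<inter> Z \<subseteq> D" using ZD(2,5) step.hyps(4) by blast
      show "if M = {} then Z = {} else card Z + k \<le> 2 * k * card M" using ZD(6) unfolding MV .
      fix C assume C: "conn E C" "C \<subseteq> V \<union> R' - Z"
      show "card {z \<in> Z. \<exists>c\<in>C. E c z} \<le> 2 * k"
      proof (cases "C \<inter> R' = {}")
        case True
        then show ?thesis using pc[OF C(1)] C(2) by blast
      next
        case False
        then have "card {z \<in> Z. \<exists>c\<in>C. E c z} \<le> card D"
          using sub[OF C] finite_subset[OF ZD(3) finZ] by (intro card_mono) auto
        then show ?thesis using ZD(4) by simp
      qed
    qed (use ZD MV sub in blast)+
  next
    case False
    then have "M \<noteq> {}" "M - V \<noteq> {}" by auto
    have cM: "card M = card (M \<inter> V) + card (M - V)"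
      by (rule card_Int_Diff[OF finM])
    \<comment> \<open>A new marked vertex contributes \<open>2 * k\<close>: one \<open>k\<close>
      pays for the bag \<open>R'\<close>, the other is the slack of the invariant. \<open>Z\<close>
      may come without slack, when \<open>V\<close> contains no mark.\<close>
    have "card (M - V) \<ge> 1" using \<open>M - V \<noteq> {}\<close> finM by (simp add: Suc_le_eq card_gt_0_iff)
    then have "2 * k * card M \<ge> 2 * k * card (M \<inter> V) + 2 * k"
      using mult_le_mono2[of 1 "card (M - V)" "2 * k"] unfolding cM by (simp add: algebra_simps)
    moreover have "card Z \<le> 2 * k * card (M \<inter> V)" using ZD(6) by (auto split: if_splits)
    moreover have "card (Z \<union> R') \<le> card Z + k"
      using card_Un_le[of Z R'] step.hyps(3) by linarith
    ultimately have cZ: "card (Z \<union> R') + k \<le> 2 * k * card M" by linarith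
    show ?thesis
    proof (rule exI[of _ "Z \<union> R'"], rule exI[of _ R'], intro conjI allI impI)
      show "M \<subseteq> Z \<union> R'" using ZD(1) step.prems by blast
      show "if M = {} then Z \<union> R' = {} else card (Z \<union> R') + k \<le> 2 * k * card M"
        using cZ \<open>M \<noteq> {}\<close> by simp
      fix C assume C: "conn E C" "C \<subseteq> V \<union> R' - (Z \<union> R')"
      then have CV: "C \<subseteq> V - Z" "C \<inter> R' = {}" by auto
      show "card {z \<in> Z \<union> R'. \<exists>c\<in>C. E c z} \<le> 2 * k"
        by (rule core_add_bag[OF sym ZD(3) finZ ZD(4) step.hyps(2,3) pc pd C(1) CV(1)])
          (use new CV step.hyps(4) in blast)+
    qed (use ZD step.hyps in auto)
  qed
next
  case (join V1 R V2)
  note fin = td_finite[OF join.hyps(1)] td_finite[OF join.hyps(2)]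
  obtain Z1 D1 where ZD1: "M \<inter> V1 \<subseteq> Z1" "Z1 \<subseteq> V1" "D1 \<subseteq> Z1" "card D1 \<le> k" "R \<inter> Z1 \<subseteq> D1"
      "if M \<inter> V1 = {} then Z1 = {} else card Z1 + k \<le> 2 * k * card (M \<inter> V1)"
    and pc1: "\<And>C. conn E C \<Longrightarrow> C \<subseteq> V1 - Z1 \<Longrightarrow> card {z\<in>Z1. \<exists>c\<in>C. E c z} \<le> 2 * k"
    and pd1: "\<And>C. conn E C \<Longrightarrow> C \<subseteq> V1 - Z1 \<Longrightarrow> C \<inter> R \<noteq> {} \<Longrightarrow> {z\<in>Z1. \<exists>c\<in>C. E c z} \<subseteq> D1"
    using join.IH(1)[of "M \<inter> V1"] by auto
  have "M - V1 \<subseteq> V2" using join.prems by blast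
  then obtain Z2 D2 where ZD2: "M - V1 \<subseteq> Z2" "Z2 \<subseteq> V2" "D2 \<subseteq> Z2" "card D2 \<le> k" "R \<inter> Z2 \<subseteq> D2"
      "if M - V1 = {} then Z2 = {} else card Z2 + k \<le> 2 * k * card (M - V1)"
    and pc2: "\<And>C. conn E C \<Longrightarrow> C \<subseteq> V2 - Z2 \<Longrightarrow> card {z\<in>Z2. \<exists>c\<in>C. E c z} \<le> 2 * k"
    and pd2: "\<And>C. conn E C \<Longrightarrow> C \<subseteq> V2 - Z2 \<Longrightarrow> C \<inter> R \<noteq> {} \<Longrightarrow> {z\<in>Z2. \<exists>c\<in>C. E c z} \<subseteq> D2"
    using join.IH(2)[of "M - V1"] by auto
  have cross: "\<not> E u v \<and> \<not> E v u" if "u \<in> V1 - R" "v \<in> V2 - R" for u v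
    using join.hyps(4)[of u v] that sympD[OF sym] by blast
  have finZ: "finite Z1" "finite Z2" using ZD1(2) ZD2(2) fin finite_subset by blast+
  have finM: "finite M" using join.prems fin finite_subset[of M "V1 \<union> V2"] by blast
  have finD: "finite D1" "finite D2" using finZ ZD1(3) ZD2(3) finite_subset by blast+
  have cM: "card M = card (M \<inter> V1) + card (M - V1)"
    by (rule card_Int_Diff[OF finM])
  show ?case
  proof (cases "M \<inter> V1 = {} \<or> M - V1 = {}")
    case True
    then show ?thesis
    proof
      assume empty: "M \<inter> V1 = {}"
      then have M: "M - V1 = M" by blast
      show ?thesis
      proof (rule exI[of _ Z2], rule exI[of _ D2], intro conjI allI impI)
        show "if M = {} then Z2 = {} else card Z2 + k \<le> 2 * k * card M" using ZD2(6) unfolding M .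
        fix C assume "conn E C" "C \<subseteq> V1 \<union> V2 - Z2"
        then have *: "card {z\<in>Z2. \<exists>c\<in>C. E c z} \<le> 2 * k \<and>
          (C \<inter> R \<noteq> {} \<longrightarrow> {z\<in>Z2. \<exists>c\<in>C. E c z} \<subseteq> D2)"
          by (intro core_join_unmarked[OF sym ZD2(3) finZ(2) ZD2(4) ZD2(2) ZD2(5) pc2 pd2, where W = V1])
            (use fin cross in blast)+
        show "card {z\<in>Z2. \<exists>c\<in>C. E c z} \<le> 2 * k" using * by blast
        show "{z\<in>Z2. \<exists>c\<in>C. E c z} \<subseteq> D2" if "C \<inter> R \<noteq> {}" using * that by blast
      qed (use ZD2 M in auto)
    next
      assume empty: "M - V1 = {}"
      then have M: "M \<inter> V1 = M" by blast
      show ?thesis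
      proof (rule exI[of _ Z1], rule exI[of _ D1], intro conjI allI impI)
        show "if M = {} then Z1 = {} else card Z1 + k \<le> 2 * k * card M" using ZD1(6) unfolding M .
        fix C assume "conn E C" "C \<subseteq> V1 \<union> V2 - Z1"
        then have *: "card {z\<in>Z1. \<exists>c\<in>C. E c z} \<le> 2 * k \<and>
          (C \<inter> R \<noteq> {} \<longrightarrow> {z\<in>Z1. \<exists>c\<in>C. E c z} \<subseteq> D1)"
          by (intro core_join_unmarked[OF sym ZD1(3) finZ(1) ZD1(4) ZD1(2) ZD1(5) pc1 pd1, where W = V2])
            (use fin cross in blast)+
        show "card {z\<in>Z1. \<exists>c\<in>C. E c z} \<le> 2 * k" using * by blast
        show "{z\<in>Z1. \<exists>c\<in>C. E c z} \<subseteq> D1" if "C \<inter> R \<noteq> {}" using * that by blast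
      qed (use ZD1 M in auto)
    qed
  next
    case False
    let ?Z = "Z1 \<union> Z2 \<union> R"
    have "card ?Z \<le> card Z1 + card Z2 + card R"
      using card_Un_le[of "Z1 \<union> Z2" R] card_Un_le[of Z1 Z2] by linarith
    \<comment> \<open>Each side brings a slack of \<open>k\<close>: one pays for the bag
      \<open>R\<close>, the other remains as the slack of the join.\<close>
    moreover have "card Z1 + k \<le> 2 * k * card (M \<inter> V1)" "card Z2 + k \<le> 2 * k * card (M - V1)"
      using ZD1(6) ZD2(6) False by auto
    moreover have "card R \<le> k" using fin by blast
    ultimately have cZ: "card ?Z + k \<le> 2 * k * card M"
      unfolding cM by (simp add: algebra_simps)
    show ?thesis
    proof (rule exI[of _ ?Z], rule exI[of _ R], intro conjI allI impI)
      show "M \<subseteq> ?Z" using ZD1(1) ZD2(1) by blast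
      show "if M = {} then ?Z = {} else card ?Z + k \<le> 2 * k * card M"
        using cZ False by auto
      fix C assume C: "conn E C" "C \<subseteq> V1 \<union> V2 - ?Z"
      \<comment> \<open>As \<open>R\<close> now belongs to the core, \<open>C\<close> lies entirely
        on one side of the join.\<close>
      show "card {z \<in> ?Z. \<exists>c\<in>C. E c z} \<le> 2 * k"
      proof (cases "C \<inter> V1 = {}")
        case True
        have "card {z \<in> Z2 \<union> R. \<exists>c\<in>C. E c z} \<le> 2 * k"
          by (rule core_add_bag[OF sym ZD2(3) finZ(2) ZD2(4) _ _ pc2 pd2 C(1)])
            (use C(2) True fin in blast)+
        moreover have "{z \<in> ?Z. \<exists>c\<in>C. E c z} = {z \<in> Z2 \<union> R. \<exists>c\<in>C. E c z}"
          using cross C(2) True ZD1(2) by blast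
        ultimately show ?thesis by simp
      next
        case False
        then obtain x where x: "x \<in> C" "x \<in> V1" by blast
        have CV: "C \<subseteq> V1"
          by (rule conn_closed_subset[OF C(1) x]) (use cross C(2) in blast)
        have "card {z \<in> Z1 \<union> R. \<exists>c\<in>C. E c z} \<le> 2 * k"
          by (rule core_add_bag[OF sym ZD1(3) finZ(1) ZD1(4) _ _ pc1 pd1 C(1)])
            (use C(2) CV fin in blast)+
        moreover have "{z \<in> ?Z. \<exists>c\<in>C. E c z} = {z \<in> Z1 \<union> R. \<exists>c\<in>C. E c z}"
          using cross C(2) CV ZD2(2) by blast
        ultimately show ?thesis by simp
      qed
    qed (use fin ZD1 ZD2 in blast)+
  qed
qed

lemma td_core:
  assumes "td E k V R" "symp E" "M \<subseteq> V"
  obtains Z where "M \<subseteq> Z" "Z \<subseteq> V" "card Z \<le> 2 * k * card M"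
    "\<And>C. conn E C \<Longrightarrow> C \<subseteq> V - Z \<Longrightarrow> card {z\<in>Z. \<exists>c\<in>C. E c z} \<le> 2 * k"
  using td_core_aux[OF assms]
proof (elim exE conjE)
  fix Z D
  assume Z: "M \<subseteq> Z" "Z \<subseteq> V" "if M = {} then Z = {} else card Z + k \<le> 2 * k * card M"
    "\<forall>C. conn E C \<longrightarrow> C \<subseteq> V - Z \<longrightarrow> card {z\<in>Z. \<exists>c\<in>C. E c z} \<le> 2 * k \<and>
        (C \<inter> R \<noteq> {} \<longrightarrow> {z\<in>Z. \<exists>c\<in>C. E c z} \<subseteq> D)"
  have "card Z \<le> 2 * k * card M" using Z(3) by (auto split: if_splits)
  then show thesis by (rule that[OF Z(1,2)]) (use Z(4) in blast)
qed

section \<open>Separators in graphs without a clique minor\<close>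

text \<open>The \<open>r\<close> layers from \<open>j0\<close> on are pairwise disjoint subsets of
  \<open>B\<close>, so they cannot all be larger than the average.\<close>

lemma exists_small_layer:
  fixes reach :: "nat \<Rightarrow> 'a set"
  assumes "finite B" "\<And>j. reach j \<subseteq> B" "mono reach" "r \<ge> 1"
  shows "\<exists>j\<ge>j0. j < j0 + r \<and> card (reach (Suc j) - reach j) * r \<le> card B"
proof (rule ccontr)
  assume no: "\<not> ?thesis"
  let ?L = "\<lambda>j. reach (Suc j) - reach j"
  have big: "card B < card (?L j) * r" if "j \<in> {j0..<j0 + r}" for j
    using that no by (auto simp: not_le)
  have disj: "?L i \<inter> ?L j = {}" if "i < j" for i j
    using monoD[OF assms(3), of "Suc i" j] that by auto
  have finL: "finite (?L j)" for j using assms(1,2) finite_subset[of "?L j" B] by blast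
  have "card (\<Union>j\<in>{j0..<j0 + r}. ?L j) = (\<Sum>j\<in>{j0..<j0 + r}. card (?L j))"
  proof (rule card_UN_disjoint)
    show "\<forall>i\<in>{j0..<j0 + r}. \<forall>j\<in>{j0..<j0 + r}. i \<noteq> j \<longrightarrow> ?L i \<inter> ?L j = {}"
      using disj by (metis Int_commute linorder_neqE_nat)
  qed (use finL in auto)
  moreover have "card (\<Union>j\<in>{j0..<j0 + r}. ?L j) \<le> card B"
    by (rule card_mono) (use assms in auto)
  ultimately have "(\<Sum>j\<in>{j0..<j0 + r}. card (?L j) * r) \<le> card B * r"
    by (simp add: sum_distrib_right[symmetric])
  moreover have "(\<Sum>j\<in>{j0..<j0 + r}. card (?L j) * r) > (\<Sum>j\<in>{j0..<j0 + r}. card B)"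
    using big assms(4) by (intro sum_strict_mono) auto
  ultimately show False by (simp add: mult.commute)
qed

text \<open>Breadth first search, one target at a time. \<open>reach j\<close> grows by at least one
  step of \<open>B\<close> per unit of \<open>j\<close>, and a thin layer among \<open>r\<close>
  consecutive ones goes into the cut. A connected \<open>D\<close> that avoids the cut and meets the
  new target starts inside \<open>reach j\<close> and cannot get out. Each target costs
  \<open>card B / r\<close> in the cut and \<open>r\<close> in the size of a connector.\<close>

lemma small_connector_or_cut:
  assumes "symp E" "finite B" "r \<ge> 1" "finite \<A>"
  shows "\<exists>Z\<subseteq>B. card Z * r \<le> card \<A> * card B \<and>
    (\<forall>D. conn E D \<longrightarrow> D \<subseteq> B - Z \<longrightarrow> (\<forall>A\<in>\<A>. D \<inter> A \<noteq> {}) \<longrightarrow>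
       (\<forall>v\<in>D. \<exists>T\<subseteq>B. conn E T \<and> v \<in> T \<and> card T \<le> card \<A> * r + 1 \<and> (\<forall>A\<in>\<A>. T \<inter> A \<noteq> {})))"
  using assms(4)
proof (induction \<A>)
  case empty
  \<comment> \<open>Without targets the vertex itself is a connector, hence the
    \<open>+ 1\<close>.\<close>
  show ?case
    by (rule exI[of _ "{}"]) (auto intro!: exI[of _ "{_}"])
next
  case (insert A \<A>)
  let ?j0 = "card \<A> * r + 1"
  obtain Z0 where Z0: "Z0 \<subseteq> B" "card Z0 * r \<le> card \<A> * card B"
    and old: "\<forall>D. conn E D \<longrightarrow> D \<subseteq> B - Z0 \<longrightarrow> (\<forall>A\<in>\<A>. D \<inter> A \<noteq> {}) \<longrightarrow>
       (\<forall>v\<in>D. \<exists>T\<subseteq>B. conn E T \<and> v \<in> T \<and> card T \<le> ?j0 \<and> (\<forall>A\<in>\<A>. T \<inter> A \<noteq> {}))"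
    using insert.IH by (elim exE conjE)
  define reach where "reach j = {v. \<exists>T\<subseteq>B. conn E T \<and> v \<in> T \<and> card T \<le> j \<and>
    (\<forall>A\<in>insert A \<A>. T \<inter> A \<noteq> {})}" for j
  have "mono reach" unfolding reach_def mono_def by (auto intro: order_trans)
  moreover have reachB: "reach j \<subseteq> B" for j unfolding reach_def by auto
  ultimately obtain j where j: "?j0 \<le> j" "j < ?j0 + r" "card (reach (Suc j) - reach j) * r \<le> card B"
    using exists_small_layer[OF assms(2) _ _ assms(3), of reach ?j0] by blast
  let ?Z = "Z0 \<union> (reach (Suc j) - reach j)"
  have "card ?Z * r \<le> (card Z0 + card (reach (Suc j) - reach j)) * r"
    by (rule mult_le_mono1[OF card_Un_le])
  also have "\<dots> \<le> card (insert A \<A>) * card B"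
    using Z0(2) j(3) insert.hyps by (simp add: algebra_simps)
  finally have cZ: "card ?Z * r \<le> card (insert A \<A>) * card B" .
  have next_layer: "b \<in> reach (Suc j)" if ab: "a \<in> reach j" "b \<in> B" "E a b" for a b
  proof -
    obtain T where T: "T \<subseteq> B" "conn E T" "a \<in> T" "card T \<le> j" "\<forall>A\<in>insert A \<A>. T \<inter> A \<noteq> {}"
      using ab(1) unfolding reach_def by blast
    have "conn E (T \<union> {b})"
      using T ab by (intro conn_Un[OF assms(1)]) (auto simp: touch_def)
    moreover have "card (T \<union> {b}) \<le> Suc j"
      using card_Un_le[of T "{b}"] T(4) by simp
    ultimately show ?thesis unfolding reach_def using T(1,5) ab(2)
      by (intro CollectI exI[of _ "T \<union> {b}"]) blast
  qed
  show ?case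
  proof (rule exI[of _ ?Z], intro conjI allI impI ballI)
    show "?Z \<subseteq> B" using Z0(1) reachB by blast
    show "card ?Z * r \<le> card (insert A \<A>) * card B" by (fact cZ)
    fix D v assume D: "conn E D" "D \<subseteq> B - ?Z" "\<forall>A\<in>insert A \<A>. D \<inter> A \<noteq> {}" and v: "v \<in> D"
    obtain a where a: "a \<in> D" "a \<in> A" using D(3) by blast
    obtain T where "T \<subseteq> B" "conn E T" "a \<in> T" "card T \<le> ?j0" "\<forall>A\<in>\<A>. T \<inter> A \<noteq> {}"
      using old[rule_format, OF D(1) _ _ a(1)] D by blast
    then have "a \<in> reach j" unfolding reach_def mem_Collect_eq using a(2) j(1)
      by (intro exI[of _ T]) auto
    then have "D \<subseteq> reach j"
      by (rule conn_closed_subset[OF D(1) a(1)]) (use next_layer D(2) in blast)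
    then have "v \<in> reach j" using v by blast
    then obtain T where "T \<subseteq> B" "conn E T" "v \<in> T" "card T \<le> j" "\<forall>A\<in>insert A \<A>. T \<inter> A \<noteq> {}"
      unfolding reach_def mem_Collect_eq by (elim exE conjE)
    moreover have "j \<le> card (insert A \<A>) * r + 1" using j(2) insert.hyps by simp
    ultimately show "\<exists>T\<subseteq>B. conn E T \<and> v \<in> T \<and> card T \<le> card (insert A \<A>) * r + 1 \<and>
        (\<forall>A\<in>insert A \<A>. T \<inter> A \<noteq> {})"
      by (intro exI[of _ T]) auto
  qed
qed

text \<open>The members of \<open>\<C>\<close> are the branch sets of a complete minor of order
  \<open>card \<C>\<close>.\<close>

definition clique_model :: "('a \<Rightarrow> 'a \<Rightarrow> bool) \<Rightarrow> 'a set set \<Rightarrow> bool" where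
  "clique_model E \<C> \<longleftrightarrow> finite \<C> \<and> (\<forall>C\<in>\<C>. conn E C \<and> C \<noteq> {}) \<and>
     (\<forall>C\<in>\<C>. \<forall>D\<in>\<C>. C \<noteq> D \<longrightarrow> C \<inter> D = {} \<and> touch E C D)"

lemma clique_model_subset: "clique_model E \<C> \<Longrightarrow> \<D> \<subseteq> \<C> \<Longrightarrow> clique_model E \<D>"
  unfolding clique_model_def by (meson finite_subset subsetD)

text \<open>The argument of Alon, Seymour and Thomas: a state consists of a clique model \<open>\<C>\<close>, a small
  part \<open>X\<close> of its vertices and a heavy connected set \<open>B\<close> whose neighbours all lie in \<open>X\<close>; without
  a balanced separator every state can be improved.\<close>

theorem clique_minor_free_separator:
  fixes w :: "'a \<Rightarrow> nat"
  assumes sym: "symp E" and V: "finite V"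
    and minor_free: "\<And>\<C>. clique_model E \<C> \<Longrightarrow> \<Union>\<C> \<subseteq> V \<Longrightarrow> card \<C> < h"
    and r: "r \<ge> 1" "card V \<le> r * r"
  shows "\<exists>S\<subseteq>V. card S \<le> h * (h + 1) * r \<and>
    (\<forall>C. conn E C \<longrightarrow> C \<subseteq> V - S \<longrightarrow> 2 * sum w C \<le> sum w V)"
proof (rule ccontr)
  let ?s = "h * (h + 1) * r"
  assume neg: "\<not> ?thesis"
  define heavy where "heavy B \<longleftrightarrow> sum w V < 2 * sum w B" for B
  have heavy_mono: "heavy B" if "heavy A" "A \<subseteq> B" "B \<subseteq> V" for A B
    using that sum_mono2[of B A w] finite_subset[OF _ V] unfolding heavy_def by fastforce
  have heavy_Int: "A \<inter> B \<noteq> {}" if "heavy A" "heavy B" "A \<subseteq> V" "B \<subseteq> V" for A B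
  proof
    assume "A \<inter> B = {}"
    then have "sum w (A \<union> B) = sum w A + sum w B"
      using that finite_subset[OF _ V] by (intro sum.union_disjoint) auto
    moreover have "sum w (A \<union> B) \<le> sum w V" using that V by (intro sum_mono2) auto
    ultimately show False using that unfolding heavy_def by linarith
  qed
  \<comment> \<open>The assumed failure of the theorem, in usable form: every small \<open>S\<close>
    leaves a heavy component.\<close>
  have heavy_comp: "\<exists>B. conn E B \<and> B \<subseteq> V - S \<and> heavy B \<and> (\<forall>b\<in>B. \<forall>v\<in>V - S. E b v \<longrightarrow> v \<in> B)"
    if S: "S \<subseteq> V" "card S \<le> ?s" for S
  proof -
    obtain C where C: "conn E C" "C \<subseteq> V - S" "heavy C"
      using neg S unfolding heavy_def by (auto simp: not_le)
    then obtain x where x: "x \<in> C" unfolding heavy_def by fastforce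
    let ?B = "component E (V - S) x"
    have "heavy ?B"
      by (rule heavy_mono[OF C(3) component_maximal[OF C(2,1) x]])
        (use component_subset[of E "V - S" x] in blast)
    then show ?thesis
      by (intro exI[of _ ?B] conjI ballI impI conn_component[OF sym] component_subset)
        (auto intro: component_closed[OF sym])
  qed
  define st where "st s \<longleftrightarrow> (case s of (\<C>, X, B) \<Rightarrow> clique_model E \<C> \<and> \<Union>\<C> \<subseteq> V \<and> X \<subseteq> \<Union>\<C> \<and>
      (\<forall>C\<in>\<C>. card (X \<inter> C) \<le> h * r) \<and> conn E B \<and> B \<subseteq> V - \<Union>\<C> \<and> heavy B \<and>
      (\<forall>b\<in>B. \<forall>v\<in>V - X. E b v \<longrightarrow> v \<in> B))" for s
  have stI: "st (\<C>, X, B)"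
    if "clique_model E \<C>" "\<Union>\<C> \<subseteq> V" "X \<subseteq> \<Union>\<C>" "\<And>C. C \<in> \<C> \<Longrightarrow> card (X \<inter> C) \<le> h * r"
      "conn E B" "B \<subseteq> V - \<Union>\<C>" "heavy B" "\<And>b v. b \<in> B \<Longrightarrow> v \<in> V - X \<Longrightarrow> E b v \<Longrightarrow> v \<in> B"
    for \<C> X B
    using that unfolding st_def by simp
  \<comment> \<open>An improvement takes some \<open>t \<ge> 1\<close> vertices out of
    \<open>B\<close>, and adds at most \<open>t\<close> vertices to \<open>X\<close> and at most one
    branch set; the weight 3 makes this a decrease.\<close>
  define m where "m s = (case s of (\<C>, X, B) \<Rightarrow> card \<C> + card X + 3 * card B)"
    for s :: "'a set set \<times> 'a set \<times> 'a set"
  obtain B0 where "conn E B0" "B0 \<subseteq> V" "heavy B0" "\<forall>b\<in>B0. \<forall>v\<in>V. E b v \<longrightarrow> v \<in> B0"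
    using heavy_comp[of "{}"] by auto
  then have "st ({}, {}, B0)" unfolding st_def clique_model_def by auto
  then obtain s where s: "st s" and min: "\<And>s'. st s' \<Longrightarrow> m s \<le> m s'"
    using exists_least_iff[of "\<lambda>n. \<exists>s. st s \<and> m s = n"] not_le by metis
  obtain \<C> X B where sCXB: "s = (\<C>, X, B)" by (cases s)
  have model: "clique_model E \<C>" and CV: "\<Union>\<C> \<subseteq> V" and XC: "X \<subseteq> \<Union>\<C>"
    and XCr: "\<And>C. C \<in> \<C> \<Longrightarrow> card (X \<inter> C) \<le> h * r" and B: "conn E B" "B \<subseteq> V - \<Union>\<C>" "heavy B"
    and Bcl: "\<And>b v. b \<in> B \<Longrightarrow> v \<in> V - X \<Longrightarrow> E b v \<Longrightarrow> v \<in> B"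
    using s unfolding st_def sCXB by auto
  have pairwise: "C \<inter> D = {} \<and> touch E C D" if "C \<in> \<C>" "D \<in> \<C>" "C \<noteq> D" for C D
    using model that unfolding clique_model_def by blast
  have cC: "card \<C> < h" using minor_free model CV by blast
  have finC: "finite \<C>" using model unfolding clique_model_def by blast
  have finB: "finite B" and finX: "finite X"
    using B(2) XC CV V finite_subset[of B V] finite_subset[of X V] by blast+
  have XV: "X \<subseteq> V" using XC CV by blast
  have cX: "card X \<le> card \<C> * (h * r)"
  proof -
    have "X = (\<Union>C\<in>\<C>. X \<inter> C)" using XC by blast
    then have "card X \<le> (\<Sum>C\<in>\<C>. card (X \<inter> C))" using card_UN_le[OF finC, of "\<lambda>C. X \<inter> C"] by simp
    also have "\<dots> \<le> (\<Sum>C\<in>\<C>. h * r)" by (rule sum_mono) (rule XCr)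
    finally show ?thesis by simp
  qed
  \<comment> \<open>\<open>X\<close> has at most \<open>h * r\<close> vertices in each of fewer than
    \<open>h\<close> branch sets; the size of the separator leaves room for one more set of that
    size.\<close>
  have bound: "card (X \<union> Z) \<le> ?s" if "card Z \<le> h * r" for Z
  proof -
    have "card (X \<union> Z) \<le> card \<C> * (h * r) + h * r"
      using card_Un_le[of X Z] cX that by linarith
    also have "\<dots> \<le> h * (h * r) + h * r" using cC by simp
    finally show ?thesis by (simp add: algebra_simps)
  qed
  \<comment> \<open>Two heavy sets intersect, and a connected set that avoids \<open>X\<close>
    cannot leave \<open>B\<close>.\<close>
  have shrink: "B' \<subseteq> B" if B': "conn E B'" "B' \<subseteq> V - X" "heavy B'" for B'
  proof -
    obtain x where x: "x \<in> B'" "x \<in> B"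
      using heavy_Int[of B' B] B' B by blast
    show ?thesis
      by (rule conn_closed_subset[OF B'(1) x]) (use Bcl B' in blast)
  qed
  define att where "att C = {v\<in>B. \<exists>c\<in>C. E c v}" for C
  \<comment> \<open>A branch set without neighbours in \<open>B\<close> could be dropped, against
    minimality.\<close>
  have att_ne: "att C \<noteq> {}" if C: "C \<in> \<C>" for C
  proof
    assume empty: "att C = {}"
    have "st (\<C> - {C}, X - C, B)"
    proof -
      have "v \<in> B" if "b \<in> B" "v \<in> V - (X - C)" "E b v" for b v
      proof -
        have "v \<notin> C" using empty that sympD[OF sym that(3)] unfolding att_def by blast
        then show ?thesis using Bcl that by blast
      qed
      moreover have "clique_model E (\<C> - {C})" using model by (rule clique_model_subset) blast
      moreover have "card ((X - C) \<inter> D) \<le> h * r" if "D \<in> \<C> - {C}" for D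
      proof -
        have "card ((X - C) \<inter> D) \<le> card (X \<inter> D)" using finX by (intro card_mono) auto
        then show ?thesis using XCr[of D] that by simp
      qed
      moreover have "B \<subseteq> V - \<Union>(\<C> - {C})" "\<Union>(\<C> - {C}) \<subseteq> V" "X - C \<subseteq> \<Union>(\<C> - {C})"
        using CV XC B(2) by blast+
      ultimately show ?thesis using B(1,3) by (intro stI)
    qed
    moreover have "card (\<C> - {C}) < card \<C>" using C finC by (rule card_Diff1_less[rotated])
    moreover have "card (X - C) \<le> card X" using finX by (intro card_mono) auto
    ultimately show False using min[of "(\<C> - {C}, X - C, B)"] unfolding sCXB m_def by simp
  qed
  have cA: "card (att ` \<C>) \<le> card \<C>" using finC by (rule card_image_le)
  obtain Z where Z: "Z \<subseteq> B" "card Z * r \<le> card (att ` \<C>) * card B"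
    and ZT: "\<forall>D. conn E D \<longrightarrow> D \<subseteq> B - Z \<longrightarrow> (\<forall>A\<in>att ` \<C>. D \<inter> A \<noteq> {}) \<longrightarrow>
       (\<forall>v\<in>D. \<exists>T\<subseteq>B. conn E T \<and> v \<in> T \<and> card T \<le> card (att ` \<C>) * r + 1 \<and>
         (\<forall>A\<in>att ` \<C>. T \<inter> A \<noteq> {}))"
    using small_connector_or_cut[OF sym finB r(1) finite_imageI[OF finC], of att]
    by (elim exE conjE)
  have "card Z * r \<le> h * (r * r)"
  proof -
    have "card B \<le> card V" using B(2) V by (intro card_mono) auto
    then have "card (att ` \<C>) * card B \<le> h * (r * r)"
      using cA cC r(2) by (intro mult_le_mono) auto
    then show ?thesis using Z(2) by linarith
  qed
  then have cZ: "card Z \<le> h * r" using r(1) by (simp add: mult.assoc[symmetric])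
  obtain B' where B': "conn E B'" "B' \<subseteq> V - (X \<union> Z)" "heavy B'"
      "\<forall>b\<in>B'. \<forall>v\<in>V - (X \<union> Z). E b v \<longrightarrow> v \<in> B'"
    using heavy_comp[of "X \<union> Z"] bound[OF cZ] XV Z(1) B(2) by blast
  have B'B: "B' \<subseteq> B - Z" using shrink[OF B'(1) _ B'(3)] B'(2) by blast
  obtain b0 where b0: "b0 \<in> B'" using B'(3) unfolding heavy_def by fastforce
  show False
  proof (cases "\<forall>A\<in>att ` \<C>. B' \<inter> A \<noteq> {}")
    case True
    \<comment> \<open>\<open>T\<close> touches every branch set and is small, so it becomes a new
      branch set, and all of it goes into \<open>X\<close>.\<close>
    then obtain T where T: "T \<subseteq> B" "conn E T" "b0 \<in> T" "card T \<le> card (att ` \<C>) * r + 1"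
        "\<forall>A\<in>att ` \<C>. T \<inter> A \<noteq> {}"
      using ZT[rule_format, OF B'(1) B'B _ b0] by blast
    have "card (att ` \<C>) * r + 1 \<le> (card (att ` \<C>) + 1) * r" using r(1) by simp
    also have "\<dots> \<le> h * r" using cA cC by (intro mult_le_mono1) simp
    finally have cT: "card T \<le> h * r" using T(4) by linarith
    have finT: "finite T" using T(1) finB finite_subset by blast
    obtain B2 where B2: "conn E B2" "B2 \<subseteq> V - (X \<union> T)" "heavy B2"
        "\<forall>b\<in>B2. \<forall>v\<in>V - (X \<union> T). E b v \<longrightarrow> v \<in> B2"
      using heavy_comp[of "X \<union> T"] bound[OF cT] XV T(1) B(2) by blast
    have B2B: "B2 \<subseteq> B - T" using shrink[OF B2(1) _ B2(3)] B2(2) by blast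
    have TC: "T \<inter> C = {}" if "C \<in> \<C>" for C using T(1) B(2) that by blast
    have "T \<notin> \<C>" using TC[of T] T(3) by blast
    have touchT: "touch E C T" if "C \<in> \<C>" for C
    proof -
      have "T \<inter> att C \<noteq> {}" using T(5) that by blast
      then show ?thesis unfolding att_def touch_def by blast
    qed
    have "st (insert T \<C>, X \<union> T, B2)"
    proof -
      have "clique_model E (insert T \<C>)"
        unfolding clique_model_def
      proof (intro conjI ballI impI)
        fix C D assume "C \<in> insert T \<C>" "D \<in> insert T \<C>" "C \<noteq> D"
        then consider "C \<in> \<C>" "D \<in> \<C>" | "C = T" "D \<in> \<C>" | "C \<in> \<C>" "D = T" by blast
        then have "C \<inter> D = {} \<and> touch E C D"
        proof cases
          case 1
          then show ?thesis using pairwise \<open>C \<noteq> D\<close> by simp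
        next
          case 2
          then show ?thesis using TC[of D] touchT[of D] touch_commute[OF sym, of T D] by blast
        next
          case 3
          then show ?thesis using TC[of C] touchT[of C] by blast
        qed
        then show "C \<inter> D = {}" "touch E C D" by simp_all
      qed (use model finC T in \<open>auto simp: clique_model_def\<close>)
      moreover have "card ((X \<union> T) \<inter> D) \<le> h * r" if "D \<in> insert T \<C>" for D
      proof (cases "D = T")
        case True
        then have "(X \<union> T) \<inter> D = T" by blast
        then show ?thesis using cT by simp
      next
        case False
        then have "(X \<union> T) \<inter> D = X \<inter> D" using TC that by blast
        then show ?thesis using XCr False that by simp
      qed
      moreover have "B2 \<subseteq> V - \<Union>(insert T \<C>)" using B(2) B2B by blast
      moreover have "\<Union>(insert T \<C>) \<subseteq> V" using CV T(1) B(2) by auto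
      moreover have "X \<union> T \<subseteq> \<Union>(insert T \<C>)" using XC by auto
      ultimately show ?thesis using B2(1,3) B2(4)[rule_format] by (intro stI)
    qed
    then have "m s \<le> m (insert T \<C>, X \<union> T, B2)" by (rule min)
    moreover have "card (insert T \<C>) = card \<C> + 1" using finC \<open>T \<notin> \<C>\<close> by simp
    moreover have "card (X \<union> T) \<le> card X + card T" by (rule card_Un_le)
    moreover have "card B2 + card T \<le> card B"
    proof -
      have "card (B2 \<union> T) = card B2 + card T"
        using B2B finB finT finite_subset by (intro card_Un_disjoint) auto
      moreover have "card (B2 \<union> T) \<le> card B" using B2B T(1) finB by (intro card_mono) auto
      ultimately show ?thesis by simp
    qed
    moreover have "card T \<ge> 1" using T(3) finT by (auto simp: Suc_le_eq card_gt_0_iff)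
    ultimately show False unfolding sCXB m_def by simp
  next
    case False
    then obtain C where C: "C \<in> \<C>" "B' \<inter> att C = {}" by blast
    \<comment> \<open>\<open>C\<close> absorbs the part of \<open>B - B'\<close> that can be reached
      from it. All neighbours of the old \<open>C\<close> in \<open>B\<close> are then absorbed, and
      what remains of \<open>B\<close> sees the enlarged branch set only in
      \<open>Z \<inter> D\<close>, which has at most \<open>h * r\<close> elements.\<close>
    define D where "D = {v. \<exists>P\<subseteq>B - B'. conn E P \<and> v \<in> P \<and> P \<inter> att C \<noteq> {}}"
    have DB: "D \<subseteq> B - B'" unfolding D_def by blast
    have attD: "att C \<subseteq> D"
    proof
      fix v assume "v \<in> att C"
      then show "v \<in> D" using C(2) unfolding D_def att_def by (intro CollectI exI[of _ "{v}"]) auto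
    qed
    have Dcl: "v \<in> D" if uv: "u \<in> D" "v \<in> B - B'" "E u v \<or> E v u" for u v
    proof -
      obtain P where P: "P \<subseteq> B - B'" "conn E P" "u \<in> P" "P \<inter> att C \<noteq> {}"
        using uv(1) unfolding D_def by blast
      have "E u v" using uv(3) sympD[OF sym] by blast
      then have "touch E P {v}" using P(3) unfolding touch_def by blast
      then have "conn E (P \<union> {v})" using P(2) by (intro conn_Un[OF sym]) simp_all
      moreover have "P \<union> {v} \<subseteq> B - B'" "(P \<union> {v}) \<inter> att C \<noteq> {}" using P(1,4) uv(2) by auto
      ultimately show ?thesis unfolding D_def mem_Collect_eq by (intro exI[of _ "P \<union> {v}"]) simp
    qed
    have finD: "finite D" using DB finB finite_subset by blast
    have connCD: "conn E (C \<union> D)"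
    proof -
      have "D = (\<Union>P\<in>{P. P \<subseteq> B - B' \<and> conn E P \<and> P \<inter> att C \<noteq> {}}. P)" unfolding D_def by blast
      moreover have "conn E (C \<union> (\<Union>P\<in>{P. P \<subseteq> B - B' \<and> conn E P \<and> P \<inter> att C \<noteq> {}}. P))"
        by (rule conn_UN[OF sym]) (use model C(1) in \<open>auto simp: clique_model_def touch_def att_def\<close>)
      ultimately show ?thesis by simp
    qed
    let ?W = "B - D"
    let ?X = "(X - C) \<union> (Z \<inter> D)"
    let ?C = "insert (C \<union> D) (\<C> - {C})"
    have B'W: "B' \<subseteq> ?W" using B'B DB by blast
    \<comment> \<open>\<open>D\<close> is a union of components of \<open>B - B'\<close>, so its
      removal cannot separate the remaining ones from \<open>B'\<close>.\<close>
    have connW: "conn E ?W"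
      unfolding conn_def
    proof (intro allI impI)
      fix S assume S: "S \<subseteq> ?W" "S \<noteq> {}" "\<forall>a\<in>S. \<forall>b\<in>?W. E a b \<longrightarrow> b \<in> S"
      have full: "S = ?W" if "x \<in> S" "x \<in> B'" for x
      proof -
        have "B' \<subseteq> S"
          by (rule conn_closed_subset[OF B'(1) that(2,1)]) (use S(3) B'W in blast)
        have "B \<subseteq> S \<union> D"
        proof (rule conn_closed_subset[OF B(1), of x])
          show "x \<in> B" "x \<in> S \<union> D" using that S(1) by auto
          fix a b assume ab: "a \<in> S \<union> D" "a \<in> B" "b \<in> B" "E a b"
          show "b \<in> S \<union> D"
          proof (cases "b \<in> B' \<or> b \<in> D")
            case True
            then show ?thesis using \<open>B' \<subseteq> S\<close> by blast
          next
            case False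
            then have "a \<notin> D" using Dcl[of a b] ab by blast
            then show ?thesis using S(3) ab False by blast
          qed
        qed
        then show ?thesis using S(1) by blast
      qed
      show "S = ?W"
      proof (cases "S \<inter> B' = {}")
        case True
        have "B \<subseteq> S"
        proof -
          obtain x where x: "x \<in> S" using S(2) by blast
          show ?thesis
          proof (rule conn_closed_subset[OF B(1) _ x])
            show "x \<in> B" using x S(1) by blast
            fix a b assume ab: "a \<in> S" "a \<in> B" "b \<in> B" "E a b"
            have "b \<notin> D" using Dcl[of b a] ab S(1) True by blast
            then show "b \<in> S" using S(3) ab by blast
          qed
        qed
        then show ?thesis using S(1) by blast
      qed (use full in blast)
    qed
    have nbrW: "v \<in> ?W" if "b \<in> ?W" "v \<in> V - ?X" "E b v" for b v
    proof (cases "v \<in> B")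
      case True
      have "v \<notin> D"
      proof
        assume "v \<in> D"
        then have "b \<in> B'" using Dcl[of v b] that by blast
        then have "v \<in> X \<union> Z" using B'(4) \<open>v \<in> D\<close> DB that B(2) by blast
        then show False using that(2) \<open>v \<in> D\<close> True B(2) XC by blast
      qed
      then show ?thesis using True by blast
    next
      case False
      then have "v \<in> X" using Bcl that by blast
      then have "v \<in> C" using that(2) by blast
      then have "b \<in> att C" using that sympD[OF sym] unfolding att_def by blast
      then show ?thesis using attD that(1) by blast
    qed
    have CD: "(C \<union> D) \<inter> C' = {}" if "C' \<in> \<C> - {C}" for C'
    proof -
      have "C \<inter> C' = {}" using that pairwise[OF C(1), of C'] by blast
      moreover have "D \<inter> C' = {}" using that DB B(2) by blast
      ultimately show ?thesis by blast
    qed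
    have "st (?C, ?X, ?W)"
    proof -
      have "clique_model E ?C"
        unfolding clique_model_def
      proof (intro conjI ballI impI)
        fix C1 C2 assume 12: "C1 \<in> ?C" "C2 \<in> ?C" "C1 \<noteq> C2"
        have t: "touch E (C \<union> D) C'" if "C' \<in> \<C> - {C}" for C'
        proof -
          have "touch E C C'" using that pairwise[OF C(1), of C'] by blast
          then show ?thesis unfolding touch_def by blast
        qed
        from 12 consider "C1 \<in> \<C>" "C2 \<in> \<C>" | "C1 = C \<union> D" "C2 \<in> \<C> - {C}" | "C1 \<in> \<C> - {C}" "C2 = C \<union> D"
          by blast
        then have "C1 \<inter> C2 = {} \<and> touch E C1 C2"
        proof cases
          case 1
          then show ?thesis using pairwise 12(3) by simp
        next
          case 2
          then show ?thesis using CD[of C2] t[of C2] by blast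
        next
          case 3
          then show ?thesis using CD[of C1] t[of C1] touch_commute[OF sym, of "C \<union> D" C1] by blast
        qed
        then show "C1 \<inter> C2 = {}" "touch E C1 C2" by simp_all
      qed (use model connCD C(1) in \<open>auto simp: clique_model_def\<close>)
      moreover have "\<Union>?C \<subseteq> V" using CV C(1) DB B(2) by blast
      moreover have "?X \<subseteq> \<Union>?C" using XC by blast
      moreover have "card (?X \<inter> C') \<le> h * r" if "C' \<in> ?C" for C'
      proof (cases "C' = C \<union> D")
        case True
        have "?X \<inter> C' \<subseteq> Z" using True XC DB B(2) by blast
        then have "card (?X \<inter> C') \<le> card Z" using Z(1) finB finite_subset by (intro card_mono) auto
        then show ?thesis using cZ by simp
      next
        case False
        then have "?X \<inter> C' \<subseteq> X \<inter> C'" using CD that by blast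
        then have "card (?X \<inter> C') \<le> card (X \<inter> C')" using finX by (intro card_mono) auto
        then show ?thesis using XCr[of C'] that False by auto
      qed
      moreover have "?W \<subseteq> V - \<Union>?C" using B(2) C(1) by blast
      moreover have "heavy ?W" using B'(3) B'W B(2) by (intro heavy_mono[of B' ?W]) auto
      ultimately show ?thesis using connW nbrW by (intro stI)
    qed
    then have "m s \<le> m (?C, ?X, ?W)" by (rule min)
    moreover have "card ?C \<le> card \<C>"
      using card_insert_le_m1[of "card \<C>" "\<C> - {C}" "C \<union> D"] card_gt_0_iff[of \<C>] finC C(1) by auto
    moreover have "card ?X \<le> card X + card D"
    proof -
      have "card ?X \<le> card (X - C) + card (Z \<inter> D)" by (rule card_Un_le)
      also have "\<dots> \<le> card X + card D" using finX finD by (intro add_mono card_mono) auto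
      finally show ?thesis .
    qed
    moreover have "card ?W + card D = card B"
      using card_Int_Diff[OF finB, of D] DB Int_absorb1[of D B] by (simp add: subset_iff)
    moreover have "card D \<ge> 1"
      using attD att_ne[OF C(1)] finD by (auto simp: Suc_le_eq card_gt_0_iff)
    ultimately show False unfolding sCXB m_def by simp
  qed
qed

section \<open>The planar grid has no \<open>K\<^sub>5\<close> minor\<close>
definition grid :: "int \<times> int \<Rightarrow> int \<times> int \<Rightarrow> bool" where
  "grid p q \<longleftrightarrow> \<bar>fst p - fst q\<bar> + \<bar>snd p - snd q\<bar> = 1"

lemma symp_grid: "symp grid"
  by (auto simp: symp_def grid_def)

text \<open>\<open>crosses p q q'\<close>: the vertical ray going up from \<open>p + (1/2, 0)\<close> meets the grid edge \<open>qq'\<close>.\<close>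

definition crosses :: "int \<times> int \<Rightarrow> int \<times> int \<Rightarrow> int \<times> int \<Rightarrow> bool" where
  "crosses p q q' \<longleftrightarrow> snd q = snd q' \<and> snd q > snd p \<and>
     (fst q = fst p \<and> fst q' = fst p + 1 \<or> fst q' = fst p \<and> fst q = fst p + 1)"

text \<open>The left to right order of the upward rays at infinity, with ties within a column broken
  by height.\<close>

definition prec :: "int \<times> int \<Rightarrow> int \<times> int \<Rightarrow> bool" where
  "prec p s \<longleftrightarrow> fst p < fst s \<or> fst p = fst s \<and> snd p > snd s"

text \<open>A walk in \<open>C\<close> from \<open>p\<close> to \<open>q\<close>, recorded by the number \<open>f z\<close> of its crossings with the ray
  from \<open>z\<close>.\<close>

inductive grid_walk :: "(int \<times> int) set \<Rightarrow> int \<times> int \<Rightarrow> int \<times> int \<Rightarrow> (int \<times> int \<Rightarrow> int) \<Rightarrow> bool"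
  for C p where
  refl: "p \<in> C \<Longrightarrow> grid_walk C p p (\<lambda>_. 0)"
| step: "grid_walk C p q f \<Longrightarrow> q' \<in> C \<Longrightarrow> grid q q' \<Longrightarrow>
    grid_walk C p q' (\<lambda>z. f z + of_bool (crosses z q q'))"

lemma grid_walk_ends: "grid_walk C p q f \<Longrightarrow> p \<in> C \<and> q \<in> C"
  by (induction rule: grid_walk.induct) auto

lemma conn_grid_walk:
  assumes "conn grid C" "p \<in> C" "q \<in> C"
  shows "\<exists>f. grid_walk C p q f"
proof -
  have "C \<subseteq> {y. \<exists>f. grid_walk C p y f}"
    by (rule conn_closed_subset[OF assms(1,2)]) (use assms(2) grid_walk.intros in blast)+
  then show ?thesis using assms(3) by blast
qed

text \<open>Picture each edge closed up by the two rays from its ends: two closed curves cross an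
  even number of times. \<open>crosses\<close> counts the crossings of rays with edges,
  \<open>prec\<close> tells whether the rays interleave at infinity, and disjoint grid edges do not
  cross. The proof checks the four directions of either edge.\<close>

lemma edge_edge_parity:
  assumes "grid p p'" "grid s s'" "p \<noteq> s" "p \<noteq> s'" "p' \<noteq> s" "p' \<noteq> s'"
  shows "even (of_bool (crosses p s s') + of_bool (crosses p' s s') +
     of_bool (crosses s p p') + of_bool (crosses s' p p') +
     of_bool (prec p s) + of_bool (prec p s') + of_bool (prec p' s) + of_bool (prec p' s') :: int)"
proof -
  obtain a b c d where p: "p = (a, b)" and s: "s = (c, d)" by fastforce
  have p': "p' = (a + 1, b) \<or> p' = (a - 1, b) \<or> p' = (a, b + 1) \<or> p' = (a, b - 1)"
    using assms(1) by (cases p') (auto simp: grid_def p)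
  have s': "s' = (c + 1, d) \<or> s' = (c - 1, d) \<or> s' = (c, d + 1) \<or> s' = (c, d - 1)"
    using assms(2) by (cases s') (auto simp: grid_def s)
  show ?thesis
    using p' s' assms(3-) unfolding p s
    by (elim disjE; simp add: crosses_def prec_def; smt (verit) even_add odd_one even_zero of_bool_def)
qed

text \<open>The sum of \<open>edge_edge_parity\<close> along the walk: terms of inner vertices occur
  twice and vanish modulo 2. \<open>walk_walk_parity\<close> repeats this along the other
  walk.\<close>

lemma edge_walk_parity:
  assumes "grid_walk D s t g" "grid q q'" "q \<notin> D" "q' \<notin> D"
  shows "even (g q + g q' + of_bool (crosses s q q') + of_bool (crosses t q q') +
     of_bool (prec q s) + of_bool (prec q t) + of_bool (prec q' s) + of_bool (prec q' t))"
  using assms(1)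
proof (induction rule: grid_walk.induct)
  case refl
  then show ?case by simp
next
  case (step t g t')
  have "t \<in> D" using grid_walk_ends[OF step.hyps(1)] by blast
  then have "even (of_bool (crosses q t t') + of_bool (crosses q' t t') +
     of_bool (crosses t q q') + of_bool (crosses t' q q') +
     of_bool (prec q t) + of_bool (prec q t') + of_bool (prec q' t) + of_bool (prec q' t') :: int)"
    using assms step.hyps by (intro edge_edge_parity) auto
  from dvd_add[OF step.IH this] show ?case by (simp add: algebra_simps)
qed

lemma walk_walk_parity:
  assumes "grid_walk C p q f" "grid_walk D s t g" "C \<inter> D = {}"
  shows "even (g p + g q + f s + f t +
     of_bool (prec p s) + of_bool (prec p t) + of_bool (prec q s) + of_bool (prec q t))"
  using assms(1)
proof (induction rule: grid_walk.induct)
  case refl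
  then show ?case by simp
next
  case (step q f q')
  have "q \<in> C" using grid_walk_ends[OF step.hyps(1)] by blast
  then have "even (g q + g q' + of_bool (crosses s q q') + of_bool (crosses t q q') +
     of_bool (prec q s) + of_bool (prec q t) + of_bool (prec q' s) + of_bool (prec q' t))"
    using assms step.hyps by (intro edge_walk_parity) auto
  from dvd_add[OF step.IH this] show ?case by (simp add: algebra_simps)
qed

text \<open>The three ways of splitting four points into two pairs: exactly one of them interleaves.\<close>

lemma prec_interleaving_parity:
  assumes "distinct [p, q, s, t]"
  shows "odd (of_bool (prec p s) + of_bool (prec p t) + of_bool (prec q s) + of_bool (prec q t) +
     of_bool (prec p q) + of_bool (prec p t) + of_bool (prec s q) + of_bool (prec s t) +
     of_bool (prec p q) + of_bool (prec p s) + of_bool (prec t q) + of_bool (prec t s) :: int)"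
proof -
  have tot: "prec y x = (\<not> prec x y)" if "x \<noteq> y" for x y
    using that by (auto simp: prec_def prod_eq_iff)
  have eqs: "prec q p = (\<not> prec p q)" "prec s q = (\<not> prec q s)" "prec t q = (\<not> prec q t)"
      "prec t s = (\<not> prec s t)" "prec s p = (\<not> prec p s)" "prec t p = (\<not> prec p t)"
    using assms tot by auto
  show ?thesis
    unfolding eqs
    by (cases "prec p q"; cases "prec p s"; cases "prec p t"; cases "prec q s"; cases "prec q t";
        cases "prec s t"; simp)
qed

lemma grid_no_K5:
  assumes "clique_model grid \<C>"
  shows "card \<C> < 5"
proof (rule ccontr)
  assume "\<not> card \<C> < 5"
  then obtain \<B> where "\<B> \<subseteq> \<C>" "card \<B> = 5"
    using obtain_subset_with_card_n[of 5 \<C>] by (metis not_less)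
  then obtain b where b: "bij_betw b {0..<5::nat} \<B>"
    by (metis ex_bij_betw_nat_finite card.infinite zero_neq_numeral)
  have bC: "b i \<in> \<C>" if "i < 5" for i
    using bij_betwE[OF b] that \<open>\<B> \<subseteq> \<C>\<close> by auto
  have bne: "b i \<noteq> b j" if "i < 5" "j < 5" "i \<noteq> j" for i j
    using bij_betw_imp_inj_on[OF b] that by (auto simp: inj_on_def)
  have con: "conn grid (b i)" "b i \<noteq> {}" if "i < 5" for i
    using assms bC[OF that] by (auto simp: clique_model_def)
  have disj: "b i \<inter> b j = {}" "touch grid (b i) (b j)" if "i < 5" "j < 5" "i \<noteq> j" for i j
    using assms bC bne[OF that] that by (auto simp: clique_model_def)
  define x where "x i = (SOME y. y \<in> b i)" for i
  have x: "x i \<in> b i" if "i < 5" for i using con(2)[OF that] some_in_eq unfolding x_def by blast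
  have "\<exists>f. grid_walk (b i \<union> b j) (x i) (x j) f" if "i < 5" "j < 5" "i \<noteq> j" for i j
  proof (rule conn_grid_walk)
    show "conn grid (b i \<union> b j)"
      using con disj that by (intro conn_Un symp_grid) auto
  qed (use x that in auto)
  then obtain f where f: "\<And>i j. i < 5 \<Longrightarrow> j < 5 \<Longrightarrow> i \<noteq> j \<Longrightarrow>
      grid_walk (b i \<union> b j) (x i) (x j) (f i j)"
    by metis
  define k where "k i j l = f i j (x l)" for i j l
  \<comment> \<open>The walk for \<open>i, j\<close> stays inside \<open>b i \<union> b j\<close>,
    so walks for disjoint pairs are disjoint.\<close>
  have pair: "even (k l m i + k l m j + k i j l + k i j m + of_bool (prec (x i) (x l)) +
      of_bool (prec (x i) (x m)) + of_bool (prec (x j) (x l)) + of_bool (prec (x j) (x m)))"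
    if "i < 5" "j < 5" "l < 5" "m < 5" "distinct [i, j, l, m]" for i j l m
  proof -
    have "(b i \<union> b j) \<inter> (b l \<union> b m) = {}" using disj(1) that by auto
    then show ?thesis
      unfolding k_def using that by (intro walk_walk_parity[OF f f]) auto
  qed
  \<comment> \<open>Adding the three pairings of one quadruple eliminates the order terms, whose
    total is odd.\<close>
  have quad: "odd (k l m i + k l m j + k i j l + k i j m + k j m i + k j m l + k i l j + k i l m +
      k j l i + k j l m + k i m j + k i m l)"
    if lt: "i < 5" "j < 5" "l < 5" "m < 5" "distinct [i, j, l, m]" for i j l m
  proof -
    have "x i \<noteq> x j" if "i < 5" "j < 5" "i \<noteq> j" for i j
      using x[of i] x[of j] disj(1)[OF that] that by auto
    then have "distinct [x i, x j, x l, x m]" using lt by auto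
    note odd = prec_interleaving_parity[OF this]
    have "even (k l m i + k l m j + k i j l + k i j m + of_bool (prec (x i) (x l)) +
        of_bool (prec (x i) (x m)) + of_bool (prec (x j) (x l)) + of_bool (prec (x j) (x m)) +
      (k j m i + k j m l + k i l j + k i l m + of_bool (prec (x i) (x j)) +
        of_bool (prec (x i) (x m)) + of_bool (prec (x l) (x j)) + of_bool (prec (x l) (x m))) +
      (k j l i + k j l m + k i m j + k i m l + of_bool (prec (x i) (x j)) +
        of_bool (prec (x i) (x l)) + of_bool (prec (x m) (x j)) + of_bool (prec (x m) (x l))))"
      using lt by (intro dvd_add[OF dvd_add] pair) auto
    from dvd_diff[OF this] odd show ?thesis
      by (smt (verit, ccfv_threshold) even_add)
  qed
  have 1: "odd (k 2 3 0 + k 2 3 1 + k 0 1 2 + k 0 1 3 + k 1 3 0 + k 1 3 2 + k 0 2 1 + k 0 2 3 +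
      k 1 2 0 + k 1 2 3 + k 0 3 1 + k 0 3 2)" (is "odd ?S1") using quad[of 0 1 2 3] by simp
  have 2: "odd (k 2 4 0 + k 2 4 1 + k 0 1 2 + k 0 1 4 + k 1 4 0 + k 1 4 2 + k 0 2 1 + k 0 2 4 +
      k 1 2 0 + k 1 2 4 + k 0 4 1 + k 0 4 2)" (is "odd ?S2") using quad[of 0 1 2 4] by simp
  have 3: "odd (k 3 4 0 + k 3 4 1 + k 0 1 3 + k 0 1 4 + k 1 4 0 + k 1 4 3 + k 0 3 1 + k 0 3 4 +
      k 1 3 0 + k 1 3 4 + k 0 4 1 + k 0 4 3)" (is "odd ?S3") using quad[of 0 1 3 4] by simp
  have 4: "odd (k 3 4 0 + k 3 4 2 + k 0 2 3 + k 0 2 4 + k 2 4 0 + k 2 4 3 + k 0 3 2 + k 0 3 4 +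
      k 2 3 0 + k 2 3 4 + k 0 4 2 + k 0 4 3)" (is "odd ?S4") using quad[of 0 2 3 4] by simp
  have 5: "odd (k 3 4 1 + k 3 4 2 + k 1 2 3 + k 1 2 4 + k 2 4 1 + k 2 4 3 + k 1 3 2 + k 1 3 4 +
      k 2 3 1 + k 2 3 4 + k 1 4 2 + k 1 4 3)" (is "odd ?S5") using quad[of 1 2 3 4] by simp
  \<comment> \<open>A term \<open>k i j l\<close> occurs in exactly the two quadruples that contain
    \<open>i\<close>, \<open>j\<close> and \<open>l\<close>. The five odd sums therefore have an
    even total.\<close>
  have "odd (?S1 + ?S2 + ?S3 + ?S4 + ?S5)" 
  proof -
    have "odd (a + b + c + d + e)" if "odd a" "odd b" "odd c" "odd d" "odd e" for a b c d e :: int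
      using that by simp
    then show ?thesis using 1 2 3 4 5 by blast
  qed
  moreover have "?S1 + ?S2 + ?S3 + ?S4 + ?S5 = 2 * (k 0 1 2 + k 0 1 3 + k 0 1 4 + k 0 2 1 + k 0 2 3 + k 0 2 4 +
      k 0 3 1 + k 0 3 2 + k 0 3 4 + k 0 4 1 + k 0 4 2 + k 0 4 3 +
      k 1 2 0 + k 1 2 3 + k 1 2 4 + k 1 3 0 + k 1 3 2 + k 1 3 4 +
      k 1 4 0 + k 1 4 2 + k 1 4 3 + k 2 3 0 + k 2 3 1 + k 2 3 4 +
      k 2 4 0 + k 2 4 1 + k 2 4 3 + k 3 4 0 + k 3 4 1 + k 3 4 2)"
    by (simp add: algebra_simps)
  ultimately show False by simp
qed

section \<open>Subgraphs of the planar grid\<close>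

lemma conn_Union_quotient:
  assumes "conn F \<P>" "\<And>P. P \<in> \<P> \<Longrightarrow> conn E P \<and> P \<noteq> {}"
    and "\<And>P P'. P \<in> \<P> \<Longrightarrow> P' \<in> \<P> \<Longrightarrow> F P P' \<Longrightarrow> touch E P P'"
  shows "conn E (\<Union>\<P>)"
  unfolding conn_def
proof (intro allI impI)
  fix S assume S: "S \<subseteq> \<Union>\<P>" "S \<noteq> {}" "\<forall>a\<in>S. \<forall>b\<in>\<Union>\<P>. E a b \<longrightarrow> b \<in> S"
  have sub: "P \<subseteq> S" if "P \<in> \<P>" "x \<in> P" "x \<in> S" for P x
  proof (rule conn_closed_subset[OF _ that(2,3)])
    show "conn E P" using assms(2) that(1) by blast
  qed (use S(3) that(1) in blast)
  obtain x P0 where x: "x \<in> S" "x \<in> P0" "P0 \<in> \<P>" using S(1,2) by blast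
  have "\<P> \<subseteq> {P. P \<subseteq> S}"
  proof (rule conn_closed_subset[OF assms(1) x(3)])
    show "P0 \<in> {P. P \<subseteq> S}" using sub x by blast
    fix P P' assume P: "P \<in> {P. P \<subseteq> S}" "P \<in> \<P>" "P' \<in> \<P>" "F P P'"
    then obtain a b where "a \<in> P" "b \<in> P'" "a = b \<or> E a b"
      using assms(3) unfolding touch_def by blast
    then have "b \<in> S" using S(3) P by blast
    then show "P' \<in> {P. P \<subseteq> S}" using sub P(3) \<open>b \<in> P'\<close> by blast
  qed
  then show "S = \<Union>\<P>" using S(1) by blast
qed

lemma conn_image:
  assumes "conn E C" "\<And>a b. a \<in> C \<Longrightarrow> b \<in> C \<Longrightarrow> E a b \<Longrightarrow> f a = f b \<or> F (f a) (f b)"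
  shows "conn F (f ` C)"
  unfolding conn_def
proof (intro allI impI)
  fix S assume S: "S \<subseteq> f ` C" "S \<noteq> {}" "\<forall>a\<in>S. \<forall>b\<in>f ` C. F a b \<longrightarrow> b \<in> S"
  obtain x where x: "x \<in> C" "f x \<in> S" using S(1,2) by blast
  have "C \<subseteq> {v. f v \<in> S}"
  proof (rule conn_closed_subset[OF assms(1) x(1)])
    show "x \<in> {v. f v \<in> S}" using x by simp
    fix a b assume ab: "a \<in> {v. f v \<in> S}" "a \<in> C" "b \<in> C" "E a b"
    then show "b \<in> {v. f v \<in> S}" using assms(2)[of a b] S(3) by auto
  qed
  then show "S = f ` C" using S(1) by blast
qed

lemma grid_nbrs: "finite {v. grid u v}" "card {v. grid u v} \<le> 4"
proof -
  obtain a b where u: "u = (a, b)" by fastforce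
  let ?N = "{(a + 1, b), (a - 1, b), (a, b + 1), (a, b - 1)}"
  have sub: "{v. grid u v} \<subseteq> ?N" by (auto simp: grid_def u)
  then show "finite {v. grid u v}" by (rule finite_subset) simp
  have "card {v. grid u v} \<le> card ?N" using sub by (intro card_mono) auto
  also have "\<dots> \<le> 4" using card_length[of "[(a + 1, b), (a - 1, b), (a, b + 1), (a, b - 1)]"] by simp
  finally show "card {v. grid u v} \<le> 4" .
qed

lemma grid_nbrs_of_set:
  assumes "finite A"
  shows "finite {v. \<exists>x\<in>A. grid x v}" "card {v. \<exists>x\<in>A. grid x v} \<le> 4 * card A"
proof -
  have eq: "{v. \<exists>x\<in>A. grid x v} = (\<Union>x\<in>A. {v. grid x v})" by blast
  show "finite {v. \<exists>x\<in>A. grid x v}" unfolding eq using assms grid_nbrs(1) by blast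
  have "card (\<Union>x\<in>A. {v. grid x v}) \<le> (\<Sum>x\<in>A. card {v. grid x v})" using assms by (rule card_UN_le)
  also have "\<dots> \<le> (\<Sum>x\<in>A. 4)" by (rule sum_mono) (rule grid_nbrs(2))
  finally show "card {v. \<exists>x\<in>A. grid x v} \<le> 4 * card A" unfolding eq by simp
qed

text \<open>The core has at most \<open>(8 * k + 1) * card X\<close> vertices, and the contracted
  graph at most 5 times as many; its square root, rounded up within a factor 2, is \<open>r\<close>.
  With \<open>h = 5\<close> the separator has at most \<open>30 * r\<close> members, each replaced
  by at most \<open>2 * k\<close> vertices.\<close>

definition sep_const :: "nat \<Rightarrow> real" where
  "sep_const k = 120 * real k * sqrt (5 * (8 * real k + 1))"

text \<open>Contracting each component of the complement of the core \<open>K\<close> gives a minor of the grid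
  with \<open>O(|X|)\<close> vertices; a contracted component in its separator is replaced by its at
  most \<open>2 k\<close> neighbours in the core.\<close>

lemma grid_separator:
  assumes Q: "finite Q" "X \<subseteq> Q" "X \<noteq> {}" and td: "td grid k (Q - X) R" and k: "k \<ge> 1"
  shows "\<exists>S\<subseteq>Q. real (card S) \<le> sep_const k * sqrt (card X) \<and>
    (\<forall>C. conn grid C \<longrightarrow> C \<subseteq> Q - S \<longrightarrow> 2 * card (C \<inter> X) \<le> card X)"
proof -
  let ?n = "card X"
  note sym = symp_grid
  have finX: "finite X" using Q finite_subset by blast
  have n1: "?n \<ge> 1" using finX Q(3) by (simp add: Suc_le_eq card_gt_0_iff)
  \<comment> \<open>The decomposition says nothing about \<open>X\<close>. With the neighbours of
    \<open>X\<close> marked, a component outside the core has no neighbour in \<open>X\<close>, so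
    the bound of \<open>td_core\<close> covers its whole neighbourhood in the core.\<close>
  define M where "M = {v \<in> Q - X. \<exists>x\<in>X. grid x v}"
  have cM: "card M \<le> 4 * ?n"
    using card_mono[of "{v. \<exists>x\<in>X. grid x v}" M] grid_nbrs_of_set[OF finX] unfolding M_def by force
  obtain Z where Z: "M \<subseteq> Z" "Z \<subseteq> Q - X" "card Z \<le> 2 * k * card M"
    and Zn: "\<And>C. conn grid C \<Longrightarrow> C \<subseteq> Q - X - Z \<Longrightarrow> card {z\<in>Z. \<exists>c\<in>C. grid c z} \<le> 2 * k"
    using td_core[OF td sym, of M] unfolding M_def by blast
  define K where "K = X \<union> Z"
  have KQ: "K \<subseteq> Q" using Z(2) Q(2) unfolding K_def by blast
  have finK: "finite K" using KQ Q(1) finite_subset by blast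
  have "card Z \<le> 2 * k * (4 * ?n)" using Z(3) mult_le_mono2[OF cM, of "2 * k"] by linarith
  then have cK: "card K \<le> (8 * k + 1) * ?n"
    using card_Un_le[of X Z] unfolding K_def by (simp add: algebra_simps)
  define part where "part v = (if v \<in> K then {v} else component grid (Q - K) v)" for v
  have self: "v \<in> part v" if "v \<in> Q" for v
    using that component_self[of v "Q - K" grid] unfolding part_def by auto
  have partQ: "part v \<subseteq> Q" if "v \<in> Q" for v
    using that component_subset[of grid "Q - K" v] unfolding part_def by auto
  have part_conn: "conn grid (part v)" for v
    unfolding part_def using conn_component[OF sym] by simp
  have part_eq: "part u = part v" if "u \<in> part v" for u v
    using that component_eq[OF sym, of u "Q - K" v] component_subset[of grid "Q - K" v]
    unfolding part_def by (auto split: if_splits)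
  have exit: "b \<in> K" if "a \<in> part v" "a \<notin> K" "b \<in> Q" "b \<notin> part v" "grid a b" for a b v
    using that component_closed[OF sym, of a "Q - K" v b] unfolding part_def
    by (auto split: if_splits)
  \<comment> \<open>Only components next to the core are kept; a core vertex has at most four
    neighbours, whence the factor 5 in \<open>cVH\<close>.\<close>
  define U where "U = K \<union> {v\<in>Q. \<exists>z\<in>K. grid z v}"
  define VH where "VH = part ` U"
  define F where "F P P' \<longleftrightarrow> P \<noteq> P' \<and> touch grid P P'" for P P'
  have symF: "symp F" using touch_commute[OF sym] unfolding F_def symp_def by blast
  have UQ: "U \<subseteq> Q" using KQ unfolding U_def by blast
  have finU: "finite U" using UQ Q(1) finite_subset by blast
  have finVH: "finite VH" unfolding VH_def using finU by simp
  have cVH: "card VH \<le> 5 * card K"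
  proof -
    have "card VH \<le> card U" unfolding VH_def by (rule card_image_le[OF finU])
    also have "\<dots> \<le> card K + card {v\<in>Q. \<exists>z\<in>K. grid z v}" unfolding U_def by (rule card_Un_le)
    also have "card {v\<in>Q. \<exists>z\<in>K. grid z v} \<le> card {v. \<exists>z\<in>K. grid z v}"
      by (rule card_mono) (use grid_nbrs_of_set[OF finK] in auto)
    also have "\<dots> \<le> 4 * card K" using grid_nbrs_of_set[OF finK] by simp
    finally show ?thesis by simp
  qed
  have VHD: "\<exists>v\<in>Q. P = part v" if "P \<in> VH" for P using that UQ unfolding VH_def by blast
  have VH_disj: "P \<inter> P' = {}" if "P \<in> VH" "P' \<in> VH" "P \<noteq> P'" for P P'
  proof (rule ccontr)
    assume "P \<inter> P' \<noteq> {}"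
    then obtain u where "u \<in> P" "u \<in> P'" by blast
    then have "part u = P" "part u = P'" using VHD part_eq that by blast+
    then show False using that by blast
  qed
  have VH_ne: "conn grid P \<and> P \<noteq> {}" if "P \<in> VH" for P
    using VHD[OF that] self part_conn by blast
  \<comment> \<open>A branch set of the contracted graph is a family of parts; the unions of these
    families form a clique model in the grid.\<close>
  have minor_free: "card \<C> < 5" if model: "clique_model F \<C>" and sub: "\<Union>\<C> \<subseteq> VH" for \<C>
  proof -
    have C: "finite \<C>" "\<And>\<P>. \<P> \<in> \<C> \<Longrightarrow> conn F \<P> \<and> \<P> \<noteq> {}"
      "\<And>\<P> \<R>. \<P> \<in> \<C> \<Longrightarrow> \<R> \<in> \<C> \<Longrightarrow> \<P> \<noteq> \<R> \<Longrightarrow> \<P> \<inter> \<R> = {} \<and> touch F \<P> \<R>"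
      using model unfolding clique_model_def by simp_all
    have ne: "\<Union>\<P> \<noteq> {}" if "\<P> \<in> \<C>" for \<P>
    proof -
      obtain P where "P \<in> \<P>" using C(2) \<open>\<P> \<in> \<C>\<close> by blast
      then show ?thesis using VH_ne[of P] sub \<open>\<P> \<in> \<C>\<close> by blast
    qed
    have disj: "\<Union>\<P> \<inter> \<Union>\<R> = {}" if PR: "\<P> \<in> \<C>" "\<R> \<in> \<C>" "\<P> \<noteq> \<R>" for \<P> \<R>
    proof -
      have "P \<inter> R = {}" if "P \<in> \<P>" "R \<in> \<R>" for P R
      proof (rule VH_disj)
        show "P \<in> VH" "R \<in> VH" using that PR sub by blast+
        show "P \<noteq> R" using C(3)[OF PR] that by blast
      qed
      then show ?thesis by blast
    qed
    have inj: "inj_on Union \<C>"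
      using disj ne by (metis Int_absorb inj_onI)
    have "clique_model grid (Union ` \<C>)"
      unfolding clique_model_def
    proof (intro conjI ballI impI)
      show "finite (Union ` \<C>)" using C(1) by simp
      fix A assume "A \<in> Union ` \<C>"
      then obtain \<P> where A: "A = \<Union>\<P>" "\<P> \<in> \<C>" by blast
      show "A \<noteq> {}" using ne A by blast
      show "conn grid A" unfolding A(1)
        by (rule conn_Union_quotient[of F]) (use C(2) A(2) VH_ne sub in \<open>auto simp: F_def\<close>)
      fix A' assume "A' \<in> Union ` \<C>" "A \<noteq> A'"
      then obtain \<R> where A': "A' = \<Union>\<R>" "\<R> \<in> \<C>" "\<P> \<noteq> \<R>" using A by blast
      show "A \<inter> A' = {}" unfolding A(1) A'(1) using disj A(2) A'(2,3) by blast
      obtain P P' where "P \<in> \<P>" "P' \<in> \<R>" "P = P' \<or> F P P'"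
        using C(3)[OF A(2) A'(2,3)] unfolding touch_def by blast
      moreover have "P \<noteq> P'" using C(3)[OF A(2) A'(2,3)] calculation by blast
      ultimately show "touch grid A A'" unfolding F_def touch_def A(1) A'(1) by blast
    qed
    then have "card (Union ` \<C>) < 5" by (rule grid_no_K5)
    then show ?thesis using card_image[OF inj] by simp
  qed
  let ?a = "5 * (8 * real k + 1)"
  define r where "r = nat \<lceil>sqrt (?a * ?n)\<rceil>"
  have an: "?a * real ?n \<ge> 1" using n1 k by (intro mult_ge1_I[of ?a "real ?n"]) auto
  then have s1: "sqrt (?a * ?n) \<ge> 1" by simp
  have r_ge: "real r \<ge> sqrt (?a * ?n)" unfolding r_def using s1 by linarith
  then have r1: "r \<ge> 1" using s1 by linarith
  have r_le: "real r \<le> 2 * sqrt (?a * ?n)" unfolding r_def using s1 by linarith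
  have "card VH \<le> r * r"
  proof -
    have "real (card VH) \<le> 5 * real (card K)" using cVH by linarith
    also have "real (card K) \<le> (8 * real k + 1) * ?n" using cK
      by (metis (mono_tags, lifting) of_nat_1 of_nat_add of_nat_le_iff of_nat_mult of_nat_numeral)
    finally have "real (card VH) \<le> ?a * ?n" by (simp only: mult.assoc)
    also have "\<dots> = sqrt (?a * ?n) * sqrt (?a * ?n)" using an by simp
    also have "\<dots> \<le> real r * real r" using r_ge s1 by (intro mult_mono) auto
    finally show ?thesis by (metis of_nat_le_iff of_nat_mult)
  qed
  \<comment> \<open>Weight sits on the singleton parts that come from \<open>X\<close>, so balance
    refers to \<open>X\<close> alone.\<close>
  define w :: "(int \<times> int) set \<Rightarrow> nat" where "w P = of_bool (\<exists>x\<in>X. P = {x})" for P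
  obtain SH where SH: "SH \<subseteq> VH" "card SH \<le> 5 * (5 + 1) * r"
    and bal: "\<And>\<D>. conn F \<D> \<Longrightarrow> \<D> \<subseteq> VH - SH \<Longrightarrow> 2 * sum w \<D> \<le> sum w VH"
    using clique_minor_free_separator[OF symF finVH minor_free r1 \<open>card VH \<le> r * r\<close>, of w] by blast
  have sumw: "sum w \<D> = card {P\<in>\<D>. \<exists>x\<in>X. P = {x}}" if "finite \<D>" for \<D>
    using that unfolding w_def by (simp add: sum_of_bool_eq Int_def)
  define bd where "bd P = (if \<exists>z\<in>K. P = {z} then P else {z\<in>K. \<exists>c\<in>P. grid c z})" for P
  have card_bd: "card (bd P) \<le> 2 * k" if P: "P \<in> VH" for P
  proof (cases "\<exists>z\<in>K. P = {z}")
    case True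
    then show ?thesis using k unfolding bd_def by auto
  next
    case False
    obtain v where v: "v \<in> Q" "P = part v" using VHD[OF P] by blast
    then have "v \<notin> K" using False unfolding part_def by auto
    then have PK: "P \<subseteq> Q - K" using v component_subset[of grid "Q - K" v] unfolding part_def by simp
    have "{z\<in>K. \<exists>c\<in>P. grid c z} = {z\<in>Z. \<exists>c\<in>P. grid c z}"
    proof -
      have "\<not> grid c x" if "c \<in> P" "x \<in> X" for c x
        using that PK Z(1) sympD[OF sym, of c x] unfolding M_def K_def by blast
      then show ?thesis unfolding K_def by blast
    qed
    then show ?thesis using Zn[of P] VH_ne[OF P] PK False unfolding bd_def K_def by auto
  qed
  define S where "S = (\<Union>P\<in>SH. bd P)"
  have finSH: "finite SH" using SH(1) finVH finite_subset by blast
  have SQ: "S \<subseteq> Q"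
  proof -
    have "bd P \<subseteq> Q" for P using KQ unfolding bd_def by auto
    then show ?thesis unfolding S_def by blast
  qed
  have "card S \<le> (\<Sum>P\<in>SH. card (bd P))" unfolding S_def by (rule card_UN_le[OF finSH])
  also have "\<dots> \<le> (\<Sum>P\<in>SH. 2 * k)" by (rule sum_mono) (use card_bd SH(1) in blast)
  also have "\<dots> \<le> 30 * r * (2 * k)" using SH(2) by simp
  finally have "real (card S) \<le> 60 * real k * real r"
    by (metis (mono_tags, opaque_lifting) mult.assoc mult.commute mult.left_commute mult_numeral_left_semiring_numeral num_double numeral_times_numeral of_nat_le_iff of_nat_mult of_nat_numeral)
  also have "\<dots> \<le> 60 * real k * (2 * sqrt (?a * ?n))" using r_le by (intro mult_left_mono) auto
  also have "\<dots> = sep_const k * sqrt ?n" unfolding sep_const_def by (simp add: real_sqrt_mult)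
  finally have cS: "real (card S) \<le> sep_const k * sqrt ?n" .
  have "2 * card (C \<inter> X) \<le> ?n" if C: "conn grid C" "C \<subseteq> Q - S" for C
  proof (cases "C \<inter> X = {}")
    case False
    then obtain x0 where x0: "x0 \<in> C" "x0 \<in> X" by blast
    \<comment> \<open>\<open>C\<close> meets \<open>X\<close>, which lies in the core, so if
      \<open>C\<close> enters a contracted component it also has a vertex \<open>b\<close> in the
      boundary of that component. A component chosen for \<open>SH\<close> would have put
      \<open>b\<close> into \<open>S\<close>.\<close>
    have good: "part v \<in> VH - SH" if v: "v \<in> C" for v
    proof (cases "v \<in> K")
      case True
      then have "part v = {v}" unfolding part_def by simp
      moreover have "{v} \<notin> SH" using v C(2) True unfolding S_def bd_def by auto
      moreover have "part v \<in> VH" using True unfolding VH_def U_def by blast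
      ultimately show ?thesis by simp
    next
      case False
      have vQ: "v \<in> Q" using v C(2) by blast
      have PK: "part v \<subseteq> Q - K" using False component_subset[of grid "Q - K" v] unfolding part_def by simp
      have "\<not> C \<subseteq> part v" using x0 PK unfolding K_def by blast
      then obtain a b where ab: "a \<in> part v" "a \<in> C" "b \<in> C" "grid a b" "b \<notin> part v"
        using conn_closed_subset[OF C(1) v self[OF vQ]] by blast
      have bK: "b \<in> K" using exit[OF ab(1) _ _ ab(5,4)] ab(1,3) PK C(2) by blast
      then have "a \<in> U" using ab(1,4) PK sympD[OF sym] unfolding U_def by blast
      then have "part v \<in> VH" using part_eq[OF ab(1)] unfolding VH_def by (metis image_eqI)
      moreover have "part v \<notin> SH"
      proof
        assume "part v \<in> SH"
        moreover have "b \<in> bd (part v)"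
        proof -
          have "\<not> (\<exists>z\<in>K. part v = {z})" using PK by blast
          then show ?thesis unfolding bd_def using bK ab by auto
        qed
        ultimately show False using C(2) ab(3) unfolding S_def by blast
      qed
      ultimately show ?thesis by blast
    qed
    have "conn F (part ` C)"
    proof (rule conn_image[OF C(1)])
      fix a b assume ab: "a \<in> C" "b \<in> C" "grid a b"
      then have "touch grid (part a) (part b)" using self C(2) unfolding touch_def by blast
      then show "part a = part b \<or> F (part a) (part b)" unfolding F_def by blast
    qed
    then have le: "2 * sum w (part ` C) \<le> sum w VH" by (rule bal) (use good in blast)
    have finC: "finite C" using C(2) Q(1) finite_subset by blast
    have sing: "inj_on (\<lambda>x. {x}) A" for A :: "(int \<times> int) set" by (simp add: inj_on_def)
    have "sum w VH \<le> card ((\<lambda>x. {x}) ` X)"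
      unfolding sumw[OF finVH] by (rule card_mono) (use finX in auto)
    then have 1: "sum w VH \<le> ?n" using card_image[OF sing] by simp
    have "card ((\<lambda>x. {x}) ` (C \<inter> X)) \<le> sum w (part ` C)"
      unfolding sumw[OF finite_imageI[OF finC]]
    proof (rule card_mono)
      show "(\<lambda>x. {x}) ` (C \<inter> X) \<subseteq> {P \<in> part ` C. \<exists>x\<in>X. P = {x}}"
      proof
        fix P assume "P \<in> (\<lambda>x. {x}) ` (C \<inter> X)"
        then obtain x where x: "P = {x}" "x \<in> C" "x \<in> X" by blast
        then have "P = part x" unfolding part_def K_def by simp
        then show "P \<in> {P \<in> part ` C. \<exists>x\<in>X. P = {x}}" using x by blast
      qed
    qed (use finC in simp)
    then have "card (C \<inter> X) \<le> sum w (part ` C)" using card_image[OF sing] by simp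
    then show ?thesis using le 1 by linarith
  qed simp
  then show ?thesis using SQ cS by blast
qed

section \<open>Recursion over balanced separators\<close>

lemma sep_const_nonneg: "sep_const k \<ge> 0"
  unfolding sep_const_def by simp

text \<open>The components of \<open>Q - S\<close> contain at most half of \<open>X\<close> each and
  share the bag size \<open>k\<close> outside \<open>X\<close>. They are joined at an empty root,
  and then \<open>S\<close> is added to all bags.\<close>

theorem grid_td_sqrt:
  assumes "k \<ge> 1" "finite Q" "X \<subseteq> Q" "td grid k (Q - X) R"
  shows "\<exists>R. td grid (k + nat \<lfloor>4 * sep_const k * sqrt (card X)\<rfloor>) Q R"
  using assms(2-)
proof (induction "card X" arbitrary: Q X R rule: less_induct)
  case less
  note sym = symp_grid
  show ?case
  proof (cases "X = {}")
    case True
    then show ?thesis using less.prems(3) by auto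
  next
    case False
    let ?n = "card X" and ?\<beta> = "4 * sep_const k"
    have finX: "finite X" using less.prems finite_subset by blast
    then have n1: "?n \<ge> 1" using False by (simp add: Suc_le_eq card_gt_0_iff)
    obtain S where S: "S \<subseteq> Q" "real (card S) \<le> sep_const k * sqrt ?n"
      and bal: "\<And>C. conn grid C \<Longrightarrow> C \<subseteq> Q - S \<Longrightarrow> 2 * card (C \<inter> X) \<le> ?n"
      using grid_separator[OF less.prems(1,2) False less.prems(3) assms(1)] by blast
    let ?I = "component grid (Q - S) ` (Q - S)"
    let ?k = "k + nat \<lfloor>?\<beta> * sqrt (?n / 2)\<rfloor>"
    have part: "\<exists>R. td grid ?k C R" if "C \<in> ?I" for C
    proof -
      have C: "conn grid C" "C \<subseteq> Q - S"
        using that conn_component[OF sym] component_subset[of grid "Q - S"] by blast+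
      have half: "2 * card (C \<inter> X) \<le> ?n" by (rule bal[OF C])
      then have lt: "card (C \<inter> X) < ?n" using n1 by linarith
      obtain R' where "td grid k (C - C \<inter> X) R'"
        using td_subgraph[OF less.prems(3) sym, of "C - C \<inter> X" grid] C(2) by blast
      then obtain R'' where "td grid (k + nat \<lfloor>?\<beta> * sqrt (card (C \<inter> X))\<rfloor>) C R''"
        using less.hyps[OF lt, of C R'] C(2) less.prems(1) finite_subset by blast
      moreover have "?\<beta> * sqrt (card (C \<inter> X)) \<le> ?\<beta> * sqrt (?n / 2)"
        using half sep_const_nonneg[of k] by (intro mult_left_mono) auto
      then have "k + nat \<lfloor>?\<beta> * sqrt (card (C \<inter> X))\<rfloor> \<le> ?k"
        by (intro add_left_mono nat_mono floor_mono)
      ultimately show ?thesis using td_mono by blast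
    qed
    have "td grid ?k (\<Union>C\<in>?I. C) {}"
    proof (rule td_UN_disjoint)
      show "finite ?I" using less.prems(1) by simp
      show "\<exists>R. td grid ?k C R" if "C \<in> ?I" for C using part that .
      fix C D assume CD: "C \<in> ?I" "D \<in> ?I" "C \<noteq> D"
      then obtain x y where xy: "C = component grid (Q - S) x" "D = component grid (Q - S) y" by blast
      have disj: "C \<inter> D = {}" using component_eq[OF sym] xy CD(3) by blast
      moreover have "\<not> grid u v" if "u \<in> C" "v \<in> D" for u v
      proof
        assume "grid u v"
        then have "v \<in> C" using component_closed[OF sym, of u "Q - S" x v] that xy
            component_subset[of grid "Q - S" y] by blast
        then show False using disj that by blast
      qed
      ultimately show "C \<inter> D = {} \<and> (\<forall>u\<in>C. \<forall>v\<in>D. \<not> grid u v)" by blast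
    qed
    moreover have "(\<Union>C\<in>?I. C) = Q - S"
      using component_subset[of grid "Q - S"] component_self[of _ "Q - S" grid] by blast
    ultimately have "td grid (?k + card S) (Q - S \<union> S) ({} \<union> S)"
      using td_Un_bags[of grid ?k "Q - S" "{}" S] S(1) less.prems(1) finite_subset by metis
    then have td: "td grid (?k + card S) Q S" using S(1) by (simp add: Un_absorb2)
    \<comment> \<open>The origin of the factor 4: halving \<open>X\<close> leaves at most three
      quarters of the bound, and the free quarter is exactly the size allowed for
      \<open>S\<close>.\<close>
    have "sqrt (1 / 2 :: real) \<le> 3 / 4" by (rule real_le_lsqrt) (auto simp: power2_eq_square)
    then have "sqrt (?n / 2) \<le> 3 / 4 * sqrt ?n"
      using mult_right_mono[of "sqrt (1/2)" "3/4" "sqrt ?n"] by (simp add: real_sqrt_divide)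
    then have "?\<beta> * sqrt (?n / 2) \<le> ?\<beta> * (3 / 4 * sqrt ?n)"
      using sep_const_nonneg[of k] by (intro mult_left_mono) auto
    then have "?\<beta> * sqrt (?n / 2) + real (card S) \<le> ?\<beta> * sqrt ?n" using S(2) by linarith
    moreover have "?\<beta> * sqrt (?n / 2) \<ge> 0" using sep_const_nonneg[of k] by simp
    ultimately have "nat \<lfloor>?\<beta> * sqrt (?n / 2)\<rfloor> + card S \<le> nat \<lfloor>?\<beta> * sqrt ?n\<rfloor>"
      by linarith
    then show ?thesis using td_mono[OF td, of "k + nat \<lfloor>?\<beta> * sqrt ?n\<rfloor>"] by (metis add.assoc nat_add_left_cancel_le)
  qed
qed

section \<open>From tree decompositions to rooted decompositions and back\<close>

text \<open>Acyclicity enters as \<open>uniq\<close>: a node outside a connected set of nodes has at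
  most one neighbour in it. The induction splits off one component \<open>K\<close> of
  \<open>S - {r}\<close>, rooted at the neighbour \<open>p\<close> of \<open>r\<close>; it goes
  under the bag \<open>B r\<close> by \<open>td.step\<close> and is combined with the rest by
  \<open>td.join\<close>.\<close>

lemma td_of_tree:
  assumes symA: "symp A" and symE: "symp E" and N: "finite N"
    and uniq: "\<And>Y l p y. Y \<subseteq> N \<Longrightarrow> conn A Y \<Longrightarrow> l \<in> N - Y \<Longrightarrow> p \<in> Y \<Longrightarrow> y \<in> Y \<Longrightarrow>
      A l p \<Longrightarrow> A l y \<Longrightarrow> p = y"
    and Bconn: "\<And>v. v \<in> (\<Union>t\<in>N. B t) \<Longrightarrow> conn A {t\<in>N. v \<in> B t}"
    and edge: "\<And>u v. E u v \<Longrightarrow> u \<in> (\<Union>t\<in>N. B t) \<Longrightarrow> v \<in> (\<Union>t\<in>N. B t) \<Longrightarrow>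
      \<exists>t\<in>N. u \<in> B t \<and> v \<in> B t"
    and bag: "\<And>t. t \<in> N \<Longrightarrow> finite (B t) \<and> card (B t) \<le> k"
    and S: "S \<subseteq> N" "conn A S" "r \<in> S"
  shows "td E k (\<Union>t\<in>S. B t) (B r)"
  using S
proof (induction "card S" arbitrary: S r rule: less_induct)
  case less
  note S = less.prems
  define T where "T v = {t\<in>N. v \<in> B t}" for v
  have connT: "conn A (T v)" if "v \<in> B t" "t \<in> N" for v t
    unfolding T_def using Bconn that by blast
  have rN: "r \<in> N" using S by blast
  have finS: "finite S" using S(1) N finite_subset by blast
  \<comment> \<open>The nodes of \<open>v\<close> form a connected set that contains
    \<open>r\<close> and meets \<open>Y\<close>; it enters \<open>r\<close> from a neighbour
    connected to \<open>Y\<close>, and by \<open>uniq\<close> this neighbour is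
    \<open>p\<close>.\<close>
  have sep: "v \<in> B p" if Y: "Y \<subseteq> N" "conn A Y" "r \<notin> Y" "p \<in> Y" "A r p"
    and v: "v \<in> B r" "t \<in> Y" "v \<in> B t" for Y p v t
  proof -
    let ?K = "component A (T v - {r}) t"
    have tT: "t \<in> T v - {r}" using v Y unfolding T_def by blast
    have tK: "t \<in> ?K" by (rule component_self[OF tT])
    have "\<not> T v \<subseteq> ?K" using v(1) rN component_subset[of A "T v - {r}" t] unfolding T_def by blast
    then obtain a b where ab: "a \<in> ?K" "b \<in> T v" "A a b" "b \<notin> ?K"
      using conn_closed_subset[OF connT[OF v(1) rN] _ tK] tT by blast
    have "b = r" using component_closed[OF symA ab(1) _ ab(3)] ab by blast
    then have "A r a" using ab(3) sympD[OF symA] by blast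
    moreover have "conn A (Y \<union> ?K)"
      by (rule conn_Un_Int[OF symA Y(2) conn_component[OF symA] v(2) tK])
    moreover have "Y \<union> ?K \<subseteq> N" "r \<notin> Y \<union> ?K"
      using Y component_subset[of A "T v - {r}" t] unfolding T_def by blast+
    ultimately have "p = a" using uniq[of "Y \<union> ?K" r p a] Y(4,5) ab(1) rN by blast
    then show ?thesis using ab(1) component_subset[of A "T v - {r}" t] unfolding T_def by blast
  qed
  show ?case
  proof (cases "S = {r}")
    case True
    then show ?thesis using bag[OF rN] td.leaf[of "B r" k E] by simp
  next
    case False
    then obtain x where x: "x \<in> S - {r}" using S(3) by blast
    have nbr: "\<exists>q\<in>component A (S - {r}) s. A r q" if s: "s \<in> S - {r}" for s
    proof -
      let ?K = "component A (S - {r}) s"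
      have "\<not> S \<subseteq> ?K" using S(3) component_subset[of A "S - {r}" s] by blast
      then obtain a b where ab: "a \<in> ?K" "b \<in> S" "A a b" "b \<notin> ?K"
        using conn_closed_subset[OF S(2) _ component_self[OF s]] s by blast
      have "b = r" using component_closed[OF symA ab(1) _ ab(3)] ab by blast
      then show ?thesis using ab sympD[OF symA] by blast
    qed
    define K where "K = component A (S - {r}) x"
    have K: "K \<subseteq> S - {r}" "conn A K" "x \<in> K"
      unfolding K_def by (rule component_subset conn_component[OF symA] component_self[OF x])+
    have Kcl: "b \<in> K" if "a \<in> K" "b \<in> S - {r}" "A a b \<or> A b a" for a b
      using component_closed[OF symA] that sympD[OF symA] unfolding K_def by blast
    obtain p where p: "p \<in> K" "A r p" using nbr[OF x] unfolding K_def by blast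
    let ?S2 = "S - K"
    \<comment> \<open>A connected set that avoids \<open>r\<close> and meets both \<open>K\<close>
      and the rest would merge \<open>K\<close> with another component of \<open>S - {r}\<close>,
      giving \<open>r\<close> two neighbours in one connected set.\<close>
    have cross: False if Y: "Y \<subseteq> N" "conn A Y" "r \<notin> Y" "t \<in> K" "t \<in> Y" "s \<in> ?S2" "s \<in> Y" for Y t s
    proof -
      have s: "s \<in> S - {r}" using Y by blast
      let ?L = "component A (S - {r}) s"
      obtain q where q: "q \<in> ?L" "A r q" using nbr[OF s] by blast
      have "conn A (Y \<union> K)" by (rule conn_Un_Int[OF symA Y(2) K(2) Y(5,4)])
      then have "conn A (Y \<union> K \<union> ?L)"
        by (rule conn_Un_Int[OF symA _ conn_component[OF symA] _ component_self[OF s]]) (use Y(7) in blast)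
      moreover have "Y \<union> K \<union> ?L \<subseteq> N" "r \<notin> Y \<union> K \<union> ?L"
        using Y(1,3) K(1) S(1) component_subset[of A "S - {r}" s] by blast+
      ultimately have "p = q" using uniq[of "Y \<union> K \<union> ?L" r p q] p q rN by blast
      then have "?L = K" using component_eq[OF symA q(1)] component_eq[OF symA, of p "S - {r}" x] p(1)
        unfolding K_def by simp
      then show False using component_self[OF s, of A] Y(6) by blast
    qed
    have conn2: "conn A ?S2"
      unfolding conn_def
    proof (intro allI impI)
      fix M assume M: "M \<subseteq> ?S2" "M \<noteq> {}" "\<forall>a\<in>M. \<forall>b\<in>?S2. A a b \<longrightarrow> b \<in> M"
      obtain m where m: "m \<in> M" using M(2) by blast
      have noK: "\<not> A a b" if "a \<in> M" "a \<noteq> r" "b \<in> K" for a b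
        using Kcl[of b a] that M(1) by blast
      have "r \<in> M"
      proof (rule ccontr)
        assume r: "r \<notin> M"
        have "S \<subseteq> M"
          by (rule conn_closed_subset[OF S(2) _ m]) (use m M r noK in blast)+
        then show False using r S(3) by blast
      qed
      have "S \<subseteq> M \<union> K"
      proof (rule conn_closed_subset[OF S(2), of r])
        fix a b assume "a \<in> M \<union> K" "a \<in> S" "b \<in> S" "A a b"
        then show "b \<in> M \<union> K" using Kcl[of a b] M(3) \<open>r \<in> M\<close> by blast
      qed (use \<open>r \<in> M\<close> S(3) in auto)
      then show "M = ?S2" using M(1) by blast
    qed
    have "K \<subset> S" "?S2 \<subset> S" using K S(3) by blast+
    then have "card K < card S" "card ?S2 < card S" using finS psubset_card_mono by blast+
    then have IH: "td E k (\<Union>t\<in>K. B t) (B p)" "td E k (\<Union>t\<in>?S2. B t) (B r)"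
      using less.hyps[of K p] less.hyps[of ?S2 r] K S p conn2 by blast+
    have "td E k ((\<Union>t\<in>K. B t) \<union> B r) (B r)"
    proof (rule td.step[OF IH(1)])
      show "B r \<inter> (\<Union>t\<in>K. B t) \<subseteq> B p" using sep[of K p] K S(1) p by blast
      fix u v assume u: "u \<in> B r - (\<Union>t\<in>K. B t)" and v: "v \<in> (\<Union>t\<in>K. B t) - B r"
      show "\<not> E u v"
      proof
        assume "E u v"
        obtain t where t: "t \<in> K" "v \<in> B t" using v by blast
        then have tN: "t \<in> N" using K(1) S(1) by blast
        obtain t0 where t0: "t0 \<in> N" "u \<in> B t0" "v \<in> B t0"
          using edge[OF \<open>E u v\<close>] u rN t tN by blast
        have "conn A (K \<union> T v)"
          by (rule conn_Un_Int[OF symA K(2) connT[OF t(2) tN] t(1)]) (use t tN in \<open>auto simp: T_def\<close>)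
        then have "u \<in> B p"
          by (rule sep[where t = t0, rotated]) (use K S(1) p u v t0 in \<open>auto simp: T_def\<close>)
        then show False using u p by blast
      qed
    qed (use bag[OF rN] in auto)
    then have "td E k ((\<Union>t\<in>?S2. B t) \<union> ((\<Union>t\<in>K. B t) \<union> B r)) (B r)"
    proof (rule td.join[OF IH(2)])
      show "(\<Union>t\<in>?S2. B t) \<inter> ((\<Union>t\<in>K. B t) \<union> B r) \<subseteq> B r"
      proof (rule ccontr)
        assume "\<not> ?thesis"
        then obtain v s t where v: "v \<notin> B r" "s \<in> ?S2" "v \<in> B s" "t \<in> K" "v \<in> B t" by blast
        have "s \<in> N" "t \<in> N" using v K(1) S(1) by blast+
        then show False using cross[of "T v" t s] connT[OF v(3)] v unfolding T_def by blast
      qed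
      fix u v assume u: "u \<in> (\<Union>t\<in>?S2. B t) - B r" and v: "v \<in> (\<Union>t\<in>K. B t) \<union> B r - B r"
      show "\<not> E u v"
      proof
        assume "E u v"
        obtain s where s: "s \<in> ?S2" "u \<in> B s" using u by blast
        obtain t where t: "t \<in> K" "v \<in> B t" using v by blast
        have stN: "s \<in> N" "t \<in> N" using s t K(1) S(1) by blast+
        obtain t0 where t0: "t0 \<in> N" "u \<in> B t0" "v \<in> B t0"
          using edge[OF \<open>E u v\<close>] s t stN by blast
        have "conn A (T u \<union> T v)"
          by (rule conn_Un_Int[OF symA connT[OF s(2) stN(1)] connT[OF t(2) stN(2)], of t0])
            (use t0 in \<open>auto simp: T_def\<close>)
        then show False using cross[of "T u \<union> T v" t s] s t stN u v unfolding T_def by blast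
      qed
    qed
    moreover have "(\<Union>t\<in>?S2. B t) \<union> ((\<Union>t\<in>K. B t) \<union> B r) = (\<Union>t\<in>S. B t)"
      using K(1) S(3) by blast
    ultimately show ?thesis by simp
  qed
qed

section \<open>Connectedness and trees of the graph library in terms of \<open>conn\<close>\<close>

lemma symp_dominates: "graph T \<Longrightarrow> symp (dominates T)"
proof -
  assume "graph T"
  then interpret graph T .
  show ?thesis by (auto simp: symp_def intro: graph_symmetric)
qed

lemma dominates_induce: "u \<rightarrow>\<^bsub>T \<restriction> S\<^esub> v \<longleftrightarrow> u \<rightarrow>\<^bsub>T\<^esub> v \<and> u \<in> S \<and> v \<in> S"
  by (auto simp: arcs_ends_conv)

lemma symmetric_induce: "symmetric T \<Longrightarrow> symmetric (T \<restriction> S)"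
  unfolding symmetric_def sym_def dominates_induce by blast

lemma connected_induce_reachable:
  assumes "graph T"
  shows "Digraph_Component.connected (T \<restriction> S) \<longleftrightarrow> S \<noteq> {} \<and> (\<forall>u\<in>S. \<forall>v\<in>S. u \<rightarrow>\<^sup>*\<^bsub>T \<restriction> S\<^esub> v)"
proof -
  interpret graph T by fact
  interpret TS: wf_digraph "T \<restriction> S" by (rule wellformed_induce_subgraph)
  show ?thesis
    unfolding Digraph_Component.connected_def strongly_connected_def
    by (simp add: TS.reachable_mk_symmetric_eq[OF symmetric_induce[OF sym_arcs]])
qed

lemma connected_induce_iff_conn:
  assumes "graph T"
  shows "Digraph_Component.connected (T \<restriction> S) \<longleftrightarrow> S \<noteq> {} \<and> conn (dominates T) S"
proof -
  interpret graph T by fact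
  interpret TS: wf_digraph "T \<restriction> S" by (rule wellformed_induce_subgraph)
  have "conn (dominates T) S" if reach: "\<forall>u\<in>S. \<forall>v\<in>S. u \<rightarrow>\<^sup>*\<^bsub>T \<restriction> S\<^esub> v"
    unfolding conn_def
  proof (intro allI impI)
    fix A assume A: "A \<subseteq> S" "A \<noteq> {}" "\<forall>a\<in>A. \<forall>b\<in>S. a \<rightarrow>\<^bsub>T\<^esub> b \<longrightarrow> b \<in> A"
    obtain a where a: "a \<in> A" using A(2) by blast
    have "v \<in> A" if "v \<in> S" for v
    proof -
      have "a \<rightarrow>\<^sup>*\<^bsub>T \<restriction> S\<^esub> v" using reach a A(1) that by blast
      then show ?thesis
        by (induction rule: TS.reachable_induct) (use a A(3) in \<open>auto simp: dominates_induce\<close>)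
    qed
    then show "A = S" using A(1) by blast
  qed
  moreover have "u \<rightarrow>\<^sup>*\<^bsub>T \<restriction> S\<^esub> v" if con: "conn (dominates T) S" and uv: "u \<in> S" "v \<in> S" for u v
  proof -
    have "S \<subseteq> {v. u \<rightarrow>\<^sup>*\<^bsub>T \<restriction> S\<^esub> v}"
    proof (rule conn_closed_subset[OF con uv(1)])
      fix a b assume "a \<in> {v. u \<rightarrow>\<^sup>*\<^bsub>T \<restriction> S\<^esub> v}" "a \<in> S" "b \<in> S" "a \<rightarrow>\<^bsub>T\<^esub> b"
      then show "b \<in> {v. u \<rightarrow>\<^sup>*\<^bsub>T \<restriction> S\<^esub> v}"
        using TS.reachable_adj_trans[of u a b] by (simp add: dominates_induce)
    qed (use uv in auto)
    then show ?thesis using uv by blast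
  qed
  ultimately show ?thesis unfolding connected_induce_reachable[OF assms] by blast
qed

lemma induce_verts: "wf_digraph T \<Longrightarrow> T \<restriction> verts T = T"
  by (cases T) (auto simp: induce_subgraph_def wf_digraph_def)

text \<open>If \<open>p\<close> and \<open>y\<close> differ, a path between them inside
  \<open>Y\<close> closes up through \<open>l\<close> to a cycle with at least three arcs.\<close>

lemma undirected_tree_unique_nbr:
  assumes tree: "undirected_tree T" and Y: "Y \<subseteq> verts T" "conn (dominates T) Y"
    and l: "l \<notin> Y" "p \<in> Y" "y \<in> Y" "l \<rightarrow>\<^bsub>T\<^esub> p" "l \<rightarrow>\<^bsub>T\<^esub> y"
  shows "p = y"
proof (rule ccontr)
  assume ne: "p \<noteq> y"
  have g: "graph T" using tree by (simp add: undirected_tree_def)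
  then interpret graph T .
  interpret TY: wf_digraph "T \<restriction> Y" by (rule wellformed_induce_subgraph)
  have "p \<rightarrow>\<^sup>*\<^bsub>T \<restriction> Y\<^esub> y"
    using connected_induce_iff_conn[OF g, of Y] connected_induce_reachable[OF g, of Y] Y l by blast
  then obtain q where q: "TY.apath p q y" using TY.reachable_apath by blast
  have qT: "apath p q y"
    by (rule subgraph_apath_imp_apath[OF q subgraph_induce_subgraphI[OF Y(1)]])
  have "set (TY.awalk_verts p q) \<subseteq> Y"
    using q TY.awalk_verts_in_verts[of p q] unfolding TY.apath_def TY.awalk_def by auto
  then have qY: "set (awalk_verts p q) \<subseteq> Y" by (simp add: awalk_verts_induce)
  obtain e1 where e1: "e1 \<in> arcs T" "tail T e1 = l" "head T e1 = p" using l(4) by (rule reachableE)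
  have "y \<rightarrow>\<^bsub>T\<^esub> l" using l(5) graph_symmetric by blast
  then obtain e2 where e2: "e2 \<in> arcs T" "tail T e2 = y" "head T e2 = l" by (rule reachableE)
  have "q \<noteq> []" using qT ne by (auto simp: apath_def awalk_Nil_iff)
  have aw: "awalk p q y" using qT by (rule awalkI_apath)
  have lv: "l \<in> verts T" using e1 by auto
  have "awalk y [e2] l" using e2 lv by (simp add: awalk_simps)
  then have "awalk p (q @ [e2]) l" using aw by (rule awalk_appendI[rotated])
  then have aw2: "awalk l (e1 # q @ [e2]) l" 
    using e1 by (simp only: awalk_Cons_iff simp_thms)
  have "awalk_verts p (q @ [e2]) = awalk_verts p q @ tl (awalk_verts (awlast p q) [e2])"
    by (rule awalk_verts_append) fact
  then have "tl (awalk_verts l (e1 # q @ [e2])) = awalk_verts p q @ [l]"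
    using e1 e2 by simp
  then have "distinct (tl (awalk_verts l (e1 # q @ [e2])))"
    using qT qY l(1) by (auto simp: apath_def)
  then have "cycle (e1 # q @ [e2])" using aw2 unfolding cycle_def by blast
  moreover have "3 \<le> length (e1 # q @ [e2])" using \<open>q \<noteq> []\<close> by (cases q) auto
  ultimately show False using tree unfolding undirected_tree_def by blast
qed

lemma treewidth_le_imp_td:
  fixes G :: "('a, 'b) pre_digraph"
  assumes "graph G" "treewidth G \<le> int k - 1"
  shows "\<exists>R. td (dominates G) k (verts G) R"
proof -
  interpret G: graph G by fact
  obtain T B where TB: "tree_decomposition G T B" and w: "treewidth G = decomposition_width T B"
    using treewidth_attained[OF assms(1)] by blast
  have tree: "undirected_tree T" and cover: "(\<Union>t\<in>verts T. B t) = verts G"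
    and edge: "\<And>u v. u \<rightarrow>\<^bsub>G\<^esub> v \<Longrightarrow> \<exists>t\<in>verts T. u \<in> B t \<and> v \<in> B t"
    and con: "\<And>v. v \<in> verts G \<Longrightarrow> Digraph_Component.connected (T \<restriction> {t \<in> verts T. v \<in> B t})"
    using TB unfolding tree_decomposition_def by blast+
  have g: "graph T" "Digraph_Component.connected T" using tree by (simp_all add: undirected_tree_def)
  interpret T: graph T by fact
  have "verts T \<noteq> {} \<and> conn (dominates T) (verts T)"
    using g connected_induce_iff_conn[OF g(1), of "verts T"] induce_verts[OF T.wf_digraph] by simp
  then obtain r where r: "r \<in> verts T" "conn (dominates T) (verts T)" by blast
  have "card (B t) \<le> k" if "t \<in> verts T" for t
  proof -
    have "card (B t) \<le> (MAX t\<in>verts T. card (B t))" using that by (intro Max_ge) auto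
    then show ?thesis using assms(2) unfolding w decomposition_width_def by linarith
  qed
  moreover have "finite (B t)" if "t \<in> verts T" for t
    using that cover G.finite_verts finite_subset[of "B t" "verts G"] by blast
  ultimately have "td (dominates G) k (\<Union>t\<in>verts T. B t) (B r)"
    using con connected_induce_iff_conn[OF g(1)] edge cover r
    by (intro td_of_tree[where A = "dominates T" and N = "verts T"] symp_dominates assms(1) g(1))
      (auto intro: undirected_tree_unique_nbr[OF tree])
  then show ?thesis using cover by auto
qed

section \<open>From rooted decompositions back to trees\<close>

lemma conn_mono_rel: "conn E C \<Longrightarrow> (\<And>u v. E u v \<Longrightarrow> F u v) \<Longrightarrow> conn F C"
  unfolding conn_def by (meson)

text \<open>After entering \<open>l\<close> the walk must return to \<open>p\<close> at once. No arc
  tail occurs twice, so it is back at its arc \<open>(p, l)\<close> and has no further arcs.\<close>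

lemma closed_arc_walk_two_step:
  fixes q :: "('a \<times> 'a) list"
  assumes chain: "\<And>j. Suc j < length q \<Longrightarrow> snd (q ! j) = fst (q ! Suc j)"
    and closed: "snd (last q) = fst (hd q)" and dist: "distinct (map fst q)"
    and pl: "(p, l) \<in> set q" and l: "\<And>x. (l, x) \<in> set q \<Longrightarrow> x = p"
  shows "length q \<le> 2"
proof (rule ccontr)
  assume len: "\<not> length q \<le> 2"
  obtain i where i: "i < length q" "q ! i = (p, l)" using pl by (auto simp: in_set_conv_nth)
  have inj: "j = m" if "j < length q" "m < length q" "fst (q ! j) = fst (q ! m)" for j m
    using that dist by (simp add: distinct_conv_nth) (metis length_map nth_map)
  have from_l: "snd (q ! j) = p" if "j < length q" "fst (q ! j) = l" for j
    using that l[of "snd (q ! j)"] by (metis nth_mem prod.collapse)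
  have "q \<noteq> []" using len by auto
  have hd: "hd q = q ! 0" and last: "last q = q ! (length q - 1)"
    using len hd_conv_nth[of q] last_conv_nth[of q] by fastforce+
  \<comment> \<open>The list is read cyclically: the cases tell how far the arc
    \<open>(p, l)\<close> is from the end, where the successor is the head of the list.\<close>
  consider "i + 2 < length q" | "i + 2 = length q" | "i + 1 = length q" using i(1) by linarith
  then show False
  proof cases
    case 1
    then have "snd (q ! Suc i) = p" using chain[of i] i from_l by simp
    then have "fst (q ! Suc (Suc i)) = p" using chain[of "Suc i"] 1 by simp
    then show False using inj[of "Suc (Suc i)" i] i 1 by simp
  next
    case 2
    then have "snd (q ! Suc i) = p" using chain[of i] i from_l by simp
    moreover have "length q - 1 = Suc i" using 2 by linarith
    ultimately have "fst (q ! 0) = p" using closed hd last by simp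
    then have "0 = i" using inj[of 0 i] i \<open>q \<noteq> []\<close> by simp
    then show False using 2 len by linarith
  next
    case 3
    then have "length q - 1 = i" by linarith
    then have "fst (q ! 0) = l" using closed hd last i by simp
    then have "snd (q ! 0) = p" using from_l[of 0] \<open>q \<noteq> []\<close> by simp
    then have "fst (q ! Suc 0) = p" using chain[of 0] len by simp
    then have "Suc 0 = i" using inj[of "Suc 0" i] i len by simp
    then show False using 3 len by linarith
  qed
qed

text \<open>A cycle that uses the arc \<open>(p, l)\<close> is too short by
  \<open>closed_arc_walk_two_step\<close>; any other avoids \<open>l\<close> altogether and is a
  cycle of \<open>T\<close>.\<close>

lemma undirected_tree_add_leaf:
  fixes T :: "('a, 'a \<times> 'a) pre_digraph"
  assumes tree: "undirected_tree T" and proj: "tail T = fst" "head T = snd"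
    and p: "p \<in> verts T" and l: "l \<notin> verts T"
  shows "undirected_tree \<lparr>verts = insert l (verts T), arcs = insert (p, l) (insert (l, p) (arcs T)),
    tail = fst, head = snd\<rparr>" (is "undirected_tree ?T")
proof -
  have g: "graph T" and con: "Digraph_Component.connected T" using tree by (simp_all add: undirected_tree_def)
  interpret T: graph T by fact
  have arcsT: "fst e \<in> verts T" "snd e \<in> verts T" "fst e \<noteq> snd e" if "e \<in> arcs T" for e
    using that T.tail_in_verts T.head_in_verts T.no_loops proj by metis+
  have ends: "arcs_ends T = arcs T" using proj by (auto simp: arcs_ends_conv)
  have sym: "(b, a) \<in> arcs T" if "(a, b) \<in> arcs T" for a b
    using T.graph_symmetric that unfolding ends by blast
  have g': "graph ?T"
  proof (unfold_locales)
    show "symmetric ?T"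
      unfolding symmetric_def sym_def by (auto simp: arcs_ends_conv sym)
  qed (use p l arcsT in \<open>auto simp: arc_to_ends_def\<close>)
  then interpret T': graph ?T .
  have ends': "arcs_ends ?T = arcs T \<union> {(p, l), (l, p)}" by (auto simp: arcs_ends_conv)
  have "conn (dominates T) (verts T)"
    using con connected_induce_iff_conn[OF g, of "verts T"] induce_verts[OF T.wf_digraph] by simp
  then have "conn (dominates ?T) (verts T)" by (rule conn_mono_rel) (unfold ends ends', blast)
  then have "conn (dominates ?T) (verts T \<union> {l})"
    using p by (intro conn_Un symp_dominates[OF g']) (simp_all only: touch_def ends' conn_singleton, blast)
  moreover have "verts ?T = verts T \<union> {l}" by simp
  ultimately have "Digraph_Component.connected (?T \<restriction> verts ?T)"
    using connected_induce_iff_conn[OF g', of "verts ?T"] by (metis Un_empty insert_not_empty)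
  then have "Digraph_Component.connected ?T" using induce_verts[OF T'.wf_digraph] by simp
  moreover have "\<not> (\<exists>q. T'.cycle q \<and> 3 \<le> length q)"
  proof
    assume "\<exists>q. T'.cycle q \<and> 3 \<le> length q"
    then obtain q u where q: "T'.awalk u q u" "distinct (tl (T'.awalk_verts u q))" "q \<noteq> []" "3 \<le> length q"
      unfolding T'.cycle_def by blast
    have cas: "T'.cas u q u" and qarcs: "set q \<subseteq> arcs T \<union> {(p, l), (l, p)}"
      using q(1) unfolding T'.awalk_def by auto
    have v1: "T'.awalk_verts u q = map fst q @ [snd (last q)]"
      using q(3) by (simp add: T'.awalk_verts_conv)
    have v2: "T'.awalk_verts u q = fst (hd q) # map snd q"
      using T'.awalk_verts_conv'[OF cas] q(3) by simp
    have hd: "fst (hd q) = u" using T'.cas_simp[OF q(3)] cas by simp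
    have closed: "snd (last q) = fst (hd q)"
      using T'.awlast_if_cas[OF cas] unfolding v1 hd by simp
    \<comment> \<open>\<open>cycle\<close> provides distinct arc heads. On a closed walk heads and
      tails agree as multisets, so the tails are distinct too.\<close>
    have "mset (map fst q) = mset (map snd q)"
      using arg_cong[OF trans[OF v1[symmetric] v2], of mset] closed by simp
    then have dist: "distinct (map fst q)"
      using q(2) unfolding v2 by (metis list.sel(3) mset_eq_imp_distinct_iff)
    have chain: "snd (q ! j) = fst (q ! Suc j)" if "Suc j < length q" for j
    proof -
      have "(map fst q @ [snd (last q)]) ! Suc j = (fst (hd q) # map snd q) ! Suc j"
        using v1 v2 by simp
      then show ?thesis using that by (simp add: nth_append)
    qed
    show False
    proof (cases "(p, l) \<in> set q")
      case True
      have "length q \<le> 2"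
        by (rule closed_arc_walk_two_step[OF chain closed dist True]) (use qarcs l arcsT in auto)
      then show False using q(4) by simp
    next
      case False
      have "l \<notin> set (map snd q)" using False qarcs l arcsT p by fastforce
      then have "l \<notin> set (map fst q)"
        using \<open>mset (map fst q) = mset (map snd q)\<close> by (metis mset_eq_setD)
      then have "(l, p) \<notin> set q" by force
      then have sub: "set q \<subseteq> arcs T" using qarcs False by blast
      have "u \<in> verts T" using hd arcsT[of "hd q"] sub q(3) by (metis hd_in_set subsetD)
      have "T.cas a q b" if "T'.cas a q b" for a b q
        using that by (induction q arbitrary: a) (auto simp: proj)
      then have "T.awalk u q u" using cas sub \<open>u \<in> verts T\<close> unfolding T.awalk_def by blast
      moreover have "distinct (tl (T.awalk_verts u q))"
        using q(2,3) by (simp add: T.awalk_verts_conv v1 proj)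
      ultimately have "T.cycle q" using q(3) unfolding T.cycle_def by blast
      then show False using tree q(4) unfolding undirected_tree_def by blast
    qed
  qed
  ultimately show ?thesis using g' unfolding undirected_tree_def by blast
qed

text \<open>The set \<open>\<B>\<close> of bags is exposed so that a node with a prescribed bag can
  be found again; \<open>fst\<close> and \<open>snd\<close> are fixed as end maps so that a leaf can
  be attached by adding pairs.\<close>

definition tree_bags :: "('a \<Rightarrow> 'a \<Rightarrow> bool) \<Rightarrow> nat \<Rightarrow> 'a set \<Rightarrow> 'a set set \<Rightarrow> bool" where
  "tree_bags E k V \<B> \<longleftrightarrow> (\<exists>(T :: (nat, nat \<times> nat) pre_digraph) B.
     undirected_tree T \<and> tail T = fst \<and> head T = snd \<and>
     (\<Union>t\<in>verts T. B t) = V \<and> (\<forall>u\<in>V. \<forall>v\<in>V. E u v \<longrightarrow> (\<exists>t\<in>verts T. u \<in> B t \<and> v \<in> B t)) \<and>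
     (\<forall>v\<in>V. conn (dominates T) {t\<in>verts T. v \<in> B t}) \<and>
     (\<forall>t\<in>verts T. card (B t) \<le> k) \<and> B ` verts T = \<B>)"

lemma tree_bags_singleton: "card R \<le> k \<Longrightarrow> tree_bags E k R {R}"
  unfolding tree_bags_def
  using undirected_tree_singleton[of "0::nat"]
  by (intro exI[of _ "\<lparr>verts = {0}, arcs = {}, tail = fst, head = snd\<rparr>"] exI[of _ "\<lambda>_. R"]) auto

text \<open>The leaf hangs on a node with bag \<open>R\<close>;
  \<open>R' \<inter> V \<subseteq> R\<close> keeps the nodes of each old vertex connected.\<close>

lemma tree_bags_add_leaf:
  assumes TB: "tree_bags E k V \<B>" and sym: "symp E" and R: "R \<in> \<B>"
    and R': "card R' \<le> k" "R' \<inter> V \<subseteq> R"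
    and cross: "\<And>u v. u \<in> R' - V \<Longrightarrow> v \<in> V - R' \<Longrightarrow> \<not> E u v"
  shows "tree_bags E k (V \<union> R') (insert R' \<B>)"
proof -
  obtain T :: "(nat, nat \<times> nat) pre_digraph" and B where T: "undirected_tree T" "tail T = fst" "head T = snd"
    and cover: "(\<Union>t\<in>verts T. B t) = V"
    and edge: "\<forall>u\<in>V. \<forall>v\<in>V. E u v \<longrightarrow> (\<exists>t\<in>verts T. u \<in> B t \<and> v \<in> B t)"
    and con: "\<forall>v\<in>V. conn (dominates T) {t\<in>verts T. v \<in> B t}"
    and bag: "\<forall>t\<in>verts T. card (B t) \<le> k" "B ` verts T = \<B>"
    using TB unfolding tree_bags_def by (elim exE conjE)
  have g: "graph T" using T by (simp add: undirected_tree_def)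
  interpret T: graph T by fact
  obtain p where p: "p \<in> verts T" "B p = R" using R bag(2) by blast
  obtain l where l: "l \<notin> verts T" using ex_new_if_finite[OF infinite_UNIV_nat T.finite_verts] by blast
  let ?T = "\<lparr>verts = insert l (verts T), arcs = insert (p, l) (insert (l, p) (arcs T)), tail = fst, head = snd\<rparr>"
  have tree: "undirected_tree ?T" by (rule undirected_tree_add_leaf[OF T p(1) l])
  have g': "graph ?T" using tree by (simp add: undirected_tree_def)
  have ends: "arcs_ends T = arcs T" "arcs_ends ?T = arcs T \<union> {(p, l), (l, p)}"
    using T(2,3) by (auto simp: arcs_ends_conv)
  let ?B = "B(l := R')"
  have old: "?B t = B t" if "t \<in> verts T" for t using that l by auto
  show ?thesis
    unfolding tree_bags_def
  proof (rule exI[of _ ?T], rule exI[of _ ?B], intro conjI ballI impI)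
    show "(\<Union>t\<in>verts ?T. ?B t) = V \<union> R'" using cover l by auto
    fix u v assume uv: "u \<in> V \<union> R'" "v \<in> V \<union> R'" "E u v"
    show "\<exists>t\<in>verts ?T. u \<in> ?B t \<and> v \<in> ?B t"
    proof (cases "u \<in> R' \<and> v \<in> R'")
      case False
      then have "u \<in> V \<and> v \<in> V" using uv cross[of u v] cross[of v u] sympD[OF sym] by blast
      then obtain t where "t \<in> verts T" "u \<in> B t" "v \<in> B t" using edge uv(3) by blast
      then show ?thesis using old by (intro bexI[of _ t]) auto
    qed auto
  next
    fix v assume v: "v \<in> V \<union> R'"
    have conV: "conn (dominates ?T) {t\<in>verts T. v \<in> B t}" if "v \<in> V"
      by (rule conn_mono_rel[of "dominates T"]) (use con that in blast, unfold ends, blast)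
    show "conn (dominates ?T) {t \<in> verts ?T. v \<in> ?B t}"
    proof (cases "v \<in> R'")
      case True
      have eq: "{t \<in> verts ?T. v \<in> ?B t} = {t\<in>verts T. v \<in> B t} \<union> {l}" using True l by auto
      show ?thesis
      proof (cases "v \<in> V")
        case True
        then have "v \<in> B p" using R'(2) p \<open>v \<in> R'\<close> by blast
        then show ?thesis unfolding eq
          using conV[OF True] p(1)
          by (intro conn_Un symp_dominates[OF g']) (simp_all only: touch_def ends conn_singleton, blast)
      next
        case False
        then have "{t\<in>verts T. v \<in> B t} \<union> {l} = {l}" using cover by blast
        then show ?thesis unfolding eq by (simp only: conn_singleton)
      qed
    next
      case False
      then have "{t \<in> verts ?T. v \<in> ?B t} = {t\<in>verts T. v \<in> B t}" using l by auto
      then show ?thesis using conV False v by auto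
    qed
  next
    fix t assume "t \<in> verts ?T"
    then show "card (?B t) \<le> k" using bag R' by auto
  next
    show "?B ` verts ?T = insert R' \<B>" using bag(2) l by auto
  qed (use tree in auto)
qed

lemma tree_bags_subset: "tree_bags E k V \<B> \<Longrightarrow> R \<in> \<B> \<Longrightarrow> R \<subseteq> V"
  unfolding tree_bags_def by blast

text \<open>The derivation of \<open>td\<close> is replayed from its root downwards onto a tree that
  already has a node with bag \<open>R\<close>. A join then attaches both branches to the growing
  tree, and no disjoint union of trees is formed.\<close>

lemma td_attach:
  assumes "td E k V R" and sym: "symp E"
    and "tree_bags E k V0 \<B>0" "R \<in> \<B>0" "V0 \<inter> V \<subseteq> R"
    and "\<And>u v. u \<in> V0 - R \<Longrightarrow> v \<in> V - R \<Longrightarrow> \<not> E u v"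
  shows "\<exists>\<B>. \<B>0 \<subseteq> \<B> \<and> tree_bags E k (V0 \<union> V) \<B>"
  using assms(1,3-)
proof (induction arbitrary: V0 \<B>0 rule: td.induct)
  case (leaf R)
  then have "V0 \<union> R = V0" using tree_bags_subset by blast
  then show ?case using leaf by auto
next
  case (step V R R')
  note fin = td_finite[OF step.hyps(1)]
  have R'V0: "R' \<subseteq> V0" using tree_bags_subset step.prems by blast
  have no: "\<not> E u v" if "u \<in> V0 - R" "v \<in> V - R'" for u v
  proof (cases "u \<in> R'")
    case True
    then show ?thesis using step.hyps(4) step.hyps(5)[of u v] that by blast
  next
    case False
    then show ?thesis using step.prems(4)[of u v] that by blast
  qed
  have leaf: "tree_bags E k (V0 \<union> R) (insert R \<B>0)"
  proof (rule tree_bags_add_leaf[OF step.prems(1) sym step.prems(2)])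
    show "card R \<le> k" using fin by blast
    show "R \<inter> V0 \<subseteq> R'" using fin step.prems(3) by blast
    fix u v assume uv: "u \<in> R - V0" "v \<in> V0 - R"
    then have "u \<in> V - R'" using fin R'V0 by blast
    then show "\<not> E u v" using no[OF uv(2)] sympD[OF sym] by blast
  qed
  have "\<exists>\<B>. insert R \<B>0 \<subseteq> \<B> \<and> tree_bags E k ((V0 \<union> R) \<union> V) \<B>"
  proof (rule step.IH[OF leaf])
    show "(V0 \<union> R) \<inter> V \<subseteq> R" using step.prems(3) step.hyps(4) by blast
    fix u v assume "u \<in> V0 \<union> R - R" "v \<in> V - R"
    moreover from this have "v \<in> V - R'" using step.hyps(4) by blast
    ultimately show "\<not> E u v" using no by blast
  qed simp
  moreover have "(V0 \<union> R) \<union> V = V0 \<union> (V \<union> R')" using fin R'V0 by blast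
  ultimately show ?case by auto
next
  case (join V1 R V2)
  have "\<exists>\<B>. \<B>0 \<subseteq> \<B> \<and> tree_bags E k (V0 \<union> V1) \<B>"
    by (rule join.IH(1)) (use join.prems in blast)+
  then obtain \<B>1 where B1: "\<B>0 \<subseteq> \<B>1" "tree_bags E k (V0 \<union> V1) \<B>1" by blast
  have "\<exists>\<B>. \<B>1 \<subseteq> \<B> \<and> tree_bags E k ((V0 \<union> V1) \<union> V2) \<B>"
    by (rule join.IH(2)[OF B1(2)]) (use join.prems join.hyps(3,4) B1(1) in blast)+
  then show ?case using B1(1) by (auto simp: Un_assoc)
qed

lemma td_imp_treewidth_le:
  fixes G :: "('a, 'b) pre_digraph"
  assumes G: "graph G" and td: "td (dominates G) k (verts G) R"
  shows "treewidth G \<le> int k - 1"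
proof -
  interpret graph G by fact
  note fin = td_finite[OF td]
  have "\<exists>\<B>. {R} \<subseteq> \<B> \<and> tree_bags (dominates G) k (R \<union> verts G) \<B>"
    by (rule td_attach[OF td symp_dominates[OF G] tree_bags_singleton]) (use fin in auto)
  moreover have "R \<union> verts G = verts G" using fin by blast
  ultimately have "\<exists>\<B>. tree_bags (dominates G) k (verts G) \<B>" by auto
  then obtain T :: "(nat, nat \<times> nat) pre_digraph" and B where T: "undirected_tree T"
    and cover: "(\<Union>t\<in>verts T. B t) = verts G"
    and edge: "\<forall>u\<in>verts G. \<forall>v\<in>verts G. u \<rightarrow>\<^bsub>G\<^esub> v \<longrightarrow> (\<exists>t\<in>verts T. u \<in> B t \<and> v \<in> B t)"
    and con: "\<forall>v\<in>verts G. conn (dominates T) {t\<in>verts T. v \<in> B t}"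
    and bag: "\<forall>t\<in>verts T. card (B t) \<le> k"
    unfolding tree_bags_def by (elim exE conjE)
  have gT: "graph T" and "Digraph_Component.connected T" using T by (simp_all add: undirected_tree_def)
  then have ne: "verts T \<noteq> {}" unfolding connected_conv by blast
  interpret T: graph T by fact
  have "tree_decomposition G T B"
    unfolding tree_decomposition_def
  proof (intro conjI allI impI ballI)
    fix v assume v: "v \<in> verts G"
    then have "{t\<in>verts T. v \<in> B t} \<noteq> {}" using cover by blast
    then show "Digraph_Component.connected (T \<restriction> {t \<in> verts T. v \<in> B t})"
      using con v connected_induce_iff_conn[OF gT] by blast
  qed (use T cover edge adj_in_verts in blast)+
  then have "treewidth G \<le> decomposition_width T B" by (rule treewidth_le[OF G])
  also have "\<dots> \<le> int k - 1"
  proof -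
    have "(MAX t\<in>verts T. card (B t)) \<le> k" using bag ne T.finite_verts by (subst Max_le_iff) auto
    then show ?thesis unfolding decomposition_width_def by linarith
  qed
  finally show ?thesis .
qed

section \<open>Unit disk graphs on the grid\<close>

lemma conn_row: "conn grid ({a..a + int k} \<times> {n})"
proof (induction k)
  case (Suc k)
  have "{a..a + int (Suc k)} \<times> {n} = {a..a + int k} \<times> {n} \<union> {(a + int (Suc k), n)}" by auto
  moreover have "conn grid ({a..a + int k} \<times> {n} \<union> {(a + int (Suc k), n)})"
  proof (rule conn_Un[OF symp_grid Suc conn_singleton])
    show "touch grid ({a..a + int k} \<times> {n}) {(a + int (Suc k), n)}"
      unfolding touch_def by (rule bexI[of _ "(a + int k, n)"]) (auto simp: grid_def)
  qed
  ultimately show ?case by simp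
qed simp

lemma conn_column: "conn grid ({n} \<times> {a..a + int k})"
proof (induction k)
  case (Suc k)
  have "{n} \<times> {a..a + int (Suc k)} = {n} \<times> {a..a + int k} \<union> {(n, a + int (Suc k))}" by auto
  moreover have "conn grid ({n} \<times> {a..a + int k} \<union> {(n, a + int (Suc k))})"
  proof (rule conn_Un[OF symp_grid Suc conn_singleton])
    show "touch grid ({n} \<times> {a..a + int k}) {(n, a + int (Suc k))}"
      unfolding touch_def by (rule bexI[of _ "(n, a + int k)"]) (auto simp: grid_def)
  qed
  ultimately show ?case by simp
qed simp

lemma conn_box: "conn grid ({a..b} \<times> {c..d})"
proof (cases "a \<le> b \<and> c \<le> d")
  case True
  have row: "conn grid ({a..b} \<times> {i})" for i using conn_row[of a "nat (b - a)" i] True by simp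
  have col: "conn grid ({a} \<times> {c..d})" using conn_column[of a c "nat (d - c)"] True by simp
  have "conn grid ({a} \<times> {c..d} \<union> (\<Union>i\<in>{c..d}. {a..b} \<times> {i}))"
  proof (rule conn_UN[OF symp_grid col row])
    show "touch grid ({a} \<times> {c..d}) ({a..b} \<times> {i})" if "i \<in> {c..d}" for i
      unfolding touch_def using that True by (intro bexI[of _ "(a, i)"]) auto
  qed
  moreover have "{a} \<times> {c..d} \<union> (\<Union>i\<in>{c..d}. {a..b} \<times> {i}) = {a..b} \<times> {c..d}" using True by auto
  ultimately show ?thesis by simp
next
  case False
  then have "{a..b} \<times> {c..d} = {}" by auto
  then show ?thesis by (simp only: conn_empty)
qed

definition block :: "real \<Rightarrow> real \<times> real \<Rightarrow> (int \<times> int) set" where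
  "block e p = {z. \<bar>real_of_int (fst z) - fst p\<bar> \<le> e \<and> \<bar>real_of_int (snd z) - snd p\<bar> \<le> e}"

lemma block_eq: "block e p = {\<lceil>fst p - e\<rceil>..\<lfloor>fst p + e\<rfloor>} \<times> {\<lceil>snd p - e\<rceil>..\<lfloor>snd p + e\<rfloor>}"
  by (auto simp: block_def abs_le_iff ceiling_le_iff le_floor_iff algebra_simps)

lemma finite_block: "finite (block e p)"
  unfolding block_eq by simp

text \<open>A closed interval of length 18 contains at most 19 integers, and 361 is the square of
  19.\<close>

lemma card_block_9: "card (block 9 p) \<le> 361"
proof -
  have len: "nat (\<lfloor>a + 9\<rfloor> + 1 - \<lceil>a - 9\<rceil>) \<le> 19" for a :: real by linarith
  have "card (block 9 p) = nat (\<lfloor>fst p + 9\<rfloor> + 1 - \<lceil>fst p - 9\<rceil>) * nat (\<lfloor>snd p + 9\<rfloor> + 1 - \<lceil>snd p - 9\<rceil>)"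
    unfolding block_eq by (simp add: card_cartesian_product)
  also have "\<dots> \<le> 19 * 19" by (rule mult_le_mono[OF len len])
  finally show ?thesis by simp
qed

lemma int_near_both:
  fixes a b :: real
  assumes "\<bar>a - b\<bar> \<le> 1"
  shows "\<exists>m::int. \<bar>real_of_int m - a\<bar> \<le> 1 \<and> \<bar>real_of_int m - b\<bar> \<le> 1"
  by (rule exI[of _ "\<lceil>max a b - 1\<rceil>"]) (use assms in linarith)

lemma block_Int_block:
  assumes "\<bar>fst p - fst q\<bar> \<le> 1" "\<bar>snd p - snd q\<bar> \<le> 1"
  shows "block 1 p \<inter> block 1 q \<noteq> {}"
proof -
  obtain m n :: int where "\<bar>m - fst p\<bar> \<le> 1" "\<bar>m - fst q\<bar> \<le> 1" "\<bar>n - snd p\<bar> \<le> 1" "\<bar>n - snd q\<bar> \<le> 1"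
    using int_near_both[OF assms(1)] int_near_both[OF assms(2)] by blast
  then have "(m, n) \<in> block 1 p \<inter> block 1 q" by (simp add: block_def)
  then show ?thesis by blast
qed

lemma conn_block_chain:
  assumes "\<And>i. \<bar>fst (p (Suc i)) - fst (p i)\<bar> \<le> 1 \<and> \<bar>snd (p (Suc i)) - snd (p i)\<bar> \<le> 1"
  shows "conn grid (\<Union>i\<le>n. block 1 (p i))"
proof (induction n)
  case 0
  then show ?case by (simp add: block_eq conn_box)
next
  case (Suc n)
  have "block 1 (p n) \<inter> block 1 (p (Suc n)) \<noteq> {}"
    using assms[of n] by (intro block_Int_block) (auto simp: abs_minus_commute)
  then have "touch grid (\<Union>i\<le>n. block 1 (p i)) (block 1 (p (Suc n)))" unfolding touch_def by blast
  then have "conn grid ((\<Union>i\<le>n. block 1 (p i)) \<union> block 1 (p (Suc n)))"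
    by (intro conn_Un[OF symp_grid Suc]) (simp_all add: block_eq conn_box)
  moreover have "(\<Union>i\<le>Suc n. block 1 (p i)) = (\<Union>i\<le>n. block 1 (p i)) \<union> block 1 (p (Suc n))"
    by (auto simp: le_Suc_eq)
  ultimately show ?case by simp
qed

lemma card_le_fibres:
  assumes "finite A" "finite B" "f ` A \<subseteq> B" "\<And>b. b \<in> B \<Longrightarrow> card {a\<in>A. f a = b} \<le> m"
  shows "card A \<le> card B * m"
proof -
  have "A = (\<Union>b\<in>B. {a\<in>A. f a = b})" using assms(3) by blast
  then have "card A \<le> (\<Sum>b\<in>B. card {a\<in>A. f a = b})"
    using card_UN_le[OF assms(2), of "\<lambda>b. {a\<in>A. f a = b}"] by simp
  also have "\<dots> \<le> (\<Sum>b\<in>B. m)" by (rule sum_mono) (rule assms(4))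
  finally show ?thesis by simp
qed

text \<open>Stewart's identity expresses the squared distance of two points on the segments \<open>ab\<close> and
  \<open>cd\<close> through the six distances between \<open>a, b, c, d\<close>.\<close>

lemma segments_close_imp_ends_close:
  fixes ax ay bx "by" cx cy dx dy s t L :: real
  assumes st: "0 \<le> s" "s \<le> 1" "0 \<le> t" "t \<le> 1"
    and ab: "(ax - bx)\<^sup>2 + (ay - by)\<^sup>2 \<le> L" and cd: "(cx - dx)\<^sup>2 + (cy - dy)\<^sup>2 \<le> L"
    and pq: "2 * ((ax + s * (bx - ax) - (cx + t * (dx - cx)))\<^sup>2 +
      (ay + s * (by - ay) - (cy + t * (dy - cy)))\<^sup>2) \<le> L"
  shows "(ax - cx)\<^sup>2 + (ay - cy)\<^sup>2 \<le> L \<or> (ax - dx)\<^sup>2 + (ay - dy)\<^sup>2 \<le> L \<or>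
    (bx - cx)\<^sup>2 + (by - cy)\<^sup>2 \<le> L \<or> (bx - dx)\<^sup>2 + (by - dy)\<^sup>2 \<le> L"
proof (rule ccontr)
  assume neg: "\<not> ?thesis"
  define AC where "AC = (ax - cx)\<^sup>2 + (ay - cy)\<^sup>2"
  define AD where "AD = (ax - dx)\<^sup>2 + (ay - dy)\<^sup>2"
  define BC where "BC = (bx - cx)\<^sup>2 + (by - cy)\<^sup>2"
  define BD where "BD = (bx - dx)\<^sup>2 + (by - dy)\<^sup>2"
  define AB where "AB = (ax - bx)\<^sup>2 + (ay - by)\<^sup>2"
  define CD where "CD = (cx - dx)\<^sup>2 + (cy - dy)\<^sup>2"
  have gt: "L < AC" "L < AD" "L < BC" "L < BD"
    using neg unfolding AC_def AD_def BC_def BD_def by auto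
  define PQ where "PQ = (ax + s * (bx - ax) - (cx + t * (dx - cx)))\<^sup>2 + (ay + s * (by - ay) - (cy + t * (dy - cy)))\<^sup>2"
  have eq: "PQ = (1 - s) * (1 - t) * AC + (1 - s) * t * AD + s * (1 - t) * BC + s * t * BD
      - s * (1 - s) * AB - t * (1 - t) * CD"
    unfolding PQ_def AC_def AD_def BC_def BD_def AB_def CD_def by (simp add: power2_eq_square algebra_simps)
  have L0: "0 \<le> L" using ab by (meson order_trans sum_power2_ge_zero)
  \<comment> \<open>Some weights may vanish, so the strict bound is kept in the minimum
    \<open>m\<close>. The four positive weights sum to 1 and the two subtracted terms are at most
    \<open>L / 4\<close> each, hence \<open>PQ \<ge> m - L / 2\<close>.\<close>
  define m where "m = min (min AC AD) (min BC BD)"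
  have m: "L < m" "m \<le> AC" "m \<le> AD" "m \<le> BC" "m \<le> BD" using gt unfolding m_def by auto
  have "(1 - s) * (1 - t) * m \<le> (1 - s) * (1 - t) * AC" "(1 - s) * t * m \<le> (1 - s) * t * AD"
    "s * (1 - t) * m \<le> s * (1 - t) * BC" "s * t * m \<le> s * t * BD"
    using st m by (intro mult_left_mono mult_nonneg_nonneg; simp)+
  moreover have "(1 - s) * (1 - t) * m + (1 - s) * t * m + s * (1 - t) * m + s * t * m = m"
    by (simp add: algebra_simps)
  moreover have quarter: "x * (1 - x) \<le> 1 / 4" for x :: real
    using zero_le_power2[of "x - 1 / 2"] by (simp add: power2_eq_square algebra_simps)
  have "s * (1 - s) * AB \<le> 1 / 4 * L" "t * (1 - t) * CD \<le> 1 / 4 * L"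
    using quarter[of s] quarter[of t] ab cd st L0 unfolding AB_def CD_def
    by (intro mult_mono; simp)+
  ultimately have "m - L / 2 \<le> PQ" unfolding eq by linarith
  moreover have "2 * PQ \<le> L" using pq unfolding PQ_def .
  ultimately show False using m(1) by linarith
qed

lemma abs_le_imp_square_le: "\<bar>a\<bar> \<le> b \<Longrightarrow> a\<^sup>2 \<le> b\<^sup>2" for a b :: real
  using power2_le_iff_abs_le[of b a] by auto

text \<open>A vertex becomes the connected set \<open>star v\<close> of at most 361 grid points, and
  a grid point becomes the connected set \<open>rel z\<close> of vertices. The first transfer
  multiplies bags by 361, the second by the number of stars through a point. The distance 8 is
  coarse enough for the parity-free metric estimates at unit grid resolution in \<open>link\<close>
  and for the cells used at the end.\<close>

lemma disk_graph_td:
  fixes x y :: "'a \<Rightarrow> real"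
  assumes V: "finite V" and sym: "symp E"
    and E: "\<And>u v. u \<in> V \<Longrightarrow> v \<in> V \<Longrightarrow> E u v \<longleftrightarrow> u \<noteq> v \<and> (x u - x v)\<^sup>2 + (y u - y v)\<^sup>2 \<le> 64"
    and deg: "\<And>v. v \<in> V \<Longrightarrow> card {u\<in>V. E v u} \<le> \<Delta>"
    and X: "X \<subseteq> V" and td: "td E k (V - X) R" and k: "k \<ge> 1"
  shows "\<exists>R. td E (25 * (\<Delta> + 1) *
    (361 * k + nat \<lfloor>4 * sep_const (361 * k) * sqrt (361 * card X)\<rfloor>)) V R"
proof -
  define near where "near u v \<longleftrightarrow> (x u - x v)\<^sup>2 + (y u - y v)\<^sup>2 \<le> 64" for u v
  have near_refl: "near v v" for v unfolding near_def by simp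
  have near_sym: "near u v \<longleftrightarrow> near v u" for u v unfolding near_def by (simp add: power2_commute)
  have nearE: "u = v \<or> E u v" if "u \<in> V" "v \<in> V" "near u v" for u v
    using E[of u v] that unfolding near_def by blast
  have near_abs: "\<bar>x v - x u\<bar> \<le> 8 \<and> \<bar>y v - y u\<bar> \<le> 8" if "near v u" for u v
  proof -
    have "(x v - x u)\<^sup>2 \<le> 8\<^sup>2" "(y v - y u)\<^sup>2 \<le> 8\<^sup>2"
      using that zero_le_power2[of "x v - x u"] zero_le_power2[of "y v - y u"]
      unfolding near_def by (simp_all; linarith)+
    then show ?thesis using power2_le_iff_abs_le[of 8 "x v - x u"] power2_le_iff_abs_le[of 8 "y v - y u"] by linarith
  qed
  \<comment> \<open>Eight steps along a segment of length at most 8 move each coordinate by at most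
    1, so consecutive blocks overlap.\<close>
  define samp where "samp v u i = (x v + real i / 8 * (x u - x v), y v + real i / 8 * (y u - y v))" for v u i
  define arm where "arm v u = (\<Union>i\<le>8. block 1 (samp v u i))" for v u
  define star where "star v = (\<Union>u\<in>{u\<in>V. near v u}. arm v u)" for v
  have samp_rev: "samp v u i = samp u v (8 - i)" if "i \<le> 8" for u v i
    using that unfolding samp_def by (simp add: of_nat_diff field_simps)
  \<comment> \<open>An arm thus lies in the stars of both its ends, so a grid point on it belongs to
    two equal or adjacent vertices.\<close>
  have arm_rev: "arm v u \<subseteq> arm u v" for u v
    unfolding arm_def
  proof (rule UN_least)
    fix i :: nat assume "i \<in> {..8}"
    then have eq: "samp v u i = samp u v (8 - i)" by (intro samp_rev) simp
    show "block 1 (samp v u i) \<subseteq> (\<Union>i\<le>8. block 1 (samp u v i))"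
      unfolding eq by (rule UN_upper) simp
  qed
  have conn_arm: "conn grid (arm v u)" if "near v u" for u v
    unfolding arm_def
  proof (rule conn_block_chain)
    fix i
    have d: "fst (samp v u (Suc i)) - fst (samp v u i) = (x u - x v) / 8"
      "snd (samp v u (Suc i)) - snd (samp v u i) = (y u - y v) / 8"
      unfolding samp_def by (simp_all add: field_simps)
    have "\<bar>(x u - x v) / 8\<bar> \<le> 1" "\<bar>(y u - y v) / 8\<bar> \<le> 1"
      using near_abs[OF that] by (simp_all add: abs_minus_commute)
    then show "\<bar>fst (samp v u (Suc i)) - fst (samp v u i)\<bar> \<le> 1 \<and>
        \<bar>snd (samp v u (Suc i)) - snd (samp v u i)\<bar> \<le> 1"
      unfolding d by blast
  qed
  have centre: "block 1 (x v, y v) \<subseteq> arm v u" for u v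
    using UN_upper[of 0 "{..8}" "\<lambda>i. block 1 (samp v u i)"] unfolding arm_def by (simp add: samp_def)
  have centre_ne: "block 1 (x v, y v) \<noteq> {}" for v using block_Int_block[of "(x v, y v)" "(x v, y v)"] by auto
  have conn_star: "conn grid (star v)" if "v \<in> V" for v
  proof -
    have "conn grid (block 1 (x v, y v) \<union> (\<Union>u\<in>{u\<in>V. near v u}. arm v u))"
    proof (rule conn_UN[OF symp_grid])
      show "touch grid (block 1 (x v, y v)) (arm v u)" if "u \<in> {u\<in>V. near v u}" for u
        using centre[of v u] centre_ne[of v] unfolding touch_def by blast
    qed (use conn_arm in \<open>auto simp: block_eq conn_box\<close>)
    moreover have "block 1 (x v, y v) \<union> (\<Union>u\<in>{u\<in>V. near v u}. arm v u) = star v"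
      using centre[of v v] that near_refl unfolding star_def by blast
    ultimately show ?thesis by simp
  qed
  have star_ne: "star v \<noteq> {}" if "v \<in> V" for v
    using centre[of v v] centre_ne[of v] that near_refl unfolding star_def by blast
  have star_touch: "touch grid (star u) (star v)" if uv: "u \<in> V" "v \<in> V" "E u v" for u v
  proof -
    have nr: "near u v" "near v u" using E[of u v] uv near_sym unfolding near_def by auto
    then have "arm u v \<subseteq> star u" "arm u v \<subseteq> star v"
      using uv arm_rev[of u v] unfolding star_def by blast+
    then show ?thesis using centre[of u v] centre_ne[of u] unfolding touch_def by blast
  qed
  have star_box: "star v \<subseteq> block 9 (x v, y v)" for v
  proof
    fix z assume "z \<in> star v"
    then obtain u i where ui: "u \<in> V" "near v u" "i \<le> 8" "z \<in> block 1 (samp v u i)"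
      unfolding star_def arm_def by blast
    have "\<bar>real i / 8 * (x u - x v)\<bar> \<le> 1 * 8" "\<bar>real i / 8 * (y u - y v)\<bar> \<le> 1 * 8"
      unfolding abs_mult using ui(3) near_abs[OF ui(2)]
      by (intro mult_mono; simp add: abs_minus_commute)+
    then show "z \<in> block 9 (x v, y v)"
      using ui(4) unfolding block_def samp_def by (simp add: abs_le_iff)
  qed
  have fin_star: "finite (star v)" and card_star: "card (star v) \<le> 361" for v
    using star_box[of v] finite_block[of 9 "(x v, y v)"] card_block_9[of "(x v, y v)"]
      finite_subset card_mono[of "block 9 (x v, y v)" "star v"] by fastforce+
  define rel where "rel z = {v\<in>V. z \<in> star v}" for z
  \<comment> \<open>The sample points are within 1 of \<open>z\<close> and \<open>z'\<close>, and
    these within 1 of each other, so they differ by at most 3 per coordinate. As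
    \<open>2 * (9 + 9) \<le> 64\<close>, some ends of the two segments are near. With
    \<open>z = z'\<close> this makes \<open>rel z\<close> connected, with adjacent points it gives
    contact.\<close>
  have link: "\<exists>u t. u \<in> rel z \<and> t \<in> rel z' \<and> conn E {v, u} \<and> conn E {w, t} \<and> touch E {v, u} {w, t}"
    if vw: "v \<in> rel z" "w \<in> rel z'" and z: "\<bar>fst z - fst z'\<bar> \<le> 1" "\<bar>snd z - snd z'\<bar> \<le> 1" for v w z z'
  proof -
    obtain u i where ui: "u \<in> V" "near v u" "i \<le> 8" "z \<in> block 1 (samp v u i)" and v: "v \<in> V"
      using vw(1) unfolding rel_def star_def arm_def by blast
    obtain t j where tj: "t \<in> V" "near w t" "j \<le> 8" "z' \<in> block 1 (samp w t j)" and w: "w \<in> V"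
      using vw(2) unfolding rel_def star_def arm_def by blast
    have "z \<in> arm v u" "z' \<in> arm w t" using ui tj unfolding arm_def by blast+
    then have "z \<in> star u" "z' \<in> star t"
      using arm_rev[of v u] arm_rev[of w t] v w ui(2) tj(2) near_sym unfolding star_def by blast+
    then have rels: "u \<in> rel z" "t \<in> rel z'" using ui tj unfolding rel_def by blast+
    have pair: "conn E {a, b}" if "a \<in> V" "b \<in> V" "near a b" for a b
    proof -
      have "conn E ({a} \<union> {b})"
        by (rule conn_Un[OF sym]) (use nearE[OF that] in \<open>auto simp: touch_def\<close>)
      then show ?thesis by (simp add: insert_commute)
    qed
    let ?s = "real i / 8" and ?t = "real j / 8"
    have "\<bar>real_of_int (fst z) - real_of_int (fst z')\<bar> \<le> 1" "\<bar>real_of_int (snd z) - real_of_int (snd z')\<bar> \<le> 1"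
      using z by linarith+
    then have "\<bar>fst (samp v u i) - fst (samp w t j)\<bar> \<le> 3" "\<bar>snd (samp v u i) - snd (samp w t j)\<bar> \<le> 3"
      using ui(4) tj(4) unfolding block_def by (simp_all add: abs_le_iff; linarith)+
    then have "(fst (samp v u i) - fst (samp w t j))\<^sup>2 \<le> 3\<^sup>2" "(snd (samp v u i) - snd (samp w t j))\<^sup>2 \<le> 3\<^sup>2"
      by (simp_all only: abs_le_imp_square_le)
    then have "near v w \<or> near v t \<or> near u w \<or> near u t"
      unfolding near_def
      by (intro segments_close_imp_ends_close[where s = ?s and t = ?t])
        (use ui tj in \<open>auto simp: near_def samp_def\<close>)
    then have "touch E {v, u} {w, t}"
      using nearE v w ui(1) tj(1) unfolding touch_def by blast
    then show ?thesis using rels pair v w ui tj by blast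
  qed
  have conn_rel: "conn E (rel z)" for z
  proof (cases "rel z = {}")
    case False
    then obtain v where v: "v \<in> rel z" by blast
    define \<D> where "\<D> = {D. D \<subseteq> rel z \<and> conn E D \<and> v \<in> D}"
    have "rel z \<subseteq> {v} \<union> (\<Union>D\<in>\<D>. D)"
    proof
      fix w assume w: "w \<in> rel z"
      obtain u t where ut: "u \<in> rel z" "t \<in> rel z" "conn E {v, u}" "conn E {w, t}" "touch E {v, u} {w, t}"
        using link[OF v w] by auto
      then have "{v, u} \<union> {w, t} \<in> \<D>" unfolding \<D>_def using conn_Un[OF sym ut(3-5)] v w by blast
      then show "w \<in> {v} \<union> (\<Union>D\<in>\<D>. D)" by blast
    qed
    then have "rel z = {v} \<union> (\<Union>D\<in>\<D>. D)" using v unfolding \<D>_def by blast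
    moreover have "conn E ({v} \<union> (\<Union>D\<in>\<D>. D))"
      by (rule conn_UN[OF sym]) (auto simp: \<D>_def touch_def)
    ultimately show ?thesis by simp
  qed simp
  define Q where "Q = (\<Union>v\<in>V. star v)"
  define XQ where "XQ = (\<Union>v\<in>X. star v)"
  have finQ: "finite Q" unfolding Q_def using V fin_star by blast
  have XQ: "XQ \<subseteq> Q" unfolding XQ_def Q_def using X by blast
  have finX: "finite X" using X V finite_subset by blast
  have cXQ: "card XQ \<le> 361 * card X"
  proof -
    have "card XQ \<le> (\<Sum>v\<in>X. card (star v))" unfolding XQ_def by (rule card_UN_le[OF finX])
    also have "\<dots> \<le> (\<Sum>v\<in>X. 361)" by (rule sum_mono) (rule card_star)
    finally show ?thesis by simp
  qed
  \<comment> \<open>A grid point outside \<open>XQ\<close> lies on no star of \<open>X\<close>, so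
    its \<open>rel\<close> set avoids \<open>X\<close>.\<close>
  have "\<exists>R. td grid (361 * k) (Q - XQ) R"
  proof (rule td_transfer[OF td sym, where rel = rel])
    fix z assume z: "z \<in> Q - XQ"
    then show "conn E (rel z) \<and> rel z \<subseteq> V - X \<and> rel z \<noteq> {}"
      using conn_rel unfolding rel_def Q_def XQ_def by blast
    fix z' assume z': "z' \<in> Q - XQ" "grid z z'"
    then obtain v w where vw: "v \<in> rel z" "w \<in> rel z'" using z unfolding rel_def Q_def by blast
    have "\<bar>fst z - fst z'\<bar> \<le> 1" "\<bar>snd z - snd z'\<bar> \<le> 1" using z'(2) unfolding grid_def by linarith+
    then obtain u t where ut: "u \<in> rel z" "t \<in> rel z'" "touch E {v, u} {w, t}"
      using link[OF vw] by blast
    then show "touch E (rel z) (rel z')" using vw unfolding touch_def by blast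
  next
    fix v
    have "{z \<in> Q - XQ. v \<in> rel z} \<subseteq> star v" unfolding rel_def by blast
    then show "finite {z \<in> Q - XQ. v \<in> rel z} \<and> card {z \<in> Q - XQ. v \<in> rel z} \<le> 361"
      using fin_star[of v] card_star[of v] finite_subset[OF _ fin_star[of v]] card_mono[OF fin_star[of v]]
      by (meson order_trans)
  qed
  then obtain R1 where R1: "td grid (361 * k) (Q - XQ) R1" by blast
  have "1 \<le> 361 * k" using k by simp
  then obtain R2 where "td grid (361 * k + nat \<lfloor>4 * sep_const (361 * k) * sqrt (card XQ)\<rfloor>) Q R2"
    using grid_td_sqrt[OF _ finQ XQ R1] by blast
  moreover have "4 * sep_const (361 * k) * sqrt (card XQ) \<le> 4 * sep_const (361 * k) * sqrt (361 * card X)"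
    using cXQ sep_const_nonneg[of "361 * k"] by (intro mult_left_mono) auto
  then have "361 * k + nat \<lfloor>4 * sep_const (361 * k) * sqrt (card XQ)\<rfloor> \<le>
      361 * k + nat \<lfloor>4 * sep_const (361 * k) * sqrt (361 * card X)\<rfloor>"
    by (intro add_left_mono nat_mono floor_mono)
  ultimately have R2: "td grid (361 * k + nat \<lfloor>4 * sep_const (361 * k) * sqrt (361 * card X)\<rfloor>) Q R2"
    by (rule td_mono)
  show ?thesis
  proof (rule td_transfer[OF R2 symp_grid, where rel = star])
    fix v assume v: "v \<in> V"
    then show "conn grid (star v) \<and> star v \<subseteq> Q \<and> star v \<noteq> {}"
      using conn_star star_ne unfolding Q_def by blast
    fix w assume "w \<in> V" "E v w"
    then show "touch grid (star v) (star w)" using star_touch v by blast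
  next
    fix z
    let ?A = "{v \<in> V. z \<in> star v}"
    \<comment> \<open>Two points in a cell of side 5 have squared distance at most 50, so a cell
      holds a clique of at most \<open>\<Delta> + 1\<close> vertices. Centres within 9 of
      \<open>z\<close> meet at most five cell indices in each direction.\<close>
    let ?cell = "\<lambda>v. (\<lfloor>x v / 5\<rfloor>, \<lfloor>y v / 5\<rfloor>)"
    let ?l = "\<lambda>a::int. \<lfloor>(real_of_int a - 9) / 5\<rfloor>"
    let ?B = "{?l (fst z)..?l (fst z) + 4} \<times> {?l (snd z)..?l (snd z) + 4}"
    have "card ?A \<le> card ?B * (\<Delta> + 1)"
    proof (rule card_le_fibres[where f = ?cell])
      show "finite ?A" using V by simp
      have rng: "\<lfloor>b / 5\<rfloor> \<in> {?l a..?l a + 4}" if "\<bar>real_of_int a - b\<bar> \<le> 9" for a :: int and b :: real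
      proof -
        have "(real_of_int a - 9) / 5 \<le> b / 5" "b / 5 \<le> (real_of_int a - 9) / 5 + 18 / 5"
          using that by (simp_all add: abs_le_iff field_simps)
        then have "?l a \<le> \<lfloor>b / 5\<rfloor>" "\<lfloor>b / 5\<rfloor> \<le> ?l a + 4" by linarith+
        then show ?thesis by simp
      qed
      show "?cell ` ?A \<subseteq> ?B"
      proof (rule image_subsetI)
        fix v assume "v \<in> ?A"
        then have "z \<in> block 9 (x v, y v)" using star_box by blast
        then show "?cell v \<in> ?B" using rng unfolding block_def by auto
      qed
      fix b assume "b \<in> ?B"
      show "card {v \<in> ?A. ?cell v = b} \<le> \<Delta> + 1"
      proof (cases "{v \<in> ?A. ?cell v = b} = {}")
        case False
        then obtain v where v: "v \<in> ?A" "?cell v = b" by blast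
        have "{v \<in> ?A. ?cell v = b} \<subseteq> insert v {u\<in>V. E v u}"
        proof
          fix u assume u: "u \<in> {v \<in> ?A. ?cell v = b}"
          then have "\<lfloor>x u / 5\<rfloor> = \<lfloor>x v / 5\<rfloor>" "\<lfloor>y u / 5\<rfloor> = \<lfloor>y v / 5\<rfloor>" using v by auto
          then have "\<bar>x v - x u\<bar> \<le> 5" "\<bar>y v - y u\<bar> \<le> 5" by linarith+
          then have "(x v - x u)\<^sup>2 \<le> 5\<^sup>2" "(y v - y u)\<^sup>2 \<le> 5\<^sup>2" by (simp_all only: abs_le_imp_square_le)
          then have "near v u" unfolding near_def by simp
          then show "u \<in> insert v {u\<in>V. E v u}" using nearE[of v u] u v by blast
        qed
        then have "card {v \<in> ?A. ?cell v = b} \<le> card (insert v {u\<in>V. E v u})"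
          using V by (intro card_mono) auto
        also have "\<dots> \<le> \<Delta> + 1" using deg[of v] v V by (simp add: card_insert_if)
        finally show ?thesis .
      qed (simp only: card.empty)
    qed simp
    then show "finite ?A \<and> card ?A \<le> 25 * (\<Delta> + 1)" using V by (simp add: card_cartesian_product)
  qed
qed

section \<open>Unit disks and the final estimate\<close>

lemma cball_1_Int_iff:
  fixes a b :: "'a::euclidean_space"
  shows "cball a 1 \<inter> cball b 1 \<noteq> {} \<longleftrightarrow> dist a b \<le> 2"
proof
  assume "cball a 1 \<inter> cball b 1 \<noteq> {}"
  then obtain z where "dist a z \<le> 1" "dist b z \<le> 1" by (auto simp: mem_cball)
  then show "dist a b \<le> 2" using dist_triangle2[of a b z] by simp
next
  assume "dist a b \<le> 2"
  then have "midpoint a b \<in> cball a 1 \<inter> cball b 1" by (simp add: dist_midpoint)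
  then show "cball a 1 \<inter> cball b 1 \<noteq> {}" by blast
qed

text \<open>Scaling the centres by 4 turns the threshold 2 into the threshold 8 of
  \<open>disk_graph_td\<close>.\<close>

lemma dist_le_2_iff:
  fixes a b :: "real ^ 2"
  shows "dist a b \<le> 2 \<longleftrightarrow> (4 * a $ 1 - 4 * b $ 1)\<^sup>2 + (4 * a $ 2 - 4 * b $ 2)\<^sup>2 \<le> 64"
proof -
  have "dist a b \<le> 2 \<longleftrightarrow> (a $ 1 - b $ 1)\<^sup>2 + (a $ 2 - b $ 2)\<^sup>2 \<le> 2\<^sup>2"
  proof -
    have "dist a b = sqrt ((a $ 1 - b $ 1)\<^sup>2 + (a $ 2 - b $ 2)\<^sup>2)"
      by (simp add: dist_vec_def L2_set_def sum_2 dist_real_def)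
    moreover have "sqrt s \<le> 2 \<longleftrightarrow> s \<le> 2\<^sup>2" for s
      using real_sqrt_le_iff[of s 4] by simp
    ultimately show ?thesis by simp
  qed
  also have "\<dots> \<longleftrightarrow> (4 * a $ 1 - 4 * b $ 1)\<^sup>2 + (4 * a $ 2 - 4 * b $ 2)\<^sup>2 \<le> 64"
  proof -
    have "(4 * p - 4 * q)\<^sup>2 = 16 * (p - q)\<^sup>2" for p q :: real by (simp add: power2_eq_square algebra_simps)
    then show ?thesis by auto
  qed
  finally show ?thesis .
qed

theorem theorem1:
  fixes \<Delta> :: nat
  shows "truly_sublinear_treewidth
           (unit_disk_graphs_max_degree \<Delta> :: ('a, 'b) pre_digraph set) (1 / 2)"
  unfolding truly_sublinear_treewidth_def
proof (intro conjI allI impI)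
  fix \<eta> :: real
  assume \<eta>: "\<eta> > 0"
  \<comment> \<open>An integer width of at most \<open>\<eta>\<close> is at most
    \<open>k - 1\<close>, which means bags of size at most \<open>k\<close>.\<close>
  define k where "k = nat \<lfloor>\<eta>\<rfloor> + 1"
  \<comment> \<open>76 is \<open>4 * 19\<close>, with 19 the square root of the factor 361 inside
    the root.\<close>
  define \<sigma> where "\<sigma> = 361 * real k + 76 * sep_const (361 * k)"
  define \<beta> where "\<beta> = 25 * (real \<Delta> + 1) * \<sigma>"
  have \<sigma>: "\<sigma> > 0" unfolding \<sigma>_def k_def using sep_const_nonneg by (intro add_pos_nonneg) auto
  have \<beta>: "\<beta> > 0" unfolding \<beta>_def using \<sigma> by simp
  show "\<exists>\<beta>>0. \<forall>G\<in>unit_disk_graphs_max_degree \<Delta> :: ('a, 'b) pre_digraph set. \<forall>X. X \<subseteq> verts G \<longrightarrow>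
      real_of_int (treewidth (delete_verts G X)) \<le> \<eta> \<longrightarrow>
      real_of_int (treewidth G) \<le> \<eta> + \<beta> * real (card X) powr (1 / 2)"
  proof (rule exI[of _ \<beta>], intro conjI ballI allI impI \<beta>)
    fix G :: "('a, 'b) pre_digraph" and X
    assume "G \<in> unit_disk_graphs_max_degree \<Delta>" and X: "X \<subseteq> verts G"
      and tw: "real_of_int (treewidth (delete_verts G X)) \<le> \<eta>"
    then have "unit_disk_graph G" and od: "\<And>v. v \<in> verts G \<Longrightarrow> out_degree G v \<le> \<Delta>"
      unfolding unit_disk_graphs_max_degree_def by auto
    then obtain c :: "'a \<Rightarrow> real ^ 2" where G: "graph G"
      and c: "\<And>u v. u \<in> verts G \<Longrightarrow> v \<in> verts G \<Longrightarrow>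
        u \<rightarrow>\<^bsub>G\<^esub> v \<longleftrightarrow> u \<noteq> v \<and> cball (c u) 1 \<inter> cball (c v) 1 \<noteq> {}"
      unfolding unit_disk_graph_def by blast
    interpret graph G by fact
    have finX: "finite X" using X finite_verts finite_subset by blast
    show "real_of_int (treewidth G) \<le> \<eta> + \<beta> * real (card X) powr (1 / 2)"
    proof (cases "X = {}")
      \<comment> \<open>The right-hand side is just \<open>\<eta>\<close> here, so no constant
        factor could be afforded.\<close>
      case True
      then show ?thesis using tw induce_verts[OF wf_digraph] by (simp add: delete_verts_def)
    next
      case False
      let ?H = "delete_verts G X" and ?n = "card X"
      have n1: "1 \<le> sqrt ?n" using False finX by (simp add: Suc_le_eq card_gt_0_iff)
      have sub: "induced_subgraph ?H G" unfolding delete_verts_def by (rule induced_induce) blast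
      have H: "graph ?H"
      proof -
        interpret H: digraph ?H by (rule digraphI_induced[OF sub])
        show ?thesis by (rule H.graphI) (rule induced_graph_imp_symmetric[OF sym_arcs sub])
      qed
      have "treewidth ?H \<le> int k - 1" using tw \<eta> unfolding k_def by linarith
      then obtain R where "td (dominates ?H) k (verts ?H) R"
        using treewidth_le_imp_td[OF H] by blast
      then obtain R1 where R1: "td (dominates G) k (verts G - X) R1"
        using td_subgraph[OF _ symp_dominates[OF H], of k "verts ?H" R "verts G - X" "dominates G"]
        unfolding delete_verts_def by (auto simp: dominates_induce)
      have "card {u \<in> verts G. v \<rightarrow>\<^bsub>G\<^esub> u} \<le> \<Delta>" if "v \<in> verts G" for v
      proof -
        have "{u \<in> verts G. v \<rightarrow>\<^bsub>G\<^esub> u} \<subseteq> head G ` out_arcs G v" by (auto simp: arcs_ends_conv)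
        then have "card {u \<in> verts G. v \<rightarrow>\<^bsub>G\<^esub> u} \<le> card (head G ` out_arcs G v)"
          using finite_out_arcs by (intro card_mono) auto
        also have "\<dots> \<le> out_degree G v" unfolding out_degree_def using finite_out_arcs by (rule card_image_le)
        finally show ?thesis using od[OF that] by simp
      qed
      then have "\<exists>R. td (dominates G) (25 * (\<Delta> + 1) *
          (361 * k + nat \<lfloor>4 * sep_const (361 * k) * sqrt (361 * ?n)\<rfloor>)) (verts G) R"
        by (intro disk_graph_td[OF finite_verts symp_dominates[OF G] _ _ X R1,
              where x = "\<lambda>v. 4 * c v $ 1" and y = "\<lambda>v. 4 * c v $ 2"])
          (simp_all add: c cball_1_Int_iff dist_le_2_iff k_def)
      moreover define m where "m = nat \<lfloor>4 * sep_const (361 * k) * sqrt (361 * ?n)\<rfloor>"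
      ultimately obtain R2 where R2: "td (dominates G) (25 * (\<Delta> + 1) * (361 * k + m)) (verts G) R2"
        by blast
      have "real_of_int (treewidth G) \<le> real (25 * (\<Delta> + 1) * (361 * k + m))"
        using td_imp_treewidth_le[OF G R2] by linarith
      also have "\<dots> = 25 * (real \<Delta> + 1) * (361 * real k + real m)" by simp
      also have "\<dots> \<le> 25 * (real \<Delta> + 1) * (\<sigma> * sqrt ?n)"
      proof (rule mult_left_mono)
        have "sqrt (361 :: real) = 19" by (rule real_sqrt_unique) auto
        then have "sqrt (361 * ?n) = 19 * sqrt ?n" by (simp add: real_sqrt_mult)
        then have "real m \<le> 76 * sep_const (361 * k) * sqrt ?n"
          using sep_const_nonneg[of "361 * k"] of_nat_floor[of "4 * sep_const (361 * k) * sqrt (361 * ?n)"]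
          unfolding m_def by (simp add: mult.assoc)
        \<comment> \<open>As \<open>X\<close> is nonempty, its root is at least 1 and absorbs the
          additive width term.\<close>
        moreover have "361 * real k \<le> 361 * real k * sqrt ?n"
          using mult_left_mono[OF n1, of "361 * real k"] by simp
        ultimately show "361 * real k + real m \<le> \<sigma> * sqrt ?n"
          unfolding \<sigma>_def by (simp add: algebra_simps)
      qed simp
      also have "\<dots> = \<beta> * real ?n powr (1 / 2)" unfolding \<beta>_def by (simp add: powr_half_sqrt)
      finally show ?thesis using \<eta> by linarith
    qed
  qed
qed simp_all

end
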